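(* Let $\mathcal{L}$ be a left bialgebroid over $B$ which admits a faithfully flat skew regular left $\mathcal{L}$-Galois extension $N\subseteq P$. Then $\mathcal{L}$ is an anti-left Hopf algebroid. More precisely, for all $X\in\mathcal{L}$, $$X_{[+]}\otimes 1\otimes X_{[-]}=X^{<1>}{}_{[0](-1)}\otimes X^{<1>}{}_{[0](0)}X^{<2>}\otimes X^{<1>}{}_{[1]}$$ in the quotient of $\mathcal{L}\otimes P\otimes\mathcal{L}$ by the relations $\bar aY\otimes p\otimes Z=Y\otimes ap\otimes Z$ and $Yb\otimes p\otimes Z=Y\otimes p\otimes bZ$ ($a,b\in B$).
   Context: $k$ is a field, $B$ a unital $k$-algebra, $\overline B$ its opposite algebra with canonical anti-isomorphism $B\to\overline B$, $b\mapsto\bar b$, and $B^e=B\otimes\overline B$. $M\diamond_B N:=M\otimes N/\langle \bar bm\otimes n-m\otimes bn\rangle$; $M\times_BN:=\{\sum m_i\otimes n_i\in M\diamond_BN:\ \sum m_i\bar a\otimes n_i=\sum m_i\otimes n_ia\ \forall a\in B\}$; $M\otimes^BN:=M\otimes N/\langle bm\otimes n-m\otimes nb\rangle$. A $B$-ring is an algebra $P$ with an algebra map $B\to P$. A left bialgebroid over $B$ is an algebra $\mathcal{L}$ with algebra maps $s:B\to\mathcal{L}$, $t:\overline B\to\mathcal{L}$ with commuting images (one writes $b,\bar b$ for $s(b),t(\bar b)$), with left $B^e$-module maps $\Delta:\mathcal{L}\to\mathcal{L}\times_B\mathcal{L}$, $\Delta(X)=X_{(1)}\otimes X_{(2)}$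 (so $\Delta(b\bar cX)=bX_{(1)}\otimes\bar cX_{(2)}$) and $\varepsilon:\mathcal{L}\to B$ (so $\varepsilon(b\bar cX)=b\varepsilon(X)c$), coassociative and counital ($\varepsilon(X_{(1)})X_{(2)}=\overline{\varepsilon(X_{(2)})}X_{(1)}=X$), such that $\Delta$ is an algebra map (componentwise product on $\mathcal{L}\times_B\mathcal{L}$), $\varepsilon(1)=1$ and $\varepsilon(X\varepsilon(Y))=\varepsilon(XY)=\varepsilon(X\overline{\varepsilon(Y)})$. Standing assumption: all $B$-module and $\overline B$-module structures are faithfully flat. $\mathcal{L}$ is an anti-left Hopf algebroid if $\mu:\mathcal{L}\otimes^B\mathcal{L}\to\mathcal{L}\diamond_B\mathcal{L}$, $\mu(X\otimes Y)=Y_{(1)}X\otimes Y_{(2)}$, is bijective; one writes $X_{[-]}\otimes^BX_{[+]}:=\mu^{-1}(1\diamond X)$. A left $\mathcal{L}$-comodule is a $B$-bimodule $\Gamma$ with a coassociative, counital ($\varepsilon(p_{(-1)})p_{(0)}=p$) map $\Gamma\to\mathcal{L}\times_B\Gamma$, $p\mapsto p_{(-1)}\otimes p_{(0)}$, with $bpb'\mapsto bp_{(-1)}b'\otimes p_{(0)}$. It is skew regular if $\phi:\mathcal{L}\otimes^B\Gamma\to\mathcal{L}\diamond_B\Gamma$, $X\otimes p\mapsto p_{(-1)}X\otimes p_{(0)}$, is bijective; then $p_{[1]}\otimes^Bp_{[0]}:=\phi^{-1}(1\diamond p)$. A left $\mathcal{L}$-comodule algebra is a $B$-ring $P$ that is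 a left $\mathcal{L}$-comodule (with the $B$-bimodule structure of the $B$-ring) whose coaction $P\to\mathcal{L}\times_BP$ is a map of $B$-rings. With $N={}^{co\mathcal{L}}P=\{p: p_{(-1)}\otimes p_{(0)}=1\otimes p\}$, $N\subseteq P$ is a left $\mathcal{L}$-Galois extension if ${}^L\mathrm{can}:P\otimes_NP\to\mathcal{L}\diamond_BP$, $p\otimes q\mapsto p_{(-1)}\otimes p_{(0)}q$, is bijective; then $X^{<1>}\otimes_NX^{<2>}:=({}^L\mathrm{can})^{-1}(X\diamond1)$. It is called skew regular if $P$ is a skew regular comodule, and faithfully flat if $P$ is a faithfully flat left $N$-module. *)

theory Defs
  imports "HOL-Algebra.Module" "HOL-Algebra.Free_Abelian_Groups"
begin

section \<open>Algebras and modules over noncommutative rings\<close>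

text \<open>The library's \<open>algebra\<close> is commutative; here only the ground ring is.\<close>

definition k_algebra :: "'k ring \<Rightarrow> ('k, 'a) module \<Rightarrow> bool" where
  "k_algebra k A \<longleftrightarrow> ring A \<and> module k A \<and>
    (\<forall>c\<in>carrier k. \<forall>x\<in>carrier A. \<forall>y\<in>carrier A.
       (c \<odot>\<^bsub>A\<^esub> x) \<otimes>\<^bsub>A\<^esub> y = c \<odot>\<^bsub>A\<^esub> (x \<otimes>\<^bsub>A\<^esub> y) \<and>
       x \<otimes>\<^bsub>A\<^esub> (c \<odot>\<^bsub>A\<^esub> y) = c \<odot>\<^bsub>A\<^esub> (x \<otimes>\<^bsub>A\<^esub> y))"

definition k_alg_hom :: "'k ring \<Rightarrow> ('k, 'a) module \<Rightarrow> ('k, 'c) module \<Rightarrow> ('a \<Rightarrow> 'c) set" where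
  "k_alg_hom k A C =
    {f \<in> ring_hom A C. \<forall>c\<in>carrier k. \<forall>x\<in>carrier A. f (c \<odot>\<^bsub>A\<^esub> x) = c \<odot>\<^bsub>C\<^esub> f x}"

text \<open>The canonical anti-isomorphism onto the opposite ring is the identity on elements.\<close>

definition opp :: "('a, 'z) ring_scheme \<Rightarrow> ('a, 'z) ring_scheme" where
  "opp R = R\<lparr>mult := (\<lambda>x y. y \<otimes>\<^bsub>R\<^esub> x)\<rparr>"

text \<open>Right \<open>R\<close>-modules are left modules over \<open>opp R\<close>. Multiplication and unit of the record
  \<open>M\<close> play no role.\<close>

definition left_mod :: "('r, 'z) ring_scheme \<Rightarrow> ('r, 'm, 'y) module_scheme \<Rightarrow> bool" where
  "left_mod R M \<longleftrightarrow> ring R \<and> abelian_group M \<and>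
    (\<forall>r\<in>carrier R. \<forall>x\<in>carrier M. r \<odot>\<^bsub>M\<^esub> x \<in> carrier M) \<and>
    (\<forall>r\<in>carrier R. \<forall>r'\<in>carrier R. \<forall>x\<in>carrier M.
       (r \<oplus>\<^bsub>R\<^esub> r') \<odot>\<^bsub>M\<^esub> x = r \<odot>\<^bsub>M\<^esub> x \<oplus>\<^bsub>M\<^esub> r' \<odot>\<^bsub>M\<^esub> x \<and>
       (r \<otimes>\<^bsub>R\<^esub> r') \<odot>\<^bsub>M\<^esub> x = r \<odot>\<^bsub>M\<^esub> (r' \<odot>\<^bsub>M\<^esub> x)) \<and>
    (\<forall>r\<in>carrier R. \<forall>x\<in>carrier M. \<forall>y\<in>carrier M.
       r \<odot>\<^bsub>M\<^esub> (x \<oplus>\<^bsub>M\<^esub> y) = r \<odot>\<^bsub>M\<^esub> x \<oplus>\<^bsub>M\<^esub> r \<odot>\<^bsub>M\<^esub> y) \<and>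
    (\<forall>x\<in>carrier M. \<one>\<^bsub>R\<^esub> \<odot>\<^bsub>M\<^esub> x = x)"

definition lin_hom ::
  "('r, 'z) ring_scheme \<Rightarrow> ('r, 'm, 'y) module_scheme \<Rightarrow> ('r, 'n, 'x) module_scheme \<Rightarrow> ('m \<Rightarrow> 'n) set"
  where
  "lin_hom R M N = {f \<in> hom (add_monoid M) (add_monoid N).
     \<forall>r\<in>carrier R. \<forall>x\<in>carrier M. f (r \<odot>\<^bsub>M\<^esub> x) = r \<odot>\<^bsub>N\<^esub> f x}"

definition with_action :: "('a, 'z) ring_scheme \<Rightarrow> ('r \<Rightarrow> 'a \<Rightarrow> 'a) \<Rightarrow> ('r, 'a) module" where
  "with_action M act =
    \<lparr>carrier = carrier M, mult = mult M, one = one M,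
     ring.zero = ring.zero M, add = add M, smult = act\<rparr>"


section \<open>Tensor products\<close>

text \<open>The abelian group generated by \<open>S\<close>, with the elements of \<open>A\<close> set to \<open>0\<close>, and the two
  generators of each pair in \<open>I\<close> identified. It is written multiplicatively, as the groups of
  the library are.\<close>

definition presented ::
  "'x set \<Rightarrow> ('x \<Rightarrow>\<^sub>0 int) set \<Rightarrow> ('x \<times> 'x) set \<Rightarrow> ('x \<Rightarrow>\<^sub>0 int) set monoid" where
  "presented S A I = free_Abelian_group S Mod
     generate (free_Abelian_group S) (A \<union> {frag_of x - frag_of y | x y. (x, y) \<in> I})"

definition tensor2 ::
  "('m, 'y) ring_scheme \<Rightarrow> ('n, 'z) ring_scheme \<Rightarrow> (('m \<times> 'n) \<times> ('m \<times> 'n)) set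
     \<Rightarrow> (('m \<times> 'n) \<Rightarrow>\<^sub>0 int) set monoid" where
  "tensor2 M N I = presented (carrier M \<times> carrier N)
     ({frag_of (x \<oplus>\<^bsub>M\<^esub> x', y) - frag_of (x, y) - frag_of (x', y) | x x' y.
         x \<in> carrier M \<and> x' \<in> carrier M \<and> y \<in> carrier N} \<union>
      {frag_of (x, y \<oplus>\<^bsub>N\<^esub> y') - frag_of (x, y) - frag_of (x, y') | x y y'.
         x \<in> carrier M \<and> y \<in> carrier N \<and> y' \<in> carrier N}) I"

definition tensor3 ::
  "('m, 'y) ring_scheme \<Rightarrow> ('n, 'z) ring_scheme \<Rightarrow> ('q, 'w) ring_scheme
     \<Rightarrow> (('m \<times> 'n \<times> 'q) \<times> ('m \<times> 'n \<times> 'q)) set \<Rightarrow> (('m \<times> 'n \<times> 'q) \<Rightarrow>\<^sub>0 int) set monoid" where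
  "tensor3 M N Q I = presented (carrier M \<times> carrier N \<times> carrier Q)
     ({frag_of (x \<oplus>\<^bsub>M\<^esub> x', y, z) - frag_of (x, y, z) - frag_of (x', y, z) | x x' y z.
         x \<in> carrier M \<and> x' \<in> carrier M \<and> y \<in> carrier N \<and> z \<in> carrier Q} \<union>
      {frag_of (x, y \<oplus>\<^bsub>N\<^esub> y', z) - frag_of (x, y, z) - frag_of (x, y', z) | x y y' z.
         x \<in> carrier M \<and> y \<in> carrier N \<and> y' \<in> carrier N \<and> z \<in> carrier Q} \<union>
      {frag_of (x, y, z \<oplus>\<^bsub>Q\<^esub> z') - frag_of (x, y, z) - frag_of (x, y, z') | x y z z'.
         x \<in> carrier M \<and> y \<in> carrier N \<and> z \<in> carrier Q \<and> z' \<in> carrier Q}) I"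

definition bal2 ::
  "'k ring \<Rightarrow> ('k, 'm, 'y) module_scheme \<Rightarrow> ('k, 'n, 'z) module_scheme
     \<Rightarrow> (('m \<times> 'n) \<times> ('m \<times> 'n)) set" where
  "bal2 k M N = {((c \<odot>\<^bsub>M\<^esub> x, y), (x, c \<odot>\<^bsub>N\<^esub> y)) | c x y.
     c \<in> carrier k \<and> x \<in> carrier M \<and> y \<in> carrier N}"

definition bal3 ::
  "'k ring \<Rightarrow> ('k, 'm, 'y) module_scheme \<Rightarrow> ('k, 'n, 'z) module_scheme \<Rightarrow> ('k, 'q, 'w) module_scheme
     \<Rightarrow> (('m \<times> 'n \<times> 'q) \<times> ('m \<times> 'n \<times> 'q)) set" where
  "bal3 k M N Q =
     {((c \<odot>\<^bsub>M\<^esub> x, y, z), (x, c \<odot>\<^bsub>N\<^esub> y, z)) | c x y z.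
        c \<in> carrier k \<and> x \<in> carrier M \<and> y \<in> carrier N \<and> z \<in> carrier Q} \<union>
     {((x, c \<odot>\<^bsub>N\<^esub> y, z), (x, y, c \<odot>\<^bsub>Q\<^esub> z)) | c x y z.
        c \<in> carrier k \<and> x \<in> carrier M \<and> y \<in> carrier N \<and> z \<in> carrier Q}"

text \<open>The pure tensor \<open>x\<^sub>1 \<otimes> x\<^sub>2\<close>, or \<open>x\<^sub>1 \<otimes> x\<^sub>2 \<otimes> x\<^sub>3\<close>, given by the tuple \<open>x\<close>.\<close>

definition pure :: "('x \<Rightarrow>\<^sub>0 int) set monoid \<Rightarrow> 'x \<Rightarrow> ('x \<Rightarrow>\<^sub>0 int) set" where
  "pure T x = (THE U. U \<in> carrier T \<and> frag_of x \<in> U)"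

definition free_eval :: "('g, 'z) monoid_scheme \<Rightarrow> ('x \<Rightarrow> 'g) \<Rightarrow> ('x \<Rightarrow>\<^sub>0 int) \<Rightarrow> 'g" where
  "free_eval G h c = finprod G (\<lambda>x. h x [^]\<^bsub>G\<^esub> Poly_Mapping.lookup c x) (Poly_Mapping.keys c)"

text \<open>Sweedler sums: for \<open>U = \<Sum>\<^sub>i x\<^sub>i \<otimes> y\<^sub>i\<close>, the element \<open>tsum G U (\<lambda>(x, y). h x y)\<close> is
  \<open>\<Sum>\<^sub>i h x\<^sub>i y\<^sub>i\<close>, computed in the abelian group \<open>G\<close>. It is the common value over all
  representatives of \<open>U\<close>, hence meaningful only where this value is independent of the
  representative; this holds in every use below.\<close>

definition tsum :: "('g, 'z) monoid_scheme \<Rightarrow> ('x \<Rightarrow>\<^sub>0 int) set \<Rightarrow> ('x \<Rightarrow> 'g) \<Rightarrow> 'g" where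
  "tsum G U h = the_elem (free_eval G h ` U)"


section \<open>Faithful flatness\<close>

text \<open>\<open>X \<otimes>\<^sub>R M\<close> for a right module \<open>X\<close> and a left module \<open>M\<close>.\<close>

definition ring_tensor ::
  "('r, 'z) ring_scheme \<Rightarrow> ('r, 'u, 'y) module_scheme \<Rightarrow> ('r, 'm, 'x) module_scheme
     \<Rightarrow> (('u \<times> 'm) \<Rightarrow>\<^sub>0 int) set monoid" where
  "ring_tensor R X M = tensor2 X M {((r \<odot>\<^bsub>X\<^esub> x, m), (x, r \<odot>\<^bsub>M\<^esub> m)) | r x m.
     r \<in> carrier R \<and> x \<in> carrier X \<and> m \<in> carrier M}"

text \<open>The left \<open>R\<close>-module \<open>M\<close> is faithfully flat: a sequence \<open>X \<rightarrow> Y \<rightarrow> Z\<close> of right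
  \<open>R\<close>-modules is exact iff \<open>X \<otimes>\<^sub>R M \<rightarrow> Y \<otimes>\<^sub>R M \<rightarrow> Z \<otimes>\<^sub>R M\<close> is. The sequences range over the modules
  whose elements lie in a universe \<open>'u\<close>. Flatness is detected on the inclusions of right ideals
  of \<open>R\<close>, faithfulness on the cyclic modules \<open>R/I\<close>; so every universe into which \<open>R\<close>
  injects gives the usual notion.\<close>

definition faithfully_flat ::
  "'u itself \<Rightarrow> ('r, 'z) ring_scheme \<Rightarrow> ('r, 'm) module \<Rightarrow> bool" where
  "faithfully_flat u R M \<longleftrightarrow> left_mod R M \<and>
    (\<forall>(X :: ('r, 'u) module) (Y :: ('r, 'u) module) (Z :: ('r, 'u) module) f g.
       left_mod (opp R) X \<and> left_mod (opp R) Y \<and> left_mod (opp R) Z \<and>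
       f \<in> lin_hom (opp R) X Y \<and> g \<in> lin_hom (opp R) Y Z \<longrightarrow>
       (kernel (add_monoid Y) (add_monoid Z) g = f ` carrier X \<longleftrightarrow>
        kernel (ring_tensor R Y M) (ring_tensor R Z M)
          (\<lambda>U. tsum (ring_tensor R Z M) U (\<lambda>(y, m). pure (ring_tensor R Z M) (g y, m)))
        = (\<lambda>U. tsum (ring_tensor R Y M) U (\<lambda>(x, m). pure (ring_tensor R Y M) (f x, m)))
            ` carrier (ring_tensor R X M)))"


section \<open>Bialgebroids and the products over the base\<close>

record ('k, 'b, 'g) bimodule = "('k, 'g) module" +
  lact :: "'b \<Rightarrow> 'g \<Rightarrow> 'g"
  ract :: "'g \<Rightarrow> 'b \<Rightarrow> 'g"

definition k_bimodule :: "'k ring \<Rightarrow> ('k, 'b) module \<Rightarrow> ('k, 'b, 'g) bimodule \<Rightarrow> bool" where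
  "k_bimodule k B \<Gamma> \<longleftrightarrow> module k \<Gamma> \<and>
    left_mod B (with_action \<Gamma> (lact \<Gamma>)) \<and>
    left_mod (opp B) (with_action \<Gamma> (\<lambda>b p. ract \<Gamma> p b)) \<and>
    (\<forall>b\<in>carrier B. \<forall>b'\<in>carrier B. \<forall>p\<in>carrier \<Gamma>.
       ract \<Gamma> (lact \<Gamma> b p) b' = lact \<Gamma> b (ract \<Gamma> p b')) \<and>
    (\<forall>c\<in>carrier k. \<forall>p\<in>carrier \<Gamma>.
       lact \<Gamma> (c \<odot>\<^bsub>B\<^esub> \<one>\<^bsub>B\<^esub>) p = c \<odot>\<^bsub>\<Gamma>\<^esub> p \<and> ract \<Gamma> p (c \<odot>\<^bsub>B\<^esub> \<one>\<^bsub>B\<^esub>) = c \<odot>\<^bsub>\<Gamma>\<^esub> p)"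

text \<open>The bimodule underlying a \<open>B\<close>-ring \<open>\<eta> : B \<rightarrow> P\<close>.\<close>

definition ring_bimodule :: "('k, 'p) module \<Rightarrow> ('b \<Rightarrow> 'p) \<Rightarrow> ('k, 'b, 'p) bimodule" where
  "ring_bimodule P \<eta> =
    \<lparr>carrier = carrier P, mult = mult P, one = one P,
     ring.zero = ring.zero P, add = add P, smult = smult P,
     lact = (\<lambda>b p. \<eta> b \<otimes>\<^bsub>P\<^esub> p), ract = (\<lambda>p b. p \<otimes>\<^bsub>P\<^esub> \<eta> b)\<rparr>"

record ('k, 'b, 'l) bialgebroid =
  ground :: "'k ring"
  base :: "('k, 'b) module"
  total :: "('k, 'l) module"
  src :: "'b \<Rightarrow> 'l"
  tgt :: "'b \<Rightarrow> 'l"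
  cop :: "'l \<Rightarrow> (('l \<times> 'l) \<Rightarrow>\<^sub>0 int) set"
  cou :: "'l \<Rightarrow> 'b"

text \<open>\<open>\<L> \<diamondop>\<^sub>B \<Gamma>\<close> and \<open>\<L> \<diamondop>\<^sub>B \<L> \<diamondop>\<^sub>B \<Gamma>\<close>.\<close>

definition dia ::
  "('k, 'b, 'l) bialgebroid \<Rightarrow> ('k, 'b, 'g) bimodule \<Rightarrow> (('l \<times> 'g) \<Rightarrow>\<^sub>0 int) set monoid" where
  "dia H \<Gamma> = tensor2 (total H) \<Gamma> (bal2 (ground H) (total H) \<Gamma> \<union>
     {((tgt H b \<otimes>\<^bsub>total H\<^esub> x, p), (x, lact \<Gamma> b p)) | b x p.
        b \<in> carrier (base H) \<and> x \<in> carrier (total H) \<and> p \<in> carrier \<Gamma>})"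

definition dia3 ::
  "('k, 'b, 'l) bialgebroid \<Rightarrow> ('k, 'b, 'g) bimodule \<Rightarrow> (('l \<times> 'l \<times> 'g) \<Rightarrow>\<^sub>0 int) set monoid" where
  "dia3 H \<Gamma> = tensor3 (total H) (total H) \<Gamma> (bal3 (ground H) (total H) (total H) \<Gamma> \<union>
     {((tgt H b \<otimes>\<^bsub>total H\<^esub> x, y, p), (x, src H b \<otimes>\<^bsub>total H\<^esub> y, p)) | b x y p.
        b \<in> carrier (base H) \<and> x \<in> carrier (total H) \<and> y \<in> carrier (total H) \<and> p \<in> carrier \<Gamma>} \<union>
     {((x, tgt H b \<otimes>\<^bsub>total H\<^esub> y, p), (x, y, lact \<Gamma> b p)) | b x y p.
        b \<in> carrier (base H) \<and> x \<in> carrier (total H) \<and> y \<in> carrier (total H) \<and> p \<in> carrier \<Gamma>})"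

text \<open>\<open>\<L> \<times>\<^sub>B \<Gamma>\<close>.\<close>

definition takeuchi ::
  "('k, 'b, 'l) bialgebroid \<Rightarrow> ('k, 'b, 'g) bimodule \<Rightarrow> (('l \<times> 'g) \<Rightarrow>\<^sub>0 int) set set" where
  "takeuchi H \<Gamma> = {U \<in> carrier (dia H \<Gamma>). \<forall>a\<in>carrier (base H).
     tsum (dia H \<Gamma>) U (\<lambda>(x, p). pure (dia H \<Gamma>) (x \<otimes>\<^bsub>total H\<^esub> tgt H a, p)) =
     tsum (dia H \<Gamma>) U (\<lambda>(x, p). pure (dia H \<Gamma>) (x, ract \<Gamma> p a))}"

text \<open>\<open>\<L> \<otimes>\<^sup>B \<Gamma>\<close>.\<close>

definition bten ::
  "('k, 'b, 'l) bialgebroid \<Rightarrow> ('k, 'b, 'g) bimodule \<Rightarrow> (('l \<times> 'g) \<Rightarrow>\<^sub>0 int) set monoid" where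
  "bten H \<Gamma> = tensor2 (total H) \<Gamma> (bal2 (ground H) (total H) \<Gamma> \<union>
     {((src H b \<otimes>\<^bsub>total H\<^esub> x, p), (x, ract \<Gamma> p b)) | b x p.
        b \<in> carrier (base H) \<and> x \<in> carrier (total H) \<and> p \<in> carrier \<Gamma>})"

text \<open>Componentwise product on \<open>\<L> \<times>\<^sub>B P\<close> for a \<open>B\<close>-ring \<open>P\<close>. The order of the two sums
  matters: for fixed \<open>y\<close> and \<open>q\<close> the inner sum is well defined on \<open>\<L> \<diamondop>\<^sub>B P\<close>, and the outer
  one is because \<open>U\<close> lies in \<open>\<L> \<times>\<^sub>B P\<close>.\<close>

definition takeuchi_mult ::
  "('k, 'b, 'l) bialgebroid \<Rightarrow> ('k, 'p) module \<Rightarrow> ('b \<Rightarrow> 'p)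
     \<Rightarrow> (('l \<times> 'p) \<Rightarrow>\<^sub>0 int) set \<Rightarrow> (('l \<times> 'p) \<Rightarrow>\<^sub>0 int) set \<Rightarrow> (('l \<times> 'p) \<Rightarrow>\<^sub>0 int) set" where
  "takeuchi_mult H P \<eta> U V =
     tsum (dia H (ring_bimodule P \<eta>)) V (\<lambda>(y, q).
       tsum (dia H (ring_bimodule P \<eta>)) U (\<lambda>(x, p).
         pure (dia H (ring_bimodule P \<eta>)) (x \<otimes>\<^bsub>total H\<^esub> y, p \<otimes>\<^bsub>P\<^esub> q)))"

text \<open>\<open>\<L>\<close> as a \<open>B\<close>-ring via the source map.\<close>

definition self :: "('k, 'b, 'l) bialgebroid \<Rightarrow> ('k, 'b, 'l) bimodule" where
  "self H = ring_bimodule (total H) (src H)"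

definition left_bialgebroid :: "('k, 'b, 'l) bialgebroid \<Rightarrow> bool" where
  "left_bialgebroid H \<longleftrightarrow>
    field (ground H) \<and> k_algebra (ground H) (base H) \<and> k_algebra (ground H) (total H) \<and>
    src H \<in> k_alg_hom (ground H) (base H) (total H) \<and>
    tgt H \<in> k_alg_hom (ground H) (opp (base H)) (total H) \<and>
    (\<forall>b\<in>carrier (base H). \<forall>c\<in>carrier (base H).
       src H b \<otimes>\<^bsub>total H\<^esub> tgt H c = tgt H c \<otimes>\<^bsub>total H\<^esub> src H b) \<and>
    cop H \<in> hom (add_monoid (total H)) (dia H (self H)) \<and>
    (\<forall>x\<in>carrier (total H). cop H x \<in> takeuchi H (self H)) \<and>
    (\<forall>b\<in>carrier (base H). \<forall>c\<in>carrier (base H). \<forall>x\<in>carrier (total H).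
       cop H (src H b \<otimes>\<^bsub>total H\<^esub> tgt H c \<otimes>\<^bsub>total H\<^esub> x) =
       tsum (dia H (self H)) (cop H x) (\<lambda>(x1, x2).
         pure (dia H (self H)) (src H b \<otimes>\<^bsub>total H\<^esub> x1, tgt H c \<otimes>\<^bsub>total H\<^esub> x2))) \<and>
    cou H \<in> hom (add_monoid (total H)) (add_monoid (base H)) \<and>
    (\<forall>b\<in>carrier (base H). \<forall>c\<in>carrier (base H). \<forall>x\<in>carrier (total H).
       cou H (src H b \<otimes>\<^bsub>total H\<^esub> tgt H c \<otimes>\<^bsub>total H\<^esub> x) = b \<otimes>\<^bsub>base H\<^esub> cou H x \<otimes>\<^bsub>base H\<^esub> c) \<and>
    (\<forall>x\<in>carrier (total H).
       tsum (dia3 H (self H)) (cop H x) (\<lambda>(x1, x2).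
         tsum (dia3 H (self H)) (cop H x1) (\<lambda>(x11, x12). pure (dia3 H (self H)) (x11, x12, x2))) =
       tsum (dia3 H (self H)) (cop H x) (\<lambda>(x1, x2).
         tsum (dia3 H (self H)) (cop H x2) (\<lambda>(x21, x22). pure (dia3 H (self H)) (x1, x21, x22)))) \<and>
    (\<forall>x\<in>carrier (total H).
       tsum (add_monoid (total H)) (cop H x) (\<lambda>(x1, x2). src H (cou H x1) \<otimes>\<^bsub>total H\<^esub> x2) = x \<and>
       tsum (add_monoid (total H)) (cop H x) (\<lambda>(x1, x2). tgt H (cou H x2) \<otimes>\<^bsub>total H\<^esub> x1) = x) \<and>
    cop H \<one>\<^bsub>total H\<^esub> = pure (dia H (self H)) (\<one>\<^bsub>total H\<^esub>, \<one>\<^bsub>total H\<^esub>) \<and>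
    (\<forall>x\<in>carrier (total H). \<forall>y\<in>carrier (total H).
       cop H (x \<otimes>\<^bsub>total H\<^esub> y) = takeuchi_mult H (total H) (src H) (cop H x) (cop H y)) \<and>
    cou H \<one>\<^bsub>total H\<^esub> = \<one>\<^bsub>base H\<^esub> \<and>
    (\<forall>x\<in>carrier (total H). \<forall>y\<in>carrier (total H).
       cou H (x \<otimes>\<^bsub>total H\<^esub> src H (cou H y)) = cou H (x \<otimes>\<^bsub>total H\<^esub> y) \<and>
       cou H (x \<otimes>\<^bsub>total H\<^esub> tgt H (cou H y)) = cou H (x \<otimes>\<^bsub>total H\<^esub> y))"

text \<open>Left and right \<open>B\<close>- and \<open>opp B\<close>-modules, in this order.\<close>

definition flat_bialgebroid :: "'u itself \<Rightarrow> ('k, 'b, 'l) bialgebroid \<Rightarrow> bool" where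
  "flat_bialgebroid u H \<longleftrightarrow>
    faithfully_flat u (base H) (with_action (total H) (\<lambda>b x. src H b \<otimes>\<^bsub>total H\<^esub> x)) \<and>
    faithfully_flat u (opp (base H)) (with_action (total H) (\<lambda>b x. x \<otimes>\<^bsub>total H\<^esub> src H b)) \<and>
    faithfully_flat u (opp (base H)) (with_action (total H) (\<lambda>b x. tgt H b \<otimes>\<^bsub>total H\<^esub> x)) \<and>
    faithfully_flat u (opp (opp (base H))) (with_action (total H) (\<lambda>b x. x \<otimes>\<^bsub>total H\<^esub> tgt H b))"

definition flat_bimodule :: "'u itself \<Rightarrow> ('k, 'b) module \<Rightarrow> ('k, 'b, 'g) bimodule \<Rightarrow> bool" where
  "flat_bimodule u B \<Gamma> \<longleftrightarrow>
    faithfully_flat u B (with_action \<Gamma> (lact \<Gamma>)) \<and>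
    faithfully_flat u (opp B) (with_action \<Gamma> (\<lambda>b p. ract \<Gamma> p b))"


section \<open>Comodules, the anti-left Hopf property and Galois extensions\<close>

definition left_comodule ::
  "('k, 'b, 'l) bialgebroid \<Rightarrow> ('k, 'b, 'g) bimodule \<Rightarrow> ('g \<Rightarrow> (('l \<times> 'g) \<Rightarrow>\<^sub>0 int) set) \<Rightarrow> bool" where
  "left_comodule H \<Gamma> \<delta> \<longleftrightarrow>
    k_bimodule (ground H) (base H) \<Gamma> \<and>
    \<delta> \<in> hom (add_monoid \<Gamma>) (dia H \<Gamma>) \<and>
    (\<forall>p\<in>carrier \<Gamma>. \<delta> p \<in> takeuchi H \<Gamma>) \<and>
    (\<forall>b\<in>carrier (base H). \<forall>b'\<in>carrier (base H). \<forall>p\<in>carrier \<Gamma>.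
       \<delta> (ract \<Gamma> (lact \<Gamma> b p) b') =
       tsum (dia H \<Gamma>) (\<delta> p) (\<lambda>(x, q).
         pure (dia H \<Gamma>) (src H b \<otimes>\<^bsub>total H\<^esub> x \<otimes>\<^bsub>total H\<^esub> src H b', q))) \<and>
    (\<forall>p\<in>carrier \<Gamma>.
       tsum (dia3 H \<Gamma>) (\<delta> p) (\<lambda>(x, q).
         tsum (dia3 H \<Gamma>) (cop H x) (\<lambda>(x1, x2). pure (dia3 H \<Gamma>) (x1, x2, q))) =
       tsum (dia3 H \<Gamma>) (\<delta> p) (\<lambda>(x, q).
         tsum (dia3 H \<Gamma>) (\<delta> q) (\<lambda>(y, r). pure (dia3 H \<Gamma>) (x, y, r)))) \<and>
    (\<forall>p\<in>carrier \<Gamma>. tsum (add_monoid \<Gamma>) (\<delta> p) (\<lambda>(x, q). lact \<Gamma> (cou H x) q) = p)"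

text \<open>\<open>\<phi> : \<L> \<otimes>\<^sup>B \<Gamma> \<rightarrow> \<L> \<diamondop>\<^sub>B \<Gamma>\<close>, sending \<open>X \<otimes> p\<close> to \<open>p\<^sub>(\<^sub>-\<^sub>1\<^sub>) X \<otimes> p\<^sub>(\<^sub>0\<^sub>)\<close>, and \<open>\<phi>\<^sup>-\<^sup>1(1 \<diamondop> p)\<close>.\<close>

definition skew_map ::
  "('k, 'b, 'l) bialgebroid \<Rightarrow> ('k, 'b, 'g) bimodule \<Rightarrow> ('g \<Rightarrow> (('l \<times> 'g) \<Rightarrow>\<^sub>0 int) set)
     \<Rightarrow> (('l \<times> 'g) \<Rightarrow>\<^sub>0 int) set \<Rightarrow> (('l \<times> 'g) \<Rightarrow>\<^sub>0 int) set" where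
  "skew_map H \<Gamma> \<delta> U =
     tsum (dia H \<Gamma>) U (\<lambda>(x, p).
       tsum (dia H \<Gamma>) (\<delta> p) (\<lambda>(y, q). pure (dia H \<Gamma>) (y \<otimes>\<^bsub>total H\<^esub> x, q)))"

definition skew_regular ::
  "('k, 'b, 'l) bialgebroid \<Rightarrow> ('k, 'b, 'g) bimodule \<Rightarrow> ('g \<Rightarrow> (('l \<times> 'g) \<Rightarrow>\<^sub>0 int) set) \<Rightarrow> bool" where
  "skew_regular H \<Gamma> \<delta> \<longleftrightarrow>
     bij_betw (skew_map H \<Gamma> \<delta>) (carrier (bten H \<Gamma>)) (carrier (dia H \<Gamma>))"

definition skew_inv ::
  "('k, 'b, 'l) bialgebroid \<Rightarrow> ('k, 'b, 'g) bimodule \<Rightarrow> ('g \<Rightarrow> (('l \<times> 'g) \<Rightarrow>\<^sub>0 int) set)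
     \<Rightarrow> 'g \<Rightarrow> (('l \<times> 'g) \<Rightarrow>\<^sub>0 int) set" where
  "skew_inv H \<Gamma> \<delta> p =
     inv_into (carrier (bten H \<Gamma>)) (skew_map H \<Gamma> \<delta>) (pure (dia H \<Gamma>) (\<one>\<^bsub>total H\<^esub>, p))"

text \<open>\<open>\<mu>(X \<otimes> Y) = Y\<^sub>(\<^sub>1\<^sub>) X \<otimes> Y\<^sub>(\<^sub>2\<^sub>)\<close>.\<close>

definition hopf_map ::
  "('k, 'b, 'l) bialgebroid \<Rightarrow> (('l \<times> 'l) \<Rightarrow>\<^sub>0 int) set \<Rightarrow> (('l \<times> 'l) \<Rightarrow>\<^sub>0 int) set" where
  "hopf_map H U =
     tsum (dia H (self H)) U (\<lambda>(x, y).
       tsum (dia H (self H)) (cop H y) (\<lambda>(y1, y2). pure (dia H (self H)) (y1 \<otimes>\<^bsub>total H\<^esub> x, y2)))"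

definition anti_left_hopf :: "('k, 'b, 'l) bialgebroid \<Rightarrow> bool" where
  "anti_left_hopf H \<longleftrightarrow> left_bialgebroid H \<and>
     bij_betw (hopf_map H) (carrier (bten H (self H))) (carrier (dia H (self H)))"

text \<open>\<open>X\<^sub>[\<^sub>-\<^sub>] \<otimes>\<^sup>B X\<^sub>[\<^sub>+\<^sub>]\<close>.\<close>

definition hopf_inv :: "('k, 'b, 'l) bialgebroid \<Rightarrow> 'l \<Rightarrow> (('l \<times> 'l) \<Rightarrow>\<^sub>0 int) set" where
  "hopf_inv H x =
     inv_into (carrier (bten H (self H))) (hopf_map H) (pure (dia H (self H)) (\<one>\<^bsub>total H\<^esub>, x))"

definition left_comodule_algebra ::
  "('k, 'b, 'l) bialgebroid \<Rightarrow> ('k, 'p) module \<Rightarrow> ('b \<Rightarrow> 'p)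
     \<Rightarrow> ('p \<Rightarrow> (('l \<times> 'p) \<Rightarrow>\<^sub>0 int) set) \<Rightarrow> bool" where
  "left_comodule_algebra H P \<eta> \<delta> \<longleftrightarrow>
    k_algebra (ground H) P \<and> \<eta> \<in> k_alg_hom (ground H) (base H) P \<and>
    left_comodule H (ring_bimodule P \<eta>) \<delta> \<and>
    \<delta> \<one>\<^bsub>P\<^esub> = pure (dia H (ring_bimodule P \<eta>)) (\<one>\<^bsub>total H\<^esub>, \<one>\<^bsub>P\<^esub>) \<and>
    (\<forall>p\<in>carrier P. \<forall>q\<in>carrier P. \<delta> (p \<otimes>\<^bsub>P\<^esub> q) = takeuchi_mult H P \<eta> (\<delta> p) (\<delta> q)) \<and>
    (\<forall>b\<in>carrier (base H). \<delta> (\<eta> b) = pure (dia H (ring_bimodule P \<eta>)) (src H b, \<one>\<^bsub>P\<^esub>))"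

definition coinvariants ::
  "('k, 'b, 'l) bialgebroid \<Rightarrow> ('k, 'p) module \<Rightarrow> ('b \<Rightarrow> 'p)
     \<Rightarrow> ('p \<Rightarrow> (('l \<times> 'p) \<Rightarrow>\<^sub>0 int) set) \<Rightarrow> 'p set" where
  "coinvariants H P \<eta> \<delta> =
     {p \<in> carrier P. \<delta> p = pure (dia H (ring_bimodule P \<eta>)) (\<one>\<^bsub>total H\<^esub>, p)}"

text \<open>\<open>P \<otimes>\<^sub>N P\<close>.\<close>

definition sub_tensor ::
  "'k ring \<Rightarrow> ('k, 'p) module \<Rightarrow> 'p set \<Rightarrow> (('p \<times> 'p) \<Rightarrow>\<^sub>0 int) set monoid" where
  "sub_tensor k P N = tensor2 P P (bal2 k P P \<union>
     {((p \<otimes>\<^bsub>P\<^esub> n, q), (p, n \<otimes>\<^bsub>P\<^esub> q)) | p n q. p \<in> carrier P \<and> n \<in> N \<and> q \<in> carrier P})"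

definition left_can ::
  "('k, 'b, 'l) bialgebroid \<Rightarrow> ('k, 'p) module \<Rightarrow> ('b \<Rightarrow> 'p)
     \<Rightarrow> ('p \<Rightarrow> (('l \<times> 'p) \<Rightarrow>\<^sub>0 int) set) \<Rightarrow> (('p \<times> 'p) \<Rightarrow>\<^sub>0 int) set \<Rightarrow> (('l \<times> 'p) \<Rightarrow>\<^sub>0 int) set" where
  "left_can H P \<eta> \<delta> U =
     tsum (dia H (ring_bimodule P \<eta>)) U (\<lambda>(p, q).
       tsum (dia H (ring_bimodule P \<eta>)) (\<delta> p) (\<lambda>(x, r).
         pure (dia H (ring_bimodule P \<eta>)) (x, r \<otimes>\<^bsub>P\<^esub> q)))"

definition left_galois ::
  "('k, 'b, 'l) bialgebroid \<Rightarrow> ('k, 'p) module \<Rightarrow> ('b \<Rightarrow> 'p)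
     \<Rightarrow> ('p \<Rightarrow> (('l \<times> 'p) \<Rightarrow>\<^sub>0 int) set) \<Rightarrow> bool" where
  "left_galois H P \<eta> \<delta> \<longleftrightarrow> left_comodule_algebra H P \<eta> \<delta> \<and>
     bij_betw (left_can H P \<eta> \<delta>)
       (carrier (sub_tensor (ground H) P (coinvariants H P \<eta> \<delta>)))
       (carrier (dia H (ring_bimodule P \<eta>)))"

definition flat_extension ::
  "'u itself \<Rightarrow> ('k, 'b, 'l) bialgebroid \<Rightarrow> ('k, 'p) module \<Rightarrow> ('b \<Rightarrow> 'p)
     \<Rightarrow> ('p \<Rightarrow> (('l \<times> 'p) \<Rightarrow>\<^sub>0 int) set) \<Rightarrow> bool" where
  "flat_extension u H P \<eta> \<delta> \<longleftrightarrow>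
     faithfully_flat u (P\<lparr>carrier := coinvariants H P \<eta> \<delta>\<rparr>) (with_action P (mult P))"

text \<open>\<open>X\<^sup><\<^sup>1\<^sup>> \<otimes>\<^sub>N X\<^sup><\<^sup>2\<^sup>>\<close>.\<close>

definition translation ::
  "('k, 'b, 'l) bialgebroid \<Rightarrow> ('k, 'p) module \<Rightarrow> ('b \<Rightarrow> 'p)
     \<Rightarrow> ('p \<Rightarrow> (('l \<times> 'p) \<Rightarrow>\<^sub>0 int) set) \<Rightarrow> 'l \<Rightarrow> (('p \<times> 'p) \<Rightarrow>\<^sub>0 int) set" where
  "translation H P \<eta> \<delta> x =
     inv_into (carrier (sub_tensor (ground H) P (coinvariants H P \<eta> \<delta>))) (left_can H P \<eta> \<delta>)
       (pure (dia H (ring_bimodule P \<eta>)) (x, \<one>\<^bsub>P\<^esub>))"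

text \<open>\<open>\<L> \<otimes> P \<otimes> \<L>\<close> modulo \<open>t(a) Y \<otimes> p \<otimes> Z = Y \<otimes> ap \<otimes> Z\<close> and
  \<open>Yb \<otimes> p \<otimes> Z = Y \<otimes> p \<otimes> bZ\<close>.\<close>

definition mixed_tensor ::
  "('k, 'b, 'l) bialgebroid \<Rightarrow> ('k, 'p) module \<Rightarrow> ('b \<Rightarrow> 'p)
     \<Rightarrow> (('l \<times> 'p \<times> 'l) \<Rightarrow>\<^sub>0 int) set monoid" where
  "mixed_tensor H P \<eta> = tensor3 (total H) P (total H) (bal3 (ground H) (total H) P (total H) \<union>
     {((tgt H a \<otimes>\<^bsub>total H\<^esub> y, p, z), (y, \<eta> a \<otimes>\<^bsub>P\<^esub> p, z)) | a y p z.
        a \<in> carrier (base H) \<and> y \<in> carrier (total H) \<and> p \<in> carrier P \<and> z \<in> carrier (total H)} \<union>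
     {((y \<otimes>\<^bsub>total H\<^esub> src H b, p, z), (y, p, src H b \<otimes>\<^bsub>total H\<^esub> z)) | b y p z.
        b \<in> carrier (base H) \<and> y \<in> carrier (total H) \<and> p \<in> carrier P \<and> z \<in> carrier (total H)})"

text \<open>A universe with room for the rings \<open>B\<close> and \<open>N \<subseteq> P\<close>, so that faithful flatness over
  either has its usual meaning, and for the test modules \<open>\<L> \<otimes>\<^sup>B \<L>\<close> and \<open>\<L> \<diamondop>\<^sub>B \<L>\<close>.\<close>

type_synonym ('b, 'p, 'l) universe = "'b + 'p + (('l \<times> 'l) \<Rightarrow>\<^sub>0 int) set"

end

theory Submission
  imports Defs
begin

text \<open>
  Write \<open>\<mu>\<close> for the Hopf map \<open>\<L> \<otimes>\<^sup>B \<L> \<rightarrow> \<L> \<diamondop>\<^sub>B \<L>\<close>, \<open>\<phi>\<close> for the skew regularity map of \<open>P\<close> and \<open>can\<close> for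
  the Galois map. Multiplication by \<open>t(b)\<close> on the second leg makes source and target of \<open>\<mu>\<close> right
  \<open>B\<close>-modules and \<open>\<mu>\<close> linear, so \<open>\<mu>\<close> can be tensored over \<open>B\<close> with \<open>P\<close>. The square with the sides

    \<open>\<L> \<otimes>\<^sup>B P \<otimes>\<^sub>N P \<rightarrow> \<L> \<otimes>\<^sup>B (\<L> \<diamondop>\<^sub>B P) \<rightarrow> \<L> \<diamondop>\<^sub>B \<L> \<diamondop>\<^sub>B P\<close>   (\<open>id \<otimes> can\<close>, then \<open>\<mu> \<otimes> P\<close>)

    \<open>\<L> \<otimes>\<^sup>B P \<otimes>\<^sub>N P \<rightarrow> (\<L> \<diamondop>\<^sub>B P) \<otimes>\<^sub>N P \<rightarrow> \<L> \<diamondop>\<^sub>B (\<L> \<diamondop>\<^sub>B P)\<close>   (\<open>\<phi> \<otimes> id\<close>, then \<open>id \<otimes> can\<close>)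

  commutes, because both composites of \<open>z \<otimes> p \<otimes> q\<close> are \<open>p\<^sub>(\<^sub>-\<^sub>2\<^sub>) z \<otimes> p\<^sub>(\<^sub>-\<^sub>1\<^sub>) \<otimes> p\<^sub>(\<^sub>0\<^sub>) q\<close> by coassociativity.
  Three sides are bijective since \<open>can\<close> and \<open>\<phi>\<close> are; hence so is \<open>\<mu> \<otimes> P\<close>. As \<open>P\<close> is faithfully flat
  over \<open>B\<close>, the map \<open>\<mu>\<close> is bijective. Following \<open>1 \<otimes> X \<otimes> 1\<close> backwards around the square gives
  \<open>X\<^sub>[\<^sub>-\<^sub>] \<otimes> X\<^sub>[\<^sub>+\<^sub>] \<otimes> 1\<close> on one side and the expression in \<open>X\<^sup><\<^sup>1\<^sup>> \<otimes> X\<^sup><\<^sup>2\<^sup>>\<close> on the other.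

  The tensor products of \<open>P \<otimes>\<^sub>N P\<close> with a further factor are never formed. Instead the inverse \<open>Mu_inv\<close>
  of \<open>Mu = \<mu> \<otimes> P\<close> is built by running \<open>can\<inverse>\<close>, \<open>\<phi>\<inverse>\<close> and \<open>id \<otimes> can\<close> one after the other with the
  remaining legs as parameters. The square is the lemma \<open>Mu_coact_bten\<close>, both composites are
  computed in \<open>Mu_Mu_inv\<close> and \<open>Mu_inv_Mu\<close>, and \<open>scalar_extension_detects_bij\<close> descends
  along \<open>P\<close>. Every map out of a tensor product is a Sweedler sum; once it is known to be
  balanced it is used only through its additivity and its values on pure tensors, and identities
  follow by induction over sums of pure tensors.\<close>

section \<open>Sweedler sums as homomorphisms\<close>

lemma (in comm_group) free_eval_superset:
  assumes "h \<in> S \<rightarrow> carrier G" "finite K" "Poly_Mapping.keys c \<subseteq> K" "K \<subseteq> S"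
  shows "free_eval G h c = finprod G (\<lambda>x. h x [^] Poly_Mapping.lookup c x) K"
  unfolding free_eval_def
  by (rule finprod_mono_neutral_cong_left)
    (use assms in \<open>auto simp: in_keys_iff Pi_iff\<close>)

lemma (in comm_group) free_eval_hom:
  assumes "h \<in> S \<rightarrow> carrier G"
  shows "free_eval G h \<in> hom (free_Abelian_group S) G"
proof (rule homI)
  show "free_eval G h c \<in> carrier G" if "c \<in> carrier (free_Abelian_group S)" for c
    unfolding free_eval_def by (rule finprod_closed) (use assms that in \<open>auto simp: Pi_iff\<close>)
  fix c d assume cd: "c \<in> carrier (free_Abelian_group S)" "d \<in> carrier (free_Abelian_group S)"
  let ?K = "Poly_Mapping.keys c \<union> Poly_Mapping.keys d"
  have K: "finite ?K" "?K \<subseteq> S" "Poly_Mapping.keys (c + d) \<subseteq> ?K"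
    using cd Poly_Mapping.keys_add[of c d] by auto
  have h: "h x \<in> carrier G" if "x \<in> ?K" for x
    using that K assms by auto
  have "free_eval G h (c + d) = finprod G (\<lambda>x. h x [^] Poly_Mapping.lookup (c + d) x) ?K"
    by (rule free_eval_superset[OF assms K(1,3,2)])
  also have "\<dots> = finprod G (\<lambda>x. h x [^] Poly_Mapping.lookup c x \<otimes> h x [^] Poly_Mapping.lookup d x) ?K"
    by (rule finprod_cong) (use h in \<open>auto simp: lookup_add int_pow_mult simp_implies_def Pi_iff simp del: Un_iff\<close>)
  also have "\<dots> = finprod G (\<lambda>x. h x [^] Poly_Mapping.lookup c x) ?K
      \<otimes> finprod G (\<lambda>x. h x [^] Poly_Mapping.lookup d x) ?K"
    by (rule finprod_multf) (use h in auto)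
  also have "\<dots> = free_eval G h c \<otimes> free_eval G h d"
    using free_eval_superset[OF assms K(1) _ K(2)] by simp
  finally show "free_eval G h (c \<otimes>\<^bsub>free_Abelian_group S\<^esub> d) = free_eval G h c \<otimes> free_eval G h d"
    by simp
qed

lemma (in comm_group) free_eval_frag_of:
  assumes "h x \<in> carrier G"
  shows "free_eval G h (frag_of x) = h x"
  unfolding free_eval_def using assms by simp

lemma (in comm_group) free_eval_diff:
  assumes h: "h \<in> S \<rightarrow> carrier G" and c: "Poly_Mapping.keys c \<subseteq> S" "Poly_Mapping.keys d \<subseteq> S"
  shows "free_eval G h (c - d) = free_eval G h c \<otimes> inv free_eval G h d"
proof -
  interpret group_hom "free_Abelian_group S" G "free_eval G h"
    by (simp add: group_hom_def group_hom_axioms_def group_axioms free_eval_hom[OF h])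
  have cF: "c \<in> carrier (free_Abelian_group S)" "d \<in> carrier (free_Abelian_group S)"
    using c by simp_all
  have "free_eval G h (c \<otimes>\<^bsub>free_Abelian_group S\<^esub> inv\<^bsub>free_Abelian_group S\<^esub> d) =
      free_eval G h c \<otimes> inv free_eval G h d"
    using cF by (simp only: hom_mult hom_inv G.inv_closed)
  then show ?thesis using c by simp
qed

lemma (in comm_group) free_eval_cong:
  assumes "\<And>x. x \<in> S \<Longrightarrow> h x = h' x" "h \<in> S \<rightarrow> carrier G" "Poly_Mapping.keys c \<subseteq> S"
  shows "free_eval G h c = free_eval G h' c"
proof -
  have "h' x \<in> carrier G" if "x \<in> Poly_Mapping.keys c" for x
    using assms that by (metis PiE subsetD)
  then show ?thesis
    unfolding free_eval_def using assms by (intro finprod_cong) (auto simp: simp_implies_def)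
qed

text \<open>The maps on generators that extend, uniquely, to homomorphisms from the presented group.\<close>

definition compatible ::
  "'x set \<Rightarrow> ('x \<Rightarrow>\<^sub>0 int) set \<Rightarrow> ('x \<times> 'x) set \<Rightarrow> ('g, 'z) monoid_scheme \<Rightarrow> ('x \<Rightarrow> 'g) \<Rightarrow> bool" where
  "compatible S A I G h \<longleftrightarrow> comm_group G \<and> h \<in> S \<rightarrow> carrier G \<and>
     (\<forall>a\<in>A. free_eval G h a = \<one>\<^bsub>G\<^esub>) \<and> (\<forall>(x, y)\<in>I. h x = h y)"

locale presentation =
  fixes S :: "'x set" and A :: "('x \<Rightarrow>\<^sub>0 int) set" and I :: "('x \<times> 'x) set"
    and T :: "('x \<Rightarrow>\<^sub>0 int) set monoid"
  assumes relators: "\<And>a. a \<in> A \<Longrightarrow> Poly_Mapping.keys a \<subseteq> S"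
    and identifications: "I \<subseteq> S \<times> S"
    and T_eq: "T = presented S A I"
begin

definition relations :: "('x \<Rightarrow>\<^sub>0 int) set" where
  "relations = A \<union> {frag_of x - frag_of y | x y. (x, y) \<in> I}"

abbreviation "F \<equiv> free_Abelian_group S"
abbreviation "K \<equiv> generate F relations"
abbreviation "cls c \<equiv> K #>\<^bsub>F\<^esub> c"

lemma relations_carrier: "relations \<subseteq> carrier F"
proof
  fix c assume "c \<in> relations"
  then consider "c \<in> A" | x y where "c = frag_of x - frag_of y" "(x, y) \<in> I"
    by (auto simp: relations_def)
  then show "c \<in> carrier F"
  proof cases
    case 2
    then show ?thesis using identifications keys_diff[of "frag_of x" "frag_of y"] by auto
  qed (use relators in auto)
qed

lemma T_Mod: "T = F Mod K"
  by (simp add: T_eq presented_def relations_def)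

sublocale free: comm_group F
  by (rule abelian_free_Abelian_group)

lemma subgroup_K: "subgroup K F"
  by (rule free.generate_is_subgroup[OF relations_carrier])

sublocale quotient: normal K F
  by (rule free.subgroup_imp_normal[OF subgroup_K])

lemma comm_group_T: "comm_group T"
  unfolding T_Mod by (rule free.abelian_FactGroup[OF subgroup_K])

lemma carrier_T: "carrier T = cls ` carrier F"
  by (simp add: T_Mod carrier_FactGroup)

lemma coset_hom: "cls \<in> hom F T"
  unfolding T_Mod by (rule quotient.r_coset_hom_Mod)

lemma coset_eq_one:
  assumes "c \<in> relations" shows "cls c = \<one>\<^bsub>T\<^esub>"
  using assms by (simp add: T_Mod free.coset_join2 generate.incl relations_carrier[THEN subsetD] subgroup_K
      del: carrier_free_Abelian_group_iff)

lemma pure_eq: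
  assumes "x \<in> S" shows "pure T x = cls (frag_of x)"
  unfolding pure_def
proof (rule the_equality)
  have x: "frag_of x \<in> carrier F" using assms by simp
  show "cls (frag_of x) \<in> carrier T \<and> frag_of x \<in> cls (frag_of x)"
    using x free.rcos_self[OF x subgroup_K] by (auto simp: carrier_T simp del: carrier_free_Abelian_group_iff)
  show "U = cls (frag_of x)" if "U \<in> carrier T \<and> frag_of x \<in> U" for U
    using that free.repr_independence[OF _ _ subgroup_K]
    by (auto simp: carrier_T simp del: carrier_free_Abelian_group_iff)
qed

lemma pure_closed: "x \<in> S \<Longrightarrow> pure T x \<in> carrier T"
  by (simp add: pure_eq carrier_T)

lemma pure_cong:
  assumes "(x, y) \<in> I" shows "pure T x = pure T y"
proof -
  interpret T: comm_group T by (rule comm_group_T)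
  interpret c: group_hom F T cls
    by (simp add: group_hom_def group_hom_axioms_def coset_hom)
  have S: "x \<in> S" "y \<in> S" using assms identifications by auto
  then have F: "frag_of x \<in> carrier F" "frag_of y \<in> carrier F" by simp_all
  have "cls (frag_of x \<otimes>\<^bsub>F\<^esub> inv\<^bsub>F\<^esub> frag_of y) = \<one>\<^bsub>T\<^esub>"
    by (rule coset_eq_one) (use assms S in \<open>auto simp: relations_def\<close>)
  then have "cls (frag_of x) \<otimes>\<^bsub>T\<^esub> inv\<^bsub>T\<^esub> (cls (frag_of y)) = \<one>\<^bsub>T\<^esub>"
    using F by (simp only: c.hom_mult c.hom_inv free.inv_closed)
  then have "cls (frag_of x) = cls (frag_of y)"
    using F c.hom_closed T.inv_solve_right' by (metis T.l_one T.one_closed)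
  then show ?thesis using S by (simp add: pure_eq)
qed

lemma pure_add:
  assumes "x \<in> S" "y \<in> S" "z \<in> S" "frag_of x - frag_of y - frag_of z \<in> A"
  shows "pure T x = pure T y \<otimes>\<^bsub>T\<^esub> pure T z"
proof -
  interpret T: comm_group T by (rule comm_group_T)
  interpret c: group_hom F T cls
    by (simp add: group_hom_def group_hom_axioms_def coset_hom)
  let ?d = "frag_of x - frag_of y - frag_of z"
  have d: "?d \<in> carrier F" using relators[OF assms(4)] by simp
  have F: "frag_of x \<in> carrier F" "frag_of y \<in> carrier F" "frag_of z \<in> carrier F" using assms by simp_all
  have "frag_of x = ?d \<otimes>\<^bsub>F\<^esub> (frag_of y \<otimes>\<^bsub>F\<^esub> frag_of z)" by simp
  then have "cls (frag_of x) =
      cls ?d \<otimes>\<^bsub>T\<^esub> (cls (frag_of y) \<otimes>\<^bsub>T\<^esub> cls (frag_of z))"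
    using d F by (metis c.hom_mult free.m_closed)
  also have "cls ?d = \<one>\<^bsub>T\<^esub>"
    by (rule coset_eq_one) (simp add: relations_def assms)
  finally show ?thesis using assms F c.hom_closed by (simp add: pure_eq del: carrier_free_Abelian_group_iff)
qed

lemma pure_induct [consumes 1, case_names pure diff one]:
  assumes "U \<in> carrier T" "\<And>x. x \<in> S \<Longrightarrow> Q (pure T x)"
    and "\<And>U V. U \<in> carrier T \<Longrightarrow> V \<in> carrier T \<Longrightarrow> Q U \<Longrightarrow> Q V \<Longrightarrow> Q (U \<otimes>\<^bsub>T\<^esub> inv\<^bsub>T\<^esub> V)"
    and "Q \<one>\<^bsub>T\<^esub>"
  shows "Q U"
proof -
  interpret T: comm_group T by (rule comm_group_T)
  interpret c: group_hom F T cls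
    by (simp add: group_hom_def group_hom_axioms_def coset_hom)
  obtain c where c: "Poly_Mapping.keys c \<subseteq> S" "U = cls c"
    using assms(1) by (auto simp: carrier_T)
  have "Q (cls c)" using c(1)
  proof (induct rule: free_Abelian_group_induct[consumes 1, case_names one diff frag])
    case one
    then show ?case using c.hom_one assms(4) by simp
  next
    case (diff x y)
    then have F: "x \<in> carrier F" "y \<in> carrier F" by simp_all
    have "cls (x \<otimes>\<^bsub>F\<^esub> inv\<^bsub>F\<^esub> y) = cls x \<otimes>\<^bsub>T\<^esub> inv\<^bsub>T\<^esub> (cls y)"
      using F by (simp only: c.hom_mult c.hom_inv free.inv_closed)
    then show ?case using diff assms(3)[OF c.hom_closed[OF F(1)] c.hom_closed[OF F(2)]] by simp
  next
    case (frag a)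
    then show ?case using assms(2) by (simp add: pure_eq)
  qed
  then show ?thesis by (simp add: c)
qed

context
  fixes G :: "('g, 'z) monoid_scheme" and h
  assumes resp: "compatible S A I G h"
begin

interpretation G: comm_group G
  using resp by (simp add: compatible_def)

lemma h_closed: "h \<in> S \<rightarrow> carrier G"
  using resp by (simp add: compatible_def)

interpretation ev: group_hom F G "free_eval G h"
  by (simp add: group_hom_def group_hom_axioms_def G.free_eval_hom[OF h_closed] G.group_axioms)

lemma free_eval_relations:
  assumes "c \<in> K" shows "free_eval G h c = \<one>\<^bsub>G\<^esub>"
proof -
  have "relations \<subseteq> kernel F G (free_eval G h)"
  proof
    fix c assume c: "c \<in> relations"
    have "free_eval G h c = \<one>\<^bsub>G\<^esub>"
    proof (cases "c \<in> A")
      case False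
      then obtain x y where xy: "c = frag_of x - frag_of y" "(x, y) \<in> I"
        using c by (auto simp: relations_def)
      then have S: "x \<in> S" "y \<in> S" using identifications by auto
      have "h x = h y" using xy resp by (auto simp: compatible_def)
      then show ?thesis
        using xy S h_closed G.free_eval_diff[OF h_closed, of "frag_of x" "frag_of y"]
        by (auto simp: G.free_eval_frag_of Pi_iff)
    qed (use resp in \<open>simp add: compatible_def\<close>)
    then show "c \<in> kernel F G (free_eval G h)"
      using subsetD[OF relations_carrier c] by (simp add: kernel_def)
  qed
  from free.generate_subgroup_incl[OF this ev.subgroup_kernel] assms
  show ?thesis by (auto simp: kernel_def)
qed

text \<open>The relations are sent to the unit, so the evaluation is constant on cosets; this is what makes
  a Sweedler sum the value of the induced homomorphism.\<close>

lemma tsum_coset: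
  assumes c: "c \<in> carrier F"
  shows "tsum G (cls c) h = free_eval G h c"
proof -
  have const: "free_eval G h d = free_eval G h c" if d: "d \<in> cls c" for d
  proof -
    obtain k where k: "k \<in> K" "d = k \<otimes>\<^bsub>F\<^esub> c"
      using d by (auto simp: r_coset_def)
    have kF: "k \<in> carrier F" by (rule subgroup.mem_carrier[OF subgroup_K k(1)])
    show ?thesis
      unfolding k(2) ev.hom_mult[OF kF c] free_eval_relations[OF k(1)]
      by (rule G.l_one[OF ev.hom_closed[OF c]])
  qed
  have c': "c \<in> cls c" by (rule free.rcos_self[OF c subgroup_K])
  have "free_eval G h ` cls c = {free_eval G h c}"
  proof (intro subset_antisym image_subsetI)
    show "{free_eval G h c} \<subseteq> free_eval G h ` cls c"
      using imageI[OF c', of "free_eval G h"] by (simp only: insert_subset empty_subsetI simp_thms)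
  qed (simp only: const singleton_iff)
  then show ?thesis by (simp add: tsum_def)
qed

lemma tsum_closed: "U \<in> carrier T \<Longrightarrow> tsum G U h \<in> carrier G"
  using ev.hom_closed by (auto simp: carrier_T tsum_coset simp del: carrier_free_Abelian_group_iff)

lemma tsum_mult:
  assumes "U \<in> carrier T" "V \<in> carrier T"
  shows "tsum G (U \<otimes>\<^bsub>T\<^esub> V) h = tsum G U h \<otimes>\<^bsub>G\<^esub> tsum G V h"
proof -
  obtain c d where cd: "c \<in> carrier F" "d \<in> carrier F" "U = cls c" "V = cls d"
    using assms by (auto simp: carrier_T)
  have "U \<otimes>\<^bsub>T\<^esub> V = cls (c \<otimes>\<^bsub>F\<^esub> d)"
    using cd coset_hom by (simp add: hom_def del: mult_free_Abelian_group)
  then show ?thesis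
    using cd by (simp only: tsum_coset ev.hom_mult free.m_closed)
qed

lemma tsum_pure: "x \<in> S \<Longrightarrow> tsum G (pure T x) h = h x"
  using h_closed by (auto simp: pure_eq tsum_coset G.free_eval_frag_of Pi_iff)

lemma tsum_cong:
  assumes "U \<in> carrier T" "\<And>x. x \<in> S \<Longrightarrow> h x = h' x"
  shows "tsum G U h = tsum G U h'"
proof -
  have "free_eval G h c = free_eval G h' c" if "c \<in> U" for c
  proof (rule G.free_eval_cong[OF assms(2) h_closed])
    show "Poly_Mapping.keys c \<subseteq> S"
    proof -
      obtain d where "d \<in> carrier F" "U = cls d"
        using assms(1) by (auto simp: carrier_T)
      then have "c \<in> carrier F"
        using that free.r_coset_subset_G[OF subgroup.subset[OF subgroup_K]] by blast
      then show ?thesis by simp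
    qed
  qed
  then show ?thesis unfolding tsum_def by (metis (no_types, lifting) image_cong)
qed

end

end

section \<open>Tensor products\<close>

definition bilinear ::
  "('m, 'y) ring_scheme \<Rightarrow> ('n, 'z) ring_scheme \<Rightarrow> (('m \<times> 'n) \<times> ('m \<times> 'n)) set
     \<Rightarrow> ('g, 'w) monoid_scheme \<Rightarrow> ('m \<Rightarrow> 'n \<Rightarrow> 'g) \<Rightarrow> bool" where
  "bilinear M N I G h \<longleftrightarrow> comm_group G \<and>
     (\<forall>x\<in>carrier M. \<forall>y\<in>carrier N. h x y \<in> carrier G) \<and>
     (\<forall>x\<in>carrier M. \<forall>x'\<in>carrier M. \<forall>y\<in>carrier N. h (x \<oplus>\<^bsub>M\<^esub> x') y = h x y \<otimes>\<^bsub>G\<^esub> h x' y) \<and>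
     (\<forall>x\<in>carrier M. \<forall>y\<in>carrier N. \<forall>y'\<in>carrier N. h x (y \<oplus>\<^bsub>N\<^esub> y') = h x y \<otimes>\<^bsub>G\<^esub> h x y') \<and>
     (\<forall>x y x' y'. ((x, y), (x', y')) \<in> I \<longrightarrow> h x y = h x' y')"

definition trilinear ::
  "('m, 'y) ring_scheme \<Rightarrow> ('n, 'z) ring_scheme \<Rightarrow> ('q, 'v) ring_scheme
     \<Rightarrow> (('m \<times> 'n \<times> 'q) \<times> ('m \<times> 'n \<times> 'q)) set
     \<Rightarrow> ('g, 'w) monoid_scheme \<Rightarrow> ('m \<Rightarrow> 'n \<Rightarrow> 'q \<Rightarrow> 'g) \<Rightarrow> bool" where
  "trilinear M N Q I G h \<longleftrightarrow> comm_group G \<and>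
     (\<forall>x\<in>carrier M. \<forall>y\<in>carrier N. \<forall>z\<in>carrier Q. h x y z \<in> carrier G) \<and>
     (\<forall>x\<in>carrier M. \<forall>x'\<in>carrier M. \<forall>y\<in>carrier N. \<forall>z\<in>carrier Q.
        h (x \<oplus>\<^bsub>M\<^esub> x') y z = h x y z \<otimes>\<^bsub>G\<^esub> h x' y z) \<and>
     (\<forall>x\<in>carrier M. \<forall>y\<in>carrier N. \<forall>y'\<in>carrier N. \<forall>z\<in>carrier Q.
        h x (y \<oplus>\<^bsub>N\<^esub> y') z = h x y z \<otimes>\<^bsub>G\<^esub> h x y' z) \<and>
     (\<forall>x\<in>carrier M. \<forall>y\<in>carrier N. \<forall>z\<in>carrier Q. \<forall>z'\<in>carrier Q.
        h x y (z \<oplus>\<^bsub>Q\<^esub> z') = h x y z \<otimes>\<^bsub>G\<^esub> h x y z') \<and>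
     (\<forall>x y z x' y' z'. ((x, y, z), (x', y', z')) \<in> I \<longrightarrow> h x y z = h x' y' z')"

lemma keys_diff3:
  "x \<in> S \<Longrightarrow> y \<in> S \<Longrightarrow> z \<in> S \<Longrightarrow> Poly_Mapping.keys (frag_of x - frag_of y - frag_of z) \<subseteq> S"
  by (rule order_trans[OF keys_diff], rule Un_least, rule order_trans[OF keys_diff]) auto

lemma (in comm_group) free_eval_diff3:
  assumes h: "h \<in> S \<rightarrow> carrier G" and S: "x \<in> S" "y \<in> S" "z \<in> S" and eq: "h x = h y \<otimes> h z"
  shows "free_eval G h (frag_of x - frag_of y - frag_of z) = \<one>"
proof -
  have c: "h x \<in> carrier G" "h y \<in> carrier G" "h z \<in> carrier G"
    using h S by auto
  have k: "Poly_Mapping.keys (frag_of x - frag_of y) \<subseteq> S"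
    using keys_diff[of "frag_of x" "frag_of y"] S by auto
  have "h x \<otimes> inv h y = h z"
    using c by (simp add: eq m_comm[of "h y"] m_assoc)
  then show ?thesis
    using S c by (simp add: free_eval_diff[OF h] k free_eval_frag_of)
qed

locale tensor_product =
  fixes M :: "('m, 'y) ring_scheme" and N :: "('n, 'z) ring_scheme"
    and I :: "(('m \<times> 'n) \<times> ('m \<times> 'n)) set" and T :: "(('m \<times> 'n) \<Rightarrow>\<^sub>0 int) set monoid"
  assumes M: "abelian_group M" and N: "abelian_group N"
    and I_sub: "I \<subseteq> (carrier M \<times> carrier N) \<times> (carrier M \<times> carrier N)"
    and T_tensor2: "T = tensor2 M N I"
begin

definition additivity :: "(('m \<times> 'n) \<Rightarrow>\<^sub>0 int) set" where
  "additivity =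
     {frag_of (x \<oplus>\<^bsub>M\<^esub> x', y) - frag_of (x, y) - frag_of (x', y) | x x' y.
         x \<in> carrier M \<and> x' \<in> carrier M \<and> y \<in> carrier N} \<union>
     {frag_of (x, y \<oplus>\<^bsub>N\<^esub> y') - frag_of (x, y) - frag_of (x, y') | x y y'.
         x \<in> carrier M \<and> y \<in> carrier N \<and> y' \<in> carrier N}"

interpretation M: abelian_group M by (rule M)
interpretation N: abelian_group N by (rule N)

sublocale pres: presentation "carrier M \<times> carrier N" additivity I T
proof
  show "Poly_Mapping.keys a \<subseteq> carrier M \<times> carrier N" if "a \<in> additivity" for a
    using that unfolding additivity_def
    by (elim UnE CollectE exE conjE; hypsubst; intro keys_diff3) auto
qed (simp_all add: I_sub T_tensor2 tensor2_def additivity_def)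

sublocale comm_group T
  by (rule pres.comm_group_T)

lemma pure_closed [simp]: "x \<in> carrier M \<Longrightarrow> y \<in> carrier N \<Longrightarrow> pure T (x, y) \<in> carrier T"
  by (rule pres.pure_closed) simp

lemma pure_add_left:
  "x \<in> carrier M \<Longrightarrow> x' \<in> carrier M \<Longrightarrow> y \<in> carrier N \<Longrightarrow>
     pure T (x \<oplus>\<^bsub>M\<^esub> x', y) = pure T (x, y) \<otimes>\<^bsub>T\<^esub> pure T (x', y)"
  by (rule pres.pure_add) (auto simp: additivity_def)

lemma pure_add_right:
  "x \<in> carrier M \<Longrightarrow> y \<in> carrier N \<Longrightarrow> y' \<in> carrier N \<Longrightarrow>
     pure T (x, y \<oplus>\<^bsub>N\<^esub> y') = pure T (x, y) \<otimes>\<^bsub>T\<^esub> pure T (x, y')"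
  by (rule pres.pure_add) (auto simp: additivity_def)

lemmas pure_cong = pres.pure_cong

lemma pure_zero_left: "y \<in> carrier N \<Longrightarrow> pure T (\<zero>\<^bsub>M\<^esub>, y) = \<one>\<^bsub>T\<^esub>"
  using pure_add_left[of "\<zero>\<^bsub>M\<^esub>" "\<zero>\<^bsub>M\<^esub>" y] by simp

lemma pure_minus: "x \<in> carrier M \<Longrightarrow> y \<in> carrier N \<Longrightarrow> pure T (\<ominus>\<^bsub>M\<^esub> x, y) = inv\<^bsub>T\<^esub> pure T (x, y)"
  using pure_add_left[of "\<ominus>\<^bsub>M\<^esub> x" x y] by (metis M.a_inv_closed M.l_neg inv_equality pure_closed pure_zero_left)

text \<open>Since \<open>-(x \<otimes> y) = (-x) \<otimes> y\<close>, every element is a sum of pure tensors, which spares the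
  induction a case for inverses.\<close>

lemma induct [consumes 1, case_names pure mult]:
  assumes U: "U \<in> carrier T"
    and pure: "\<And>x y. x \<in> carrier M \<Longrightarrow> y \<in> carrier N \<Longrightarrow> Q (pure T (x, y))"
    and mult: "\<And>U V. U \<in> carrier T \<Longrightarrow> V \<in> carrier T \<Longrightarrow> Q U \<Longrightarrow> Q V \<Longrightarrow> Q (U \<otimes>\<^bsub>T\<^esub> V)"
  shows "Q U"
proof -
  have "Q U \<and> Q (inv\<^bsub>T\<^esub> U)" using U
  proof (induct rule: pres.pure_induct)
    case (pure z)
    then show ?case
      using assms(2) by (cases z) (simp add: pure_minus[symmetric])
  next
    case (diff U V)
    have "Q (V \<otimes>\<^bsub>T\<^esub> inv\<^bsub>T\<^esub> U)" by (rule mult) (use diff in auto)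
    moreover have "Q (U \<otimes>\<^bsub>T\<^esub> inv\<^bsub>T\<^esub> V)" by (rule mult) (use diff in auto)
    ultimately show ?case using diff by (simp add: inv_mult_group)
  next
    case one
    show ?case using pure_zero_left[of "\<zero>\<^bsub>N\<^esub>"] assms(2)[of "\<zero>\<^bsub>M\<^esub>" "\<zero>\<^bsub>N\<^esub>"] by simp
  qed
  then show ?thesis by simp
qed

lemma bilinear_compatible:
  assumes h: "bilinear M N I G h"
  shows "compatible (carrier M \<times> carrier N) additivity I G (\<lambda>(x, y). h x y)"
proof -
  interpret G: comm_group G using h by (simp add: bilinear_def)
  have cl: "(\<lambda>(x, y). h x y) \<in> carrier M \<times> carrier N \<rightarrow> carrier G"
    using h by (auto simp: bilinear_def)
  have "free_eval G (\<lambda>(x, y). h x y) a = \<one>\<^bsub>G\<^esub>" if "a \<in> additivity" for a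
    using that unfolding additivity_def
    by (elim UnE CollectE exE conjE; hypsubst; intro G.free_eval_diff3[OF cl])
      (use h in \<open>auto simp: bilinear_def\<close>)
  then show ?thesis
    using h cl by (auto simp: compatible_def bilinear_def)
qed

lemma
  assumes h: "bilinear M N I G h"
  shows tsum_closed: "U \<in> carrier T \<Longrightarrow> tsum G U (\<lambda>(x, y). h x y) \<in> carrier G"
    and tsum_mult: "U \<in> carrier T \<Longrightarrow> V \<in> carrier T \<Longrightarrow> tsum G (U \<otimes>\<^bsub>T\<^esub> V) (\<lambda>(x, y). h x y) =
          tsum G U (\<lambda>(x, y). h x y) \<otimes>\<^bsub>G\<^esub> tsum G V (\<lambda>(x, y). h x y)"
    and tsum_pure: "x \<in> carrier M \<Longrightarrow> y \<in> carrier N \<Longrightarrow> tsum G (pure T (x, y)) (\<lambda>(x, y). h x y) = h x y"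
    and tsum_cong: "U \<in> carrier T \<Longrightarrow> (\<And>x y. x \<in> carrier M \<Longrightarrow> y \<in> carrier N \<Longrightarrow> h x y = h' x y) \<Longrightarrow>
          tsum G U (\<lambda>(x, y). h x y) = tsum G U (\<lambda>(x, y). h' x y)"
  using pres.tsum_closed[OF bilinear_compatible[OF h]] pres.tsum_mult[OF bilinear_compatible[OF h]]
    pres.tsum_pure[OF bilinear_compatible[OF h], of "(x, y)"]
    pres.tsum_cong[OF bilinear_compatible[OF h], of U "\<lambda>(x, y). h' x y"]
  by auto

lemma bilinear_comp_hom:
  assumes "bilinear M N I G h" "f \<in> hom G G'" "comm_group G'"
  shows "bilinear M N I G' (\<lambda>x y. f (h x y))"
proof -
  have "f (h x y) = f (h x' y')" if "((x, y), (x', y')) \<in> I" for x y x' y'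
    using assms(1) that unfolding bilinear_def by (metis (no_types))
  then show ?thesis
    using assms unfolding bilinear_def by (simp add: hom_mult hom_in_carrier)
qed

lemma tsum_comp_hom:
  assumes h: "bilinear M N I G h" and f: "f \<in> hom G G'" "comm_group G'" and U: "U \<in> carrier T"
  shows "f (tsum G U (\<lambda>(x, y). h x y)) = tsum G' U (\<lambda>(x, y). f (h x y))"
  using U
proof (induct rule: induct)
  case (pure x y)
  then show ?case by (simp add: tsum_pure[OF h] tsum_pure[OF bilinear_comp_hom[OF h f]])
next
  case (mult U V)
  then show ?case
    by (simp add: tsum_mult[OF h] tsum_mult[OF bilinear_comp_hom[OF h f]] hom_mult[OF f(1)] tsum_closed[OF h])
qed

end

locale triple_tensor_product =
  fixes M :: "('m, 'y) ring_scheme" and N :: "('n, 'z) ring_scheme" and Q :: "('q, 'v) ring_scheme"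
    and I :: "(('m \<times> 'n \<times> 'q) \<times> ('m \<times> 'n \<times> 'q)) set" and T :: "(('m \<times> 'n \<times> 'q) \<Rightarrow>\<^sub>0 int) set monoid"
  assumes M: "abelian_group M" and N: "abelian_group N" and Q: "abelian_group Q"
    and I_sub: "I \<subseteq> (carrier M \<times> carrier N \<times> carrier Q) \<times> (carrier M \<times> carrier N \<times> carrier Q)"
    and T_tensor3: "T = tensor3 M N Q I"
begin

definition additivity :: "(('m \<times> 'n \<times> 'q) \<Rightarrow>\<^sub>0 int) set" where
  "additivity =
     {frag_of (x \<oplus>\<^bsub>M\<^esub> x', y, z) - frag_of (x, y, z) - frag_of (x', y, z) | x x' y z.
         x \<in> carrier M \<and> x' \<in> carrier M \<and> y \<in> carrier N \<and> z \<in> carrier Q} \<union>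
     {frag_of (x, y \<oplus>\<^bsub>N\<^esub> y', z) - frag_of (x, y, z) - frag_of (x, y', z) | x y y' z.
         x \<in> carrier M \<and> y \<in> carrier N \<and> y' \<in> carrier N \<and> z \<in> carrier Q} \<union>
     {frag_of (x, y, z \<oplus>\<^bsub>Q\<^esub> z') - frag_of (x, y, z) - frag_of (x, y, z') | x y z z'.
         x \<in> carrier M \<and> y \<in> carrier N \<and> z \<in> carrier Q \<and> z' \<in> carrier Q}"

interpretation M: abelian_group M by (rule M)
interpretation N: abelian_group N by (rule N)
interpretation Q: abelian_group Q by (rule Q)

sublocale pres: presentation "carrier M \<times> carrier N \<times> carrier Q" additivity I T
proof
  show "Poly_Mapping.keys a \<subseteq> carrier M \<times> carrier N \<times> carrier Q" if "a \<in> additivity" for a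
    using that unfolding additivity_def
    by (elim UnE CollectE exE conjE; hypsubst; intro keys_diff3) auto
qed (simp_all add: I_sub T_tensor3 tensor3_def additivity_def)

sublocale comm_group T
  by (rule pres.comm_group_T)

lemma pure_closed [simp]:
  "x \<in> carrier M \<Longrightarrow> y \<in> carrier N \<Longrightarrow> z \<in> carrier Q \<Longrightarrow> pure T (x, y, z) \<in> carrier T"
  by (rule pres.pure_closed) simp

lemma pure_add1:
  "x \<in> carrier M \<Longrightarrow> x' \<in> carrier M \<Longrightarrow> y \<in> carrier N \<Longrightarrow> z \<in> carrier Q \<Longrightarrow>
     pure T (x \<oplus>\<^bsub>M\<^esub> x', y, z) = pure T (x, y, z) \<otimes>\<^bsub>T\<^esub> pure T (x', y, z)"
  by (rule pres.pure_add) (auto simp: additivity_def)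

lemma pure_add2:
  "x \<in> carrier M \<Longrightarrow> y \<in> carrier N \<Longrightarrow> y' \<in> carrier N \<Longrightarrow> z \<in> carrier Q \<Longrightarrow>
     pure T (x, y \<oplus>\<^bsub>N\<^esub> y', z) = pure T (x, y, z) \<otimes>\<^bsub>T\<^esub> pure T (x, y', z)"
  by (rule pres.pure_add) (auto simp: additivity_def)

lemma pure_add3:
  "x \<in> carrier M \<Longrightarrow> y \<in> carrier N \<Longrightarrow> z \<in> carrier Q \<Longrightarrow> z' \<in> carrier Q \<Longrightarrow>
     pure T (x, y, z \<oplus>\<^bsub>Q\<^esub> z') = pure T (x, y, z) \<otimes>\<^bsub>T\<^esub> pure T (x, y, z')"
  by (rule pres.pure_add) (auto simp: additivity_def)

lemmas pure_cong = pres.pure_cong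

lemma trilinear_compatible:
  assumes h: "trilinear M N Q I G h"
  shows "compatible (carrier M \<times> carrier N \<times> carrier Q) additivity I G (\<lambda>(x, y, z). h x y z)"
proof -
  interpret G: comm_group G using h by (simp add: trilinear_def)
  have cl: "(\<lambda>(x, y, z). h x y z) \<in> carrier M \<times> carrier N \<times> carrier Q \<rightarrow> carrier G"
    using h by (auto simp: trilinear_def)
  have "free_eval G (\<lambda>(x, y, z). h x y z) a = \<one>\<^bsub>G\<^esub>" if "a \<in> additivity" for a
    using that unfolding additivity_def
    by (elim UnE CollectE exE conjE; hypsubst; intro G.free_eval_diff3[OF cl])
      (use h in \<open>auto simp: trilinear_def\<close>)
  moreover have "(\<lambda>(x, y, z). h x y z) u = (\<lambda>(x, y, z). h x y z) v" if "(u, v) \<in> I" for u v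
    using h that by (cases u, cases v) (simp add: trilinear_def)
  ultimately show ?thesis
    using G.comm_group_axioms cl by (auto simp: compatible_def)
qed

lemma
  assumes h: "trilinear M N Q I G h"
  shows tsum_closed: "U \<in> carrier T \<Longrightarrow> tsum G U (\<lambda>(x, y, z). h x y z) \<in> carrier G"
    and tsum_mult: "U \<in> carrier T \<Longrightarrow> V \<in> carrier T \<Longrightarrow> tsum G (U \<otimes>\<^bsub>T\<^esub> V) (\<lambda>(x, y, z). h x y z) =
          tsum G U (\<lambda>(x, y, z). h x y z) \<otimes>\<^bsub>G\<^esub> tsum G V (\<lambda>(x, y, z). h x y z)"
    and tsum_pure: "x \<in> carrier M \<Longrightarrow> y \<in> carrier N \<Longrightarrow> z \<in> carrier Q \<Longrightarrow>
          tsum G (pure T (x, y, z)) (\<lambda>(x, y, z). h x y z) = h x y z"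
  using pres.tsum_pure[OF trilinear_compatible[OF h], of "(x, y, z)"]
  by (simp_all add: pres.tsum_closed[OF trilinear_compatible[OF h]]
      pres.tsum_mult[OF trilinear_compatible[OF h]])

end

section \<open>Faithful flatness detects bijections\<close>

abbreviation ring_balance ::
  "('r, 'z) ring_scheme \<Rightarrow> ('r, 'u, 'y) module_scheme \<Rightarrow> ('r, 'm, 'x) module_scheme
     \<Rightarrow> (('u \<times> 'm) \<times> ('u \<times> 'm)) set" where
  "ring_balance R X M \<equiv> {((r \<odot>\<^bsub>X\<^esub> x, m), (x, r \<odot>\<^bsub>M\<^esub> m)) | r x m.
     r \<in> carrier R \<and> x \<in> carrier X \<and> m \<in> carrier M}"

lemma opp_simps [simp]:
  "carrier (opp R) = carrier R" "add (opp R) = add R" "ring.zero (opp R) = ring.zero R"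
  "one (opp R) = one R" "mult (opp R) = (\<lambda>x y. y \<otimes>\<^bsub>R\<^esub> x)"
  by (simp_all add: opp_def)

lemma abelian_group_cong:
  assumes "abelian_group M" "carrier X = carrier M" "add X = add M" "ring.zero X = ring.zero M"
  shows "abelian_group X"
proof -
  interpret M: abelian_group M by fact
  show ?thesis
  proof (rule abelian_groupI)
    show "\<exists>y\<in>carrier X. y \<oplus>\<^bsub>X\<^esub> x = \<zero>\<^bsub>X\<^esub>" if "x \<in> carrier X" for x
      using that by (intro bexI[of _ "\<ominus>\<^bsub>M\<^esub> x"]) (simp_all add: assms M.l_neg)
  qed (simp_all add: assms M.a_ac)
qed

lemma ring_opp:
  assumes "ring R" shows "ring (opp R)"
proof -
  interpret ring R by fact
  show ?thesis
  proof (rule ringI)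
    show "abelian_group (opp R)"
      by (rule abelian_group_cong[OF abelian_group_axioms]) simp_all
    show "Group.monoid (opp R)"
      by (rule monoidI) (simp_all add: m_assoc)
  qed (simp_all add: l_distr r_distr)
qed

lemma left_mod_ring_tensor:
  assumes "left_mod (opp R) X" "left_mod R M"
  shows "tensor_product X M (ring_balance R X M) (ring_tensor R X M)"
  by (rule tensor_product.intro) (use assms in \<open>auto simp: left_mod_def ring_tensor_def\<close>)

lemma lin_hom_bilinear:
  assumes X: "left_mod (opp R) X" and Y: "left_mod (opp R) Y" and M: "left_mod R M"
    and f: "f \<in> lin_hom (opp R) X Y"
  shows "bilinear X M (ring_balance R X M) (ring_tensor R Y M) (\<lambda>x m. pure (ring_tensor R Y M) (f x, m))"
proof -
  interpret TY: tensor_product Y M "ring_balance R Y M" "ring_tensor R Y M"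
    by (rule left_mod_ring_tensor[OF Y M])
  have fc: "f x \<in> carrier Y" if "x \<in> carrier X" for x
    using f that by (auto simp: lin_hom_def hom_def)
  have fa: "f (x \<oplus>\<^bsub>X\<^esub> x') = f x \<oplus>\<^bsub>Y\<^esub> f x'" if "x \<in> carrier X" "x' \<in> carrier X" for x x'
    using f that by (auto simp: lin_hom_def hom_def)
  have fs: "f (r \<odot>\<^bsub>X\<^esub> x) = r \<odot>\<^bsub>Y\<^esub> f x" if "r \<in> carrier R" "x \<in> carrier X" for r x
    using f that by (auto simp: lin_hom_def)
  show ?thesis
    unfolding bilinear_def
  proof (intro conjI ballI allI impI)
    show "comm_group (ring_tensor R Y M)" by (rule TY.comm_group_axioms)
  next
    fix x m x' m' assume "((x, m), (x', m')) \<in> ring_balance R X M"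
    then show "pure (ring_tensor R Y M) (f x, m) = pure (ring_tensor R Y M) (f x', m')"
      using fc fs by (auto intro!: TY.pure_cong)
  qed (simp_all add: fc fa TY.pure_add_left TY.pure_add_right)
qed

text \<open>Injectivity is exactness of \<open>0 \<rightarrow> X \<rightarrow> Y\<close> and surjectivity exactness of \<open>X \<rightarrow> Y \<rightarrow> 0\<close>; both
  are tested after tensoring with \<open>M\<close>, where \<open>0 \<otimes> M\<close> vanishes.\<close>

lemma faithfully_flat_detects_bij:
  fixes X Y :: "('r, 'u) module"
  assumes ff: "faithfully_flat TYPE('u) R M"
    and X: "left_mod (opp R) X" and Y: "left_mod (opp R) Y" and f: "f \<in> lin_hom (opp R) X Y"
    and bij: "bij_betw (\<lambda>U. tsum (ring_tensor R Y M) U (\<lambda>(x, m). pure (ring_tensor R Y M) (f x, m)))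
      (carrier (ring_tensor R X M)) (carrier (ring_tensor R Y M))" (is "bij_betw ?F _ _")
  shows "bij_betw f (carrier X) (carrier Y)"
proof -
  have M: "left_mod R M" using ff by (simp add: faithfully_flat_def)
  define Z where "Z = X\<lparr>carrier := {\<zero>\<^bsub>X\<^esub>}\<rparr>"
  have Zs: "carrier Z = {\<zero>\<^bsub>X\<^esub>}" "add Z = add X" "ring.zero Z = \<zero>\<^bsub>X\<^esub>" "smult Z = smult X"
    by (simp_all add: Z_def)
  interpret X: abelian_group X using X by (simp add: left_mod_def)
  interpret Y: abelian_group Y using Y by (simp add: left_mod_def)
  have smult_zero: "r \<odot>\<^bsub>X\<^esub> \<zero>\<^bsub>X\<^esub> = \<zero>\<^bsub>X\<^esub>" if r: "r \<in> carrier R" for r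
  proof -
    have "r \<odot>\<^bsub>X\<^esub> (\<zero>\<^bsub>X\<^esub> \<oplus>\<^bsub>X\<^esub> \<zero>\<^bsub>X\<^esub>) = r \<odot>\<^bsub>X\<^esub> \<zero>\<^bsub>X\<^esub> \<oplus>\<^bsub>X\<^esub> r \<odot>\<^bsub>X\<^esub> \<zero>\<^bsub>X\<^esub>" "r \<odot>\<^bsub>X\<^esub> \<zero>\<^bsub>X\<^esub> \<in> carrier X"
      using X r unfolding left_mod_def by (simp_all del: X.l_zero X.r_zero)
    then show ?thesis by (simp add: X.add.r_cancel_one')
  qed
  have Z: "left_mod (opp R) Z"
  proof -
    have "abelian_group Z"
      by (rule abelian_groupI) (simp_all add: Zs)
    then show ?thesis
      using X smult_zero unfolding left_mod_def Zs by simp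
  qed
  interpret TX: tensor_product X M "ring_balance R X M" "ring_tensor R X M"
    by (rule left_mod_ring_tensor[OF X M])
  interpret TY: tensor_product Y M "ring_balance R Y M" "ring_tensor R Y M"
    by (rule left_mod_ring_tensor[OF Y M])
  interpret TZ: tensor_product Z M "ring_balance R Z M" "ring_tensor R Z M"
    by (rule left_mod_ring_tensor[OF Z M])
  have triv: "U = \<one>\<^bsub>ring_tensor R Z M\<^esub>" if "U \<in> carrier (ring_tensor R Z M)" for U
    using that
  proof (induct rule: TZ.induct)
    case (pure x m)
    then show ?case using TZ.pure_zero_left by (simp add: Zs)
  qed simp
  have tsum_hom: "(\<lambda>U. tsum (ring_tensor R W M) U (\<lambda>(x, m). pure (ring_tensor R W M) (g x, m)))
      \<in> hom (ring_tensor R V M) (ring_tensor R W M)"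
    if V: "left_mod (opp R) V" and W: "left_mod (opp R) W" and g: "g \<in> lin_hom (opp R) V W"
    for V W :: "('r, 'u) module" and g
  proof -
    interpret TV: tensor_product V M "ring_balance R V M" "ring_tensor R V M"
      by (rule left_mod_ring_tensor[OF V M])
    show ?thesis
      by (rule homI)
        (simp_all add: TV.tsum_closed[OF lin_hom_bilinear[OF V W M g]] TV.tsum_mult[OF lin_hom_bilinear[OF V W M g]])
  qed
  have F: "?F \<in> hom (ring_tensor R X M) (ring_tensor R Y M)"
    by (rule tsum_hom[OF X Y f])
  interpret F: group_hom "ring_tensor R X M" "ring_tensor R Y M" ?F
    using F by (simp add: group_hom_def group_hom_axioms_def TX.group_axioms TY.group_axioms)
  interpret f: group_hom "add_monoid X" "add_monoid Y" f
    using f by (simp add: group_hom_def group_hom_axioms_def lin_hom_def X.a_group Y.a_group)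
  have "inj_on f (carrier X)"
  proof -
    define i :: "'u \<Rightarrow> 'u" where "i = (\<lambda>x. x)"
    have i: "i \<in> lin_hom (opp R) Z X"
      by (auto simp: i_def lin_hom_def hom_def Zs)
    interpret I: group_hom "ring_tensor R Z M" "ring_tensor R X M"
      "\<lambda>U. tsum (ring_tensor R X M) U (\<lambda>(x, m). pure (ring_tensor R X M) (i x, m))"
      using tsum_hom[OF Z X i]
      by (simp add: group_hom_def group_hom_axioms_def TX.group_axioms TZ.group_axioms)
    have "carrier (ring_tensor R Z M) = {\<one>\<^bsub>ring_tensor R Z M\<^esub>}"
      using triv TZ.one_closed by blast
    then have "kernel (ring_tensor R X M) (ring_tensor R Y M) ?F =
        (\<lambda>U. tsum (ring_tensor R X M) U (\<lambda>(x, m). pure (ring_tensor R X M) (i x, m)))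
          ` carrier (ring_tensor R Z M)"
    proof -
      have inj: "\<forall>U\<in>carrier (ring_tensor R X M). ?F U = \<one>\<^bsub>ring_tensor R Y M\<^esub> \<longrightarrow> U = \<one>\<^bsub>ring_tensor R X M\<^esub>"
        using bij unfolding bij_betw_def F.inj_on_one_iff Ball_def by (rule conjunct1)
      have "kernel (ring_tensor R X M) (ring_tensor R Y M) ?F = {\<one>\<^bsub>ring_tensor R X M\<^esub>}"
      proof (rule Set.set_eqI)
        show "U \<in> kernel (ring_tensor R X M) (ring_tensor R Y M) ?F \<longleftrightarrow> U \<in> {\<one>\<^bsub>ring_tensor R X M\<^esub>}" for U
          unfolding kernel_def mem_Collect_eq singleton_iff
          by (rule iffI, erule conjE, rule inj[rule_format], assumption+, erule ssubst,
              rule conjI[OF TX.one_closed F.hom_one])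
      qed
      then show ?thesis
        unfolding \<open>carrier (ring_tensor R Z M) = {\<one>\<^bsub>ring_tensor R Z M\<^esub>}\<close> image_insert image_empty I.hom_one .
    qed
    then have ker: "kernel (add_monoid X) (add_monoid Y) f = i ` carrier Z"
      by (rule conjunct2[OF ff[unfolded faithfully_flat_def], rule_format,
            OF conjI[OF Z conjI[OF X conjI[OF Y conjI[OF i f]]]], THEN iffD2])
    have "x = \<zero>\<^bsub>X\<^esub>" if "x \<in> carrier X" "f x = \<zero>\<^bsub>Y\<^esub>" for x
    proof -
      have "x \<in> kernel (add_monoid X) (add_monoid Y) f" using that by (simp add: kernel_def)
      then show ?thesis by (simp add: ker Zs i_def)
    qed
    then have "inj_on f (carrier (add_monoid X))"
      unfolding f.inj_on_one_iff by simp
    then show ?thesis by simp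
  qed
  moreover have "f ` carrier X = carrier Y"
  proof -
    define o0 :: "'u \<Rightarrow> 'u" where "o0 = (\<lambda>x. \<zero>\<^bsub>X\<^esub>)"
    have o: "o0 \<in> lin_hom (opp R) Y Z"
      by (auto simp: o0_def lin_hom_def hom_def Zs smult_zero)
    have "tsum (ring_tensor R Z M) U (\<lambda>(x, m). pure (ring_tensor R Z M) (o0 x, m)) = \<one>\<^bsub>ring_tensor R Z M\<^esub>"
      if "U \<in> carrier (ring_tensor R Y M)" for U
      by (rule triv[OF hom_in_carrier[OF tsum_hom[OF Y Z o] that]])
    then have "kernel (ring_tensor R Y M) (ring_tensor R Z M)
        (\<lambda>U. tsum (ring_tensor R Z M) U (\<lambda>(x, m). pure (ring_tensor R Z M) (o0 x, m))) =
        ?F ` carrier (ring_tensor R X M)"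
      using bij by (auto simp: kernel_def bij_betw_def)
    then have "kernel (add_monoid Y) (add_monoid Z) o0 = f ` carrier X"
      by (rule conjunct2[OF ff[unfolded faithfully_flat_def], rule_format,
            OF conjI[OF X conjI[OF Y conjI[OF Z conjI[OF f o]]]], THEN iffD2])
    then show ?thesis by (simp add: kernel_def o0_def Zs)
  qed
  ultimately show ?thesis by (simp add: bij_betw_def)
qed

text \<open>The given modules live on quotients of free groups, whereas faithful flatness speaks of
  modules on a universe; an injection \<open>e\<close> moves them there. The map \<open>act\<close> will be
  a right action, that is, a left action of the opposite ring.\<close>

definition transport ::
  "('v \<Rightarrow> 'u) \<Rightarrow> 'v monoid \<Rightarrow> ('r \<Rightarrow> 'v \<Rightarrow> 'v) \<Rightarrow> ('r, 'u) module" where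
  "transport e T act =
    \<lparr>carrier = e ` carrier T, mult = undefined, one = undefined,
     ring.zero = e \<one>\<^bsub>T\<^esub>, add = (\<lambda>u v. e (the_inv e u \<otimes>\<^bsub>T\<^esub> the_inv e v)),
     smult = (\<lambda>r u. e (act r (the_inv e u)))\<rparr>"

lemma transport_simps [simp]:
  "carrier (transport e T act) = e ` carrier T"
  "ring.zero (transport e T act) = e \<one>\<^bsub>T\<^esub>"
  "u \<oplus>\<^bsub>transport e T act\<^esub> v = e (the_inv e u \<otimes>\<^bsub>T\<^esub> the_inv e v)"
  "r \<odot>\<^bsub>transport e T act\<^esub> u = e (act r (the_inv e u))"
  by (simp_all add: transport_def)

locale scalar_extension =
  fixes R :: "('r, 'z) ring_scheme" and T :: "'v monoid" and act :: "'r \<Rightarrow> 'v \<Rightarrow> 'v"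
    and e :: "'v \<Rightarrow> 'u" and M :: "('r, 'm) module"
  assumes inj_e: "inj e"
    and M: "left_mod R M"
    and T: "comm_group T"
    and act_closed: "\<And>r U. r \<in> carrier R \<Longrightarrow> U \<in> carrier T \<Longrightarrow> act r U \<in> carrier T"
    and act_mult: "\<And>r U V. r \<in> carrier R \<Longrightarrow> U \<in> carrier T \<Longrightarrow> V \<in> carrier T \<Longrightarrow>
      act r (U \<otimes>\<^bsub>T\<^esub> V) = act r U \<otimes>\<^bsub>T\<^esub> act r V"
    and act_add: "\<And>r r' U. r \<in> carrier R \<Longrightarrow> r' \<in> carrier R \<Longrightarrow> U \<in> carrier T \<Longrightarrow>
      act (r \<oplus>\<^bsub>R\<^esub> r') U = act r U \<otimes>\<^bsub>T\<^esub> act r' U"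
    and act_act: "\<And>r r' U. r \<in> carrier R \<Longrightarrow> r' \<in> carrier R \<Longrightarrow> U \<in> carrier T \<Longrightarrow>
      act (r \<otimes>\<^bsub>R\<^esub> r') U = act r' (act r U)"
    and act_one: "\<And>U. U \<in> carrier T \<Longrightarrow> act \<one>\<^bsub>R\<^esub> U = U"
begin

abbreviation "X \<equiv> transport e T act"
abbreviation "XM \<equiv> ring_tensor R X M"

interpretation T: comm_group T by (rule T)

lemma the_inv_e [simp]: "the_inv e (e U) = U"
  by (simp add: the_inv_f_f inj_e)

lemma left_mod_transport: "left_mod (opp R) X"
proof -
  have "abelian_group X"
  proof (rule abelian_groupI)
    show "\<exists>y\<in>carrier X. y \<oplus>\<^bsub>X\<^esub> x = \<zero>\<^bsub>X\<^esub>" if "x \<in> carrier X" for x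
      using that by (auto intro!: bexI[of _ "inv\<^bsub>T\<^esub> _"])
  qed (auto simp: T.m_ac)
  then show ?thesis
    using M by (auto simp: left_mod_def ring_opp act_closed act_mult act_add act_act act_one)
qed

sublocale tensor: tensor_product X M "ring_balance R X M" XM
  by (rule left_mod_ring_tensor[OF left_mod_transport M])

text \<open>The pure tensor \<open>U \<otimes> m\<close>, with \<open>U\<close> named by its original in \<open>T\<close>.\<close>

definition elt :: "'v \<Rightarrow> 'm \<Rightarrow> (('u \<times> 'm) \<Rightarrow>\<^sub>0 int) set" where
  "elt U m = pure XM (e U, m)"

lemma elt_closed: "U \<in> carrier T \<Longrightarrow> m \<in> carrier M \<Longrightarrow> elt U m \<in> carrier XM"
  by (simp add: elt_def)

lemma elt_mult:
  "U \<in> carrier T \<Longrightarrow> V \<in> carrier T \<Longrightarrow> m \<in> carrier M \<Longrightarrow> elt (U \<otimes>\<^bsub>T\<^esub> V) m = elt U m \<otimes>\<^bsub>XM\<^esub> elt V m"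
  using tensor.pure_add_left[of "e U" "e V" m] by (simp add: elt_def)

lemma elt_add:
  "U \<in> carrier T \<Longrightarrow> m \<in> carrier M \<Longrightarrow> m' \<in> carrier M \<Longrightarrow> elt U (m \<oplus>\<^bsub>M\<^esub> m') = elt U m \<otimes>\<^bsub>XM\<^esub> elt U m'"
  by (simp add: elt_def tensor.pure_add_right)

lemma elt_act:
  "r \<in> carrier R \<Longrightarrow> U \<in> carrier T \<Longrightarrow> m \<in> carrier M \<Longrightarrow> elt (act r U) m = elt U (r \<odot>\<^bsub>M\<^esub> m)"
  unfolding elt_def by (rule tensor.pure_cong) (force intro: exI[of _ r] exI[of _ "e U"])

lemma ext_induct [consumes 1, case_names elt mult]:
  assumes "W \<in> carrier XM" "\<And>U m. U \<in> carrier T \<Longrightarrow> m \<in> carrier M \<Longrightarrow> Q (elt U m)"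
    and "\<And>V W. V \<in> carrier XM \<Longrightarrow> W \<in> carrier XM \<Longrightarrow> Q V \<Longrightarrow> Q W \<Longrightarrow> Q (V \<otimes>\<^bsub>XM\<^esub> W)"
  shows "Q W"
  using assms(1) by (induct rule: tensor.induct) (auto simp: assms(3) assms(2)[unfolded elt_def])

definition ext_lift :: "('g, 'w) monoid_scheme \<Rightarrow> ('v \<Rightarrow> 'm \<Rightarrow> 'g) \<Rightarrow> (('u \<times> 'm) \<Rightarrow>\<^sub>0 int) set \<Rightarrow> 'g" where
  "ext_lift G h W = tsum G W (\<lambda>(u, m). h (the_inv e u) m)"

context
  fixes G :: "('g, 'w) monoid_scheme" and h
  assumes G: "comm_group G"
    and h_closed: "\<And>U m. U \<in> carrier T \<Longrightarrow> m \<in> carrier M \<Longrightarrow> h U m \<in> carrier G"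
    and h_mult: "\<And>U V m. U \<in> carrier T \<Longrightarrow> V \<in> carrier T \<Longrightarrow> m \<in> carrier M \<Longrightarrow>
      h (U \<otimes>\<^bsub>T\<^esub> V) m = h U m \<otimes>\<^bsub>G\<^esub> h V m"
    and h_add: "\<And>U m m'. U \<in> carrier T \<Longrightarrow> m \<in> carrier M \<Longrightarrow> m' \<in> carrier M \<Longrightarrow>
      h U (m \<oplus>\<^bsub>M\<^esub> m') = h U m \<otimes>\<^bsub>G\<^esub> h U m'"
    and h_act: "\<And>r U m. r \<in> carrier R \<Longrightarrow> U \<in> carrier T \<Longrightarrow> m \<in> carrier M \<Longrightarrow>
      h (act r U) m = h U (r \<odot>\<^bsub>M\<^esub> m)"
begin

lemma ext_bilinear: "bilinear X M (ring_balance R X M) G (\<lambda>u m. h (the_inv e u) m)"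
  unfolding bilinear_def using h_act by (auto simp: G h_closed h_mult h_add)

lemma ext_lift_closed: "W \<in> carrier XM \<Longrightarrow> ext_lift G h W \<in> carrier G"
  unfolding ext_lift_def by (rule tensor.tsum_closed[OF ext_bilinear])

lemma ext_lift_mult: "V \<in> carrier XM \<Longrightarrow> W \<in> carrier XM \<Longrightarrow>
    ext_lift G h (V \<otimes>\<^bsub>XM\<^esub> W) = ext_lift G h V \<otimes>\<^bsub>G\<^esub> ext_lift G h W"
  unfolding ext_lift_def by (rule tensor.tsum_mult[OF ext_bilinear])

lemma ext_lift_elt: "U \<in> carrier T \<Longrightarrow> m \<in> carrier M \<Longrightarrow> ext_lift G h (elt U m) = h U m"
  using tensor.tsum_pure[OF ext_bilinear, of "e U" m] by (simp add: ext_lift_def elt_def)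

end

end

text \<open>The map in the last hypothesis is \<open>f \<otimes> M\<close>.\<close>

lemma scalar_extension_detects_bij:
  fixes e :: "'v \<Rightarrow> 'u"
  assumes ff: "faithfully_flat TYPE('u) R M"
    and s1: "scalar_extension R T act e M" and s2: "scalar_extension R T' act' e M"
    and f: "f \<in> hom T T'" and f_act: "\<And>r U. r \<in> carrier R \<Longrightarrow> U \<in> carrier T \<Longrightarrow> f (act r U) = act' r (f U)"
    and bij: "bij_betw (scalar_extension.ext_lift e (scalar_extension.XM R T' act' e M)
       (\<lambda>U. scalar_extension.elt R T' act' e M (f U)))
      (carrier (scalar_extension.XM R T act e M)) (carrier (scalar_extension.XM R T' act' e M))"
  shows "bij_betw f (carrier T) (carrier T')"
proof -
  interpret s1: scalar_extension R T act e M by fact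
  interpret s2: scalar_extension R T' act' e M by fact
  have g: "(\<lambda>u. e (f (the_inv e u))) \<in> lin_hom (opp R) s1.X s2.X"
    using f by (auto simp: lin_hom_def hom_def f_act)
  have "bij_betw (\<lambda>u. e (f (the_inv e u))) (carrier s1.X) (carrier s2.X)"
    by (rule faithfully_flat_detects_bij[OF ff s1.left_mod_transport s2.left_mod_transport g])
      (use bij in \<open>unfold s1.ext_lift_def s2.elt_def\<close>)
  then have inj: "inj_on (\<lambda>u. e (f (the_inv e u))) (e ` carrier T)"
    and img: "(\<lambda>u. e (f (the_inv e u))) ` e ` carrier T = e ` carrier T'"
    by (simp_all add: bij_betw_def)
  have "inj_on f (carrier T)"
  proof (rule inj_onI)
    fix U V assume UV: "U \<in> carrier T" "V \<in> carrier T" "f U = f V"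
    have "e U = e V"
      by (rule inj_onD[OF inj]) (use UV in simp_all)
    then show "U = V" by (rule injD[OF s1.inj_e])
  qed
  moreover have "e ` f ` carrier T = e ` carrier T'"
    using img by (simp add: image_image)
  then have "f ` carrier T = carrier T'"
    by (simp only: inj_image_eq_iff[OF s1.inj_e])
  ultimately show ?thesis by (simp add: bij_betw_def)
qed

section \<open>Rings over the base of a bialgebroid\<close>

lemma ring_bimodule_simps [simp]:
  "carrier (ring_bimodule P \<eta>) = carrier P" "add (ring_bimodule P \<eta>) = add P"
  "ring.zero (ring_bimodule P \<eta>) = ring.zero P" "smult (ring_bimodule P \<eta>) = smult P"
  "lact (ring_bimodule P \<eta>) b p = \<eta> b \<otimes>\<^bsub>P\<^esub> p" "ract (ring_bimodule P \<eta>) p b = p \<otimes>\<^bsub>P\<^esub> \<eta> b"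
  by (simp_all add: ring_bimodule_def)

locale bialg =
  fixes H :: "('k, 'b, 'l) bialgebroid"
  assumes H: "left_bialgebroid H"
begin

abbreviation "L \<equiv> total H"
abbreviation "B \<equiv> base H"
abbreviation "s \<equiv> src H"
abbreviation "t \<equiv> tgt H"

sublocale L: ring L
  using H by (simp add: left_bialgebroid_def k_algebra_def)

sublocale B: ring B
  using H by (simp add: left_bialgebroid_def k_algebra_def)

lemma s_hom: "s \<in> k_alg_hom (ground H) B L"
  using H by (simp add: left_bialgebroid_def)

lemma t_hom: "t \<in> k_alg_hom (ground H) (opp B) L"
  using H by (simp add: left_bialgebroid_def)

lemma s_simps [simp]:
  "b \<in> carrier B \<Longrightarrow> s b \<in> carrier L" "s \<one>\<^bsub>B\<^esub> = \<one>\<^bsub>L\<^esub>"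
  using s_hom by (auto simp: k_alg_hom_def ring_hom_def)

lemma t_simps [simp]:
  "b \<in> carrier B \<Longrightarrow> t b \<in> carrier L" "t \<one>\<^bsub>B\<^esub> = \<one>\<^bsub>L\<^esub>"
  "b \<in> carrier B \<Longrightarrow> c \<in> carrier B \<Longrightarrow> t (b \<oplus>\<^bsub>B\<^esub> c) = t b \<oplus>\<^bsub>L\<^esub> t c"
  "b \<in> carrier B \<Longrightarrow> c \<in> carrier B \<Longrightarrow> t (b \<otimes>\<^bsub>B\<^esub> c) = t c \<otimes>\<^bsub>L\<^esub> t b"
  using t_hom by (auto simp: k_alg_hom_def ring_hom_def)

lemma s_t_commute:
  "b \<in> carrier B \<Longrightarrow> c \<in> carrier B \<Longrightarrow> s b \<otimes>\<^bsub>L\<^esub> t c = t c \<otimes>\<^bsub>L\<^esub> s b"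
  using H by (simp add: left_bialgebroid_def)

lemma s_t_left_commute:
  assumes "b \<in> carrier B" "c \<in> carrier B" "x \<in> carrier L"
  shows "s b \<otimes>\<^bsub>L\<^esub> (t c \<otimes>\<^bsub>L\<^esub> x) = t c \<otimes>\<^bsub>L\<^esub> (s b \<otimes>\<^bsub>L\<^esub> x)"
  using assms s_t_commute by (metis L.m_assoc s_simps(1) t_simps(1))

lemma ground_in_base:
  "c \<in> carrier (ground H) \<Longrightarrow> c \<odot>\<^bsub>B\<^esub> \<one>\<^bsub>B\<^esub> \<in> carrier B"
  using H by (auto simp: left_bialgebroid_def k_algebra_def intro: module.smult_closed)

text \<open>Over all algebras in sight the ground field acts through its image in the base. Therefore the
  relations balancing a tensor product over \<open>k\<close> are among those balancing it over \<open>B\<close> or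
  over the coinvariants, and only the latter have to be checked.\<close>

lemma ground_smult:
  assumes "k_algebra (ground H) A" "f \<in> k_alg_hom (ground H) B A \<or> f \<in> k_alg_hom (ground H) (opp B) A"
    and "c \<in> carrier (ground H)" "x \<in> carrier A"
  shows "f (c \<odot>\<^bsub>B\<^esub> \<one>\<^bsub>B\<^esub>) \<otimes>\<^bsub>A\<^esub> x = c \<odot>\<^bsub>A\<^esub> x" "x \<otimes>\<^bsub>A\<^esub> f (c \<odot>\<^bsub>B\<^esub> \<one>\<^bsub>B\<^esub>) = c \<odot>\<^bsub>A\<^esub> x"
proof -
  interpret A: ring A using assms(1) by (simp add: k_algebra_def)
  have [simp]: "smult (opp B) = smult B" by (simp add: opp_def)
  have "f (c \<odot>\<^bsub>B\<^esub> \<one>\<^bsub>B\<^esub>) = c \<odot>\<^bsub>A\<^esub> \<one>\<^bsub>A\<^esub>"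
    using assms(2,3) by (auto simp: k_alg_hom_def ring_hom_def)
  then show "f (c \<odot>\<^bsub>B\<^esub> \<one>\<^bsub>B\<^esub>) \<otimes>\<^bsub>A\<^esub> x = c \<odot>\<^bsub>A\<^esub> x" "x \<otimes>\<^bsub>A\<^esub> f (c \<odot>\<^bsub>B\<^esub> \<one>\<^bsub>B\<^esub>) = c \<odot>\<^bsub>A\<^esub> x"
    using assms(1,3,4) unfolding k_algebra_def by simp_all
qed

end

locale bialg_ring = bialg H
  for H :: "('k, 'b, 'l) bialgebroid" +
  fixes P :: "('k, 'p) module" and \<eta> :: "'b \<Rightarrow> 'p"
  assumes P: "k_algebra (ground H) P" and \<eta>_hom: "\<eta> \<in> k_alg_hom (ground H) (base H) P"
begin

sublocale P: ring P
  using P by (simp add: k_algebra_def)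

lemma \<eta>_simps [simp]:
  "b \<in> carrier B \<Longrightarrow> \<eta> b \<in> carrier P" "\<eta> \<one>\<^bsub>B\<^esub> = \<one>\<^bsub>P\<^esub>"
  using \<eta>_hom by (auto simp: k_alg_hom_def ring_hom_def)

lemma smult_L:
  "c \<in> carrier (ground H) \<Longrightarrow> x \<in> carrier L \<Longrightarrow> c \<odot>\<^bsub>L\<^esub> x = s (c \<odot>\<^bsub>B\<^esub> \<one>\<^bsub>B\<^esub>) \<otimes>\<^bsub>L\<^esub> x"
  "c \<in> carrier (ground H) \<Longrightarrow> x \<in> carrier L \<Longrightarrow> c \<odot>\<^bsub>L\<^esub> x = t (c \<odot>\<^bsub>B\<^esub> \<one>\<^bsub>B\<^esub>) \<otimes>\<^bsub>L\<^esub> x"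
  using ground_smult[of L s] ground_smult[of L t] s_hom t_hom H
  by (simp_all add: left_bialgebroid_def)

lemma smult_P:
  "c \<in> carrier (ground H) \<Longrightarrow> p \<in> carrier P \<Longrightarrow> c \<odot>\<^bsub>P\<^esub> p = \<eta> (c \<odot>\<^bsub>B\<^esub> \<one>\<^bsub>B\<^esub>) \<otimes>\<^bsub>P\<^esub> p"
  "c \<in> carrier (ground H) \<Longrightarrow> p \<in> carrier P \<Longrightarrow> c \<odot>\<^bsub>P\<^esub> p = p \<otimes>\<^bsub>P\<^esub> \<eta> (c \<odot>\<^bsub>B\<^esub> \<one>\<^bsub>B\<^esub>)"
  using ground_smult[of P \<eta>] \<eta>_hom P by simp_all

section \<open>The product \<open>\<L> \<diamondop>\<^sub>B P\<close>\<close>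

abbreviation "D \<equiv> dia H (ring_bimodule P \<eta>)"

definition dia_balance :: "(('l \<times> 'p) \<times> ('l \<times> 'p)) set" where
  "dia_balance = {((t b \<otimes>\<^bsub>L\<^esub> x, p), (x, \<eta> b \<otimes>\<^bsub>P\<^esub> p)) | b x p.
     b \<in> carrier B \<and> x \<in> carrier L \<and> p \<in> carrier P}"

lemma D_eq: "D = tensor2 L P dia_balance"
proof -
  have "bal2 (ground H) L (ring_bimodule P \<eta>) \<subseteq> dia_balance"
  proof
    fix z assume "z \<in> bal2 (ground H) L (ring_bimodule P \<eta>)"
    then obtain c x p where z: "z = ((c \<odot>\<^bsub>L\<^esub> x, p), (x, c \<odot>\<^bsub>P\<^esub> p))"
      and cxp: "c \<in> carrier (ground H)" "x \<in> carrier L" "p \<in> carrier P"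
      by (auto simp: bal2_def)
    show "z \<in> dia_balance"
      unfolding dia_balance_def z smult_L(2)[OF cxp(1,2)] smult_P(1)[OF cxp(1,3)]
      using cxp ground_in_base[OF cxp(1)] by blast
  qed
  then have "bal2 (ground H) L (ring_bimodule P \<eta>) \<union> dia_balance = dia_balance" by blast
  then show ?thesis
    unfolding dia_def dia_balance_def by (simp add: tensor2_def)
qed

sublocale D: tensor_product L P dia_balance D
  by (rule tensor_product.intro)
    (auto simp: D_eq dia_balance_def L.abelian_group_axioms P.abelian_group_axioms)

lemma D_balance:
  "b \<in> carrier B \<Longrightarrow> x \<in> carrier L \<Longrightarrow> p \<in> carrier P \<Longrightarrow>
     pure D (t b \<otimes>\<^bsub>L\<^esub> x, p) = pure D (x, \<eta> b \<otimes>\<^bsub>P\<^esub> p)"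
  by (rule D.pure_cong) (auto simp: dia_balance_def)

lemma D_bilinearI:
  assumes "comm_group G"
    and "\<And>x p. x \<in> carrier L \<Longrightarrow> p \<in> carrier P \<Longrightarrow> h x p \<in> carrier G"
    and "\<And>x x' p. x \<in> carrier L \<Longrightarrow> x' \<in> carrier L \<Longrightarrow> p \<in> carrier P \<Longrightarrow>
      h (x \<oplus>\<^bsub>L\<^esub> x') p = h x p \<otimes>\<^bsub>G\<^esub> h x' p"
    and "\<And>x p p'. x \<in> carrier L \<Longrightarrow> p \<in> carrier P \<Longrightarrow> p' \<in> carrier P \<Longrightarrow>
      h x (p \<oplus>\<^bsub>P\<^esub> p') = h x p \<otimes>\<^bsub>G\<^esub> h x p'"
    and "\<And>b x p. b \<in> carrier B \<Longrightarrow> x \<in> carrier L \<Longrightarrow> p \<in> carrier P \<Longrightarrow>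
      h (t b \<otimes>\<^bsub>L\<^esub> x) p = h x (\<eta> b \<otimes>\<^bsub>P\<^esub> p)"
  shows "bilinear L P dia_balance G h"
  using assms unfolding bilinear_def dia_balance_def by auto

text \<open>Three commuting actions on \<open>\<L> \<diamondop>\<^sub>B P\<close>. In terms of them \<open>\<phi>(x \<otimes> p)\<close> is \<open>rmul_total x (\<delta> p)\<close> and
  \<open>can(p \<otimes> q)\<close> is \<open>rmul_ring q (\<delta> p)\<close>.\<close>

definition rmul_total :: "'l \<Rightarrow> (('l \<times> 'p) \<Rightarrow>\<^sub>0 int) set \<Rightarrow> (('l \<times> 'p) \<Rightarrow>\<^sub>0 int) set" where
  "rmul_total x U = tsum D U (\<lambda>(y, p). pure D (y \<otimes>\<^bsub>L\<^esub> x, p))"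

definition lmul_src :: "'b \<Rightarrow> (('l \<times> 'p) \<Rightarrow>\<^sub>0 int) set \<Rightarrow> (('l \<times> 'p) \<Rightarrow>\<^sub>0 int) set" where
  "lmul_src b U = tsum D U (\<lambda>(y, p). pure D (s b \<otimes>\<^bsub>L\<^esub> y, p))"

definition rmul_ring :: "'p \<Rightarrow> (('l \<times> 'p) \<Rightarrow>\<^sub>0 int) set \<Rightarrow> (('l \<times> 'p) \<Rightarrow>\<^sub>0 int) set" where
  "rmul_ring q U = tsum D U (\<lambda>(y, p). pure D (y, p \<otimes>\<^bsub>P\<^esub> q))"

lemma rmul_total_bilinear:
  "x \<in> carrier L \<Longrightarrow> bilinear L P dia_balance D (\<lambda>y p. pure D (y \<otimes>\<^bsub>L\<^esub> x, p))"
  by (rule D_bilinearI) (simp_all add: D.comm_group_axioms D.pure_add_left D.pure_add_right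
      L.l_distr L.m_assoc D_balance)

lemma lmul_src_bilinear:
  "b \<in> carrier B \<Longrightarrow> bilinear L P dia_balance D (\<lambda>y p. pure D (s b \<otimes>\<^bsub>L\<^esub> y, p))"
  by (rule D_bilinearI) (simp_all add: D.comm_group_axioms D.pure_add_left D.pure_add_right
      L.r_distr s_t_left_commute D_balance)

lemma rmul_ring_bilinear:
  "q \<in> carrier P \<Longrightarrow> bilinear L P dia_balance D (\<lambda>y p. pure D (y, p \<otimes>\<^bsub>P\<^esub> q))"
  by (rule D_bilinearI) (simp_all add: D.comm_group_axioms D.pure_add_left D.pure_add_right
      P.l_distr P.m_assoc D_balance)

lemmas rmul_total_simps [simp] =
  D.tsum_closed[OF rmul_total_bilinear, folded rmul_total_def] D.tsum_mult[OF rmul_total_bilinear, folded rmul_total_def]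
  D.tsum_pure[OF rmul_total_bilinear, folded rmul_total_def]

lemmas lmul_src_simps [simp] =
  D.tsum_closed[OF lmul_src_bilinear, folded lmul_src_def] D.tsum_mult[OF lmul_src_bilinear, folded lmul_src_def]
  D.tsum_pure[OF lmul_src_bilinear, folded lmul_src_def]

lemmas rmul_ring_simps [simp] =
  D.tsum_closed[OF rmul_ring_bilinear, folded rmul_ring_def] D.tsum_mult[OF rmul_ring_bilinear, folded rmul_ring_def]
  D.tsum_pure[OF rmul_ring_bilinear, folded rmul_ring_def]

lemma rmul_total_one [simp]: "U \<in> carrier D \<Longrightarrow> rmul_total \<one>\<^bsub>L\<^esub> U = U"
  by (induct rule: D.induct) simp_all

lemma lmul_src_one [simp]: "U \<in> carrier D \<Longrightarrow> lmul_src \<one>\<^bsub>B\<^esub> U = U"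
  by (induct rule: D.induct) simp_all

lemma rmul_ring_one [simp]: "U \<in> carrier D \<Longrightarrow> rmul_ring \<one>\<^bsub>P\<^esub> U = U"
  by (induct rule: D.induct) simp_all

lemma rmul_total_add:
  "U \<in> carrier D \<Longrightarrow> x \<in> carrier L \<Longrightarrow> x' \<in> carrier L \<Longrightarrow> rmul_total (x \<oplus>\<^bsub>L\<^esub> x') U = rmul_total x U \<otimes>\<^bsub>D\<^esub> rmul_total x' U"
  by (induct rule: D.induct) (simp_all add: L.r_distr D.pure_add_left D.m_ac)

lemma rmul_ring_add:
  "U \<in> carrier D \<Longrightarrow> q \<in> carrier P \<Longrightarrow> q' \<in> carrier P \<Longrightarrow> rmul_ring (q \<oplus>\<^bsub>P\<^esub> q') U = rmul_ring q U \<otimes>\<^bsub>D\<^esub> rmul_ring q' U"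
  by (induct rule: D.induct) (simp_all add: P.r_distr D.pure_add_right D.m_ac)

lemma rmul_total_mult:
  "U \<in> carrier D \<Longrightarrow> x \<in> carrier L \<Longrightarrow> y \<in> carrier L \<Longrightarrow> rmul_total (x \<otimes>\<^bsub>L\<^esub> y) U = rmul_total y (rmul_total x U)"
  by (induct rule: D.induct) (simp_all add: L.m_assoc)

lemma rmul_ring_mult:
  "U \<in> carrier D \<Longrightarrow> p \<in> carrier P \<Longrightarrow> q \<in> carrier P \<Longrightarrow> rmul_ring (p \<otimes>\<^bsub>P\<^esub> q) U = rmul_ring q (rmul_ring p U)"
  by (induct rule: D.induct) (simp_all add: P.m_assoc)

lemma rmul_total_rmul_ring:
  "U \<in> carrier D \<Longrightarrow> x \<in> carrier L \<Longrightarrow> q \<in> carrier P \<Longrightarrow> rmul_total x (rmul_ring q U) = rmul_ring q (rmul_total x U)"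
  by (induct rule: D.induct) simp_all

lemma lmul_src_rmul_ring:
  "U \<in> carrier D \<Longrightarrow> b \<in> carrier B \<Longrightarrow> q \<in> carrier P \<Longrightarrow> lmul_src b (rmul_ring q U) = rmul_ring q (lmul_src b U)"
  by (induct rule: D.induct) simp_all

lemma takeuchi_closed: "U \<in> takeuchi H (ring_bimodule P \<eta>) \<Longrightarrow> U \<in> carrier D"
  by (simp add: takeuchi_def)

lemma takeuchi_rmul_total_rmul_ring:
  "U \<in> takeuchi H (ring_bimodule P \<eta>) \<Longrightarrow> b \<in> carrier B \<Longrightarrow> rmul_total (t b) U = rmul_ring (\<eta> b) U"
  by (simp add: takeuchi_def rmul_total_def rmul_ring_def)

lemma mult_pure:
  assumes "U \<in> carrier D" and xq: "y \<in> carrier L" "q \<in> carrier P"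
  shows "tsum D U (\<lambda>(x, p). pure D (x \<otimes>\<^bsub>L\<^esub> y, p \<otimes>\<^bsub>P\<^esub> q)) = rmul_total y (rmul_ring q U)"
proof -
  have b: "bilinear L P dia_balance D (\<lambda>x p. pure D (x \<otimes>\<^bsub>L\<^esub> y, p \<otimes>\<^bsub>P\<^esub> q))"
    by (rule D_bilinearI) (simp_all add: xq D.comm_group_axioms D.pure_add_left D.pure_add_right
      P.l_distr P.m_assoc L.l_distr L.m_assoc D_balance)
  from assms(1) show ?thesis
    by (induct rule: D.induct) (simp_all add: xq D.tsum_mult[OF b] D.tsum_pure[OF b])
qed

text \<open>The defining property of \<open>\<L> \<times>\<^sub>B P\<close> is what makes the product by \<open>y \<otimes> q\<close> balanced in
  \<open>y \<otimes> q\<close>.\<close>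

lemma takeuchi_mult_pure:
  assumes U: "U \<in> takeuchi H (ring_bimodule P \<eta>)" and yq: "y \<in> carrier L" "q \<in> carrier P"
  shows "takeuchi_mult H P \<eta> U (pure D (y, q)) = rmul_total y (rmul_ring q U)"
proof -
  note UD = takeuchi_closed[OF U]
  have "bilinear L P dia_balance D
      (\<lambda>y q. tsum D U (\<lambda>(x, p). pure D (x \<otimes>\<^bsub>L\<^esub> y, p \<otimes>\<^bsub>P\<^esub> q)))"
    by (rule D_bilinearI)
      (simp_all add: mult_pure UD D.comm_group_axioms rmul_total_add rmul_ring_add rmul_total_mult rmul_ring_mult rmul_total_rmul_ring
        takeuchi_rmul_total_rmul_ring[OF U])
  from D.tsum_pure[OF this yq] show ?thesis
    by (simp add: takeuchi_mult_def mult_pure UD yq)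
qed

lemma bimodule_pure:
  assumes "U \<in> carrier D" and b: "b \<in> carrier B" "b' \<in> carrier B"
  shows "tsum D U (\<lambda>(x, p). pure D (s b \<otimes>\<^bsub>L\<^esub> x \<otimes>\<^bsub>L\<^esub> s b', p)) = rmul_total (s b') (lmul_src b U)"
proof -
  have h: "bilinear L P dia_balance D (\<lambda>x p. pure D (s b \<otimes>\<^bsub>L\<^esub> x \<otimes>\<^bsub>L\<^esub> s b', p))"
    by (rule D_bilinearI) (simp_all add: b D.comm_group_axioms D.pure_add_left D.pure_add_right
      L.l_distr L.r_distr L.m_assoc D_balance s_t_left_commute)
  from assms(1) show ?thesis
    by (induct rule: D.induct) (simp_all add: b D.tsum_mult[OF h] D.tsum_pure[OF h])
qed

section \<open>The product \<open>\<L> \<otimes>\<^sup>B P\<close>\<close>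

abbreviation "E \<equiv> bten H (ring_bimodule P \<eta>)"

definition bten_balance :: "(('l \<times> 'p) \<times> ('l \<times> 'p)) set" where
  "bten_balance = {((s b \<otimes>\<^bsub>L\<^esub> x, p), (x, p \<otimes>\<^bsub>P\<^esub> \<eta> b)) | b x p.
     b \<in> carrier B \<and> x \<in> carrier L \<and> p \<in> carrier P}"

lemma E_eq: "E = tensor2 L P bten_balance"
proof -
  have "bal2 (ground H) L (ring_bimodule P \<eta>) \<subseteq> bten_balance"
  proof
    fix z assume "z \<in> bal2 (ground H) L (ring_bimodule P \<eta>)"
    then obtain c x p where z: "z = ((c \<odot>\<^bsub>L\<^esub> x, p), (x, c \<odot>\<^bsub>P\<^esub> p))"
      and cxp: "c \<in> carrier (ground H)" "x \<in> carrier L" "p \<in> carrier P"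
      by (auto simp: bal2_def)
    show "z \<in> bten_balance"
      unfolding bten_balance_def z smult_L(1)[OF cxp(1,2)] smult_P(2)[OF cxp(1,3)]
      using cxp ground_in_base[OF cxp(1)] by blast
  qed
  then have "bal2 (ground H) L (ring_bimodule P \<eta>) \<union> bten_balance = bten_balance" by blast
  then show ?thesis
    unfolding bten_def bten_balance_def by (simp add: tensor2_def)
qed

sublocale E: tensor_product L P bten_balance E
  by (rule tensor_product.intro)
    (auto simp: E_eq bten_balance_def L.abelian_group_axioms P.abelian_group_axioms)

lemma E_balance:
  "b \<in> carrier B \<Longrightarrow> x \<in> carrier L \<Longrightarrow> p \<in> carrier P \<Longrightarrow>
     pure E (s b \<otimes>\<^bsub>L\<^esub> x, p) = pure E (x, p \<otimes>\<^bsub>P\<^esub> \<eta> b)"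
  by (rule E.pure_cong) (auto simp: bten_balance_def)

lemma E_bilinearI:
  assumes "comm_group G"
    and "\<And>x p. x \<in> carrier L \<Longrightarrow> p \<in> carrier P \<Longrightarrow> h x p \<in> carrier G"
    and "\<And>x x' p. x \<in> carrier L \<Longrightarrow> x' \<in> carrier L \<Longrightarrow> p \<in> carrier P \<Longrightarrow>
      h (x \<oplus>\<^bsub>L\<^esub> x') p = h x p \<otimes>\<^bsub>G\<^esub> h x' p"
    and "\<And>x p p'. x \<in> carrier L \<Longrightarrow> p \<in> carrier P \<Longrightarrow> p' \<in> carrier P \<Longrightarrow>
      h x (p \<oplus>\<^bsub>P\<^esub> p') = h x p \<otimes>\<^bsub>G\<^esub> h x p'"
    and "\<And>b x p. b \<in> carrier B \<Longrightarrow> x \<in> carrier L \<Longrightarrow> p \<in> carrier P \<Longrightarrow>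
      h (s b \<otimes>\<^bsub>L\<^esub> x) p = h x (p \<otimes>\<^bsub>P\<^esub> \<eta> b)"
  shows "bilinear L P bten_balance G h"
  using assms unfolding bilinear_def bten_balance_def by auto

end

section \<open>Coactions and the skew regularity map\<close>

text \<open>What the coaction on \<open>P\<close> and the comultiplication of \<open>\<L>\<close> have in common. The map \<open>\<phi>\<close> is
  formed from it, and for the comultiplication \<open>\<phi>\<close> is the Hopf map.\<close>

locale coacted_ring = bialg_ring H P \<eta>
  for H :: "('k, 'b, 'l) bialgebroid" and P :: "('k, 'p) module" and \<eta> :: "'b \<Rightarrow> 'p" +
  fixes \<delta> :: "'p \<Rightarrow> (('l \<times> 'p) \<Rightarrow>\<^sub>0 int) set"
  assumes \<delta>_hom: "\<delta> \<in> hom (add_monoid P) D"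
    and \<delta>_takeuchi: "\<And>p. p \<in> carrier P \<Longrightarrow> \<delta> p \<in> takeuchi H (ring_bimodule P \<eta>)"
    and \<delta>_left: "\<And>b p. b \<in> carrier B \<Longrightarrow> p \<in> carrier P \<Longrightarrow> \<delta> (\<eta> b \<otimes>\<^bsub>P\<^esub> p) = lmul_src b (\<delta> p)"
    and \<delta>_right: "\<And>b p. b \<in> carrier B \<Longrightarrow> p \<in> carrier P \<Longrightarrow> \<delta> (p \<otimes>\<^bsub>P\<^esub> \<eta> b) = rmul_total (s b) (\<delta> p)"
begin

lemma \<delta>_simps [simp]:
  "p \<in> carrier P \<Longrightarrow> \<delta> p \<in> carrier D"
  "p \<in> carrier P \<Longrightarrow> q \<in> carrier P \<Longrightarrow> \<delta> (p \<oplus>\<^bsub>P\<^esub> q) = \<delta> p \<otimes>\<^bsub>D\<^esub> \<delta> q"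
  using \<delta>_hom by (auto simp: hom_def)

abbreviation "\<phi> \<equiv> skew_map H (ring_bimodule P \<eta>) \<delta>"

lemma \<phi>_eq: "\<phi> U = tsum D U (\<lambda>(x, p). rmul_total x (\<delta> p))"
  by (simp add: skew_map_def rmul_total_def)

lemma \<phi>_bilinear: "bilinear L P bten_balance D (\<lambda>x p. rmul_total x (\<delta> p))"
  by (rule E_bilinearI) (simp_all add: D.comm_group_axioms rmul_total_add \<delta>_right rmul_total_mult)

lemmas \<phi>_simps [simp] =
  E.tsum_closed[OF \<phi>_bilinear, folded \<phi>_eq] E.tsum_mult[OF \<phi>_bilinear, folded \<phi>_eq]
  E.tsum_pure[OF \<phi>_bilinear, folded \<phi>_eq]

lemma \<phi>_hom: "\<phi> \<in> hom E D"
  by (rule homI) simp_all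

end

section \<open>A bialgebroid coacts on itself\<close>

sublocale bialg \<subseteq> self: bialg_ring H L s
  by unfold_locales (use H in \<open>simp_all add: left_bialgebroid_def\<close>)

context bialg
begin

lemma self_eq: "self H = ring_bimodule L s"
  by (simp add: self_def)

lemma cop_bimodule:
  assumes "b \<in> carrier B" "c \<in> carrier B" "x \<in> carrier L"
  shows "cop H (s b \<otimes>\<^bsub>L\<^esub> t c \<otimes>\<^bsub>L\<^esub> x) =
    tsum self.D (cop H x) (\<lambda>(x1, x2). pure self.D (s b \<otimes>\<^bsub>L\<^esub> x1, t c \<otimes>\<^bsub>L\<^esub> x2))"
proof -
  have "\<forall>b\<in>carrier B. \<forall>c\<in>carrier B. \<forall>x\<in>carrier L. cop H (s b \<otimes>\<^bsub>L\<^esub> t c \<otimes>\<^bsub>L\<^esub> x) =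
      tsum (dia H (self H)) (cop H x) (\<lambda>(x1, x2).
        pure (dia H (self H)) (s b \<otimes>\<^bsub>L\<^esub> x1, t c \<otimes>\<^bsub>L\<^esub> x2))"
    using H unfolding left_bialgebroid_def by (elim conjE) assumption
  then show ?thesis unfolding self_eq using assms by blast
qed

lemma cop_one: "cop H \<one>\<^bsub>L\<^esub> = pure self.D (\<one>\<^bsub>L\<^esub>, \<one>\<^bsub>L\<^esub>)"
  using H by (simp add: left_bialgebroid_def self_eq)

lemma cop_hom: "cop H \<in> hom (add_monoid L) self.D"
  using H by (simp add: left_bialgebroid_def self_eq)

lemma cop_closed: "x \<in> carrier L \<Longrightarrow> cop H x \<in> carrier self.D"
  using cop_hom by (auto simp: hom_def)

lemma cop_takeuchi: "x \<in> carrier L \<Longrightarrow> cop H x \<in> takeuchi H (ring_bimodule L s)"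
  using H by (simp add: left_bialgebroid_def self_eq)

text \<open>The right \<open>B\<close>-module structures on \<open>\<L> \<diamondop>\<^sub>B \<L>\<close> and \<open>\<L> \<otimes>\<^sup>B \<L>\<close> over which these groups are tensored
  with \<open>P\<close>.\<close>

definition tgt_dia :: "'b \<Rightarrow> (('l \<times> 'l) \<Rightarrow>\<^sub>0 int) set \<Rightarrow> (('l \<times> 'l) \<Rightarrow>\<^sub>0 int) set" where
  "tgt_dia b U = tsum self.D U (\<lambda>(x, y). pure self.D (x, t b \<otimes>\<^bsub>L\<^esub> y))"

definition tgt_bten :: "'b \<Rightarrow> (('l \<times> 'l) \<Rightarrow>\<^sub>0 int) set \<Rightarrow> (('l \<times> 'l) \<Rightarrow>\<^sub>0 int) set" where
  "tgt_bten b U = tsum self.E U (\<lambda>(x, y). pure self.E (x, t b \<otimes>\<^bsub>L\<^esub> y))"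

lemma tgt_dia_bilinear:
  "b \<in> carrier B \<Longrightarrow> bilinear L L self.dia_balance self.D (\<lambda>x y. pure self.D (x, t b \<otimes>\<^bsub>L\<^esub> y))"
  by (rule self.D_bilinearI) (simp_all add: self.D.comm_group_axioms self.D.pure_add_left
      self.D.pure_add_right L.r_distr s_t_left_commute self.D_balance)

lemma tgt_bten_bilinear:
  "b \<in> carrier B \<Longrightarrow> bilinear L L self.bten_balance self.E (\<lambda>x y. pure self.E (x, t b \<otimes>\<^bsub>L\<^esub> y))"
  by (rule self.E_bilinearI) (simp_all add: self.E.comm_group_axioms self.E.pure_add_left
      self.E.pure_add_right L.r_distr self.E_balance L.m_assoc)

lemmas tgt_dia_simps [simp] =
  self.D.tsum_closed[OF tgt_dia_bilinear, folded tgt_dia_def] self.D.tsum_mult[OF tgt_dia_bilinear, folded tgt_dia_def]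
  self.D.tsum_pure[OF tgt_dia_bilinear, folded tgt_dia_def]

lemmas tgt_bten_simps [simp] =
  self.E.tsum_closed[OF tgt_bten_bilinear, folded tgt_bten_def] self.E.tsum_mult[OF tgt_bten_bilinear, folded tgt_bten_def]
  self.E.tsum_pure[OF tgt_bten_bilinear, folded tgt_bten_def]

lemma cop_lmul_src_tgt_dia:
  assumes b: "b \<in> carrier B" "c \<in> carrier B" and U: "U \<in> carrier self.D"
  shows "tsum self.D U (\<lambda>(x1, x2). pure self.D (s b \<otimes>\<^bsub>L\<^esub> x1, t c \<otimes>\<^bsub>L\<^esub> x2)) = tgt_dia c (self.lmul_src b U)"
proof -
  have h: "bilinear L L self.dia_balance self.D (\<lambda>x1 x2. pure self.D (s b \<otimes>\<^bsub>L\<^esub> x1, t c \<otimes>\<^bsub>L\<^esub> x2))"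
    by (rule self.D_bilinearI) (simp_all add: b self.D.comm_group_axioms self.D.pure_add_left
      self.D.pure_add_right L.r_distr s_t_left_commute self.D_balance)
  from U show ?thesis
    by (induct rule: self.D.induct) (simp_all add: b self.D.tsum_mult[OF h] self.D.tsum_pure[OF h])
qed

lemma tgt_dia_one [simp]: "U \<in> carrier self.D \<Longrightarrow> tgt_dia \<one>\<^bsub>B\<^esub> U = U"
  by (induct rule: self.D.induct) simp_all

lemma tgt_bten_one: "U \<in> carrier self.E \<Longrightarrow> tgt_bten \<one>\<^bsub>B\<^esub> U = U"
  by (induct rule: self.E.induct) simp_all

lemma cop_src_left:
  "b \<in> carrier B \<Longrightarrow> x \<in> carrier L \<Longrightarrow> cop H (s b \<otimes>\<^bsub>L\<^esub> x) = self.lmul_src b (cop H x)"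
  using cop_bimodule[of b "\<one>\<^bsub>B\<^esub>" x] cop_lmul_src_tgt_dia[of b "\<one>\<^bsub>B\<^esub>" "cop H x"] cop_closed by simp

lemma cop_tgt_left:
  "c \<in> carrier B \<Longrightarrow> x \<in> carrier L \<Longrightarrow> cop H (t c \<otimes>\<^bsub>L\<^esub> x) = tgt_dia c (cop H x)"
  using cop_bimodule[of "\<one>\<^bsub>B\<^esub>" c x] cop_lmul_src_tgt_dia[of "\<one>\<^bsub>B\<^esub>" c "cop H x"] cop_closed by simp

lemma cop_src_right:
  assumes "b \<in> carrier B" "x \<in> carrier L"
  shows "cop H (x \<otimes>\<^bsub>L\<^esub> s b) = self.rmul_total (s b) (cop H x)"
proof -
  have "cop H (s b) = pure self.D (s b, \<one>\<^bsub>L\<^esub>)"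
    using cop_src_left[of b "\<one>\<^bsub>L\<^esub>"] assms by (simp add: cop_one)
  moreover have "cop H (x \<otimes>\<^bsub>L\<^esub> s b) = takeuchi_mult H L s (cop H x) (cop H (s b))"
    using H assms by (simp add: left_bialgebroid_def)
  ultimately show ?thesis
    using assms by (simp add: self.takeuchi_mult_pure[OF cop_takeuchi] cop_closed)
qed

end

sublocale bialg \<subseteq> self: coacted_ring H L s "cop H"
  by unfold_locales (simp_all add: cop_hom cop_takeuchi cop_src_left cop_src_right)

context bialg
begin

lemma hopf_map_eq: "hopf_map H = self.\<phi>"
  by (simp add: fun_eq_iff hopf_map_def skew_map_def self_eq)

lemma tgt_dia_rmul_total:
  "U \<in> carrier self.D \<Longrightarrow> b \<in> carrier B \<Longrightarrow> x \<in> carrier L \<Longrightarrow> self.rmul_total x (tgt_dia b U) = tgt_dia b (self.rmul_total x U)"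
  by (induct rule: self.D.induct) simp_all

text \<open>The Hopf map is right \<open>B\<close>-linear, so that it may be tensored with \<open>P\<close>.\<close>

lemma \<phi>_tgt_bten: "U \<in> carrier self.E \<Longrightarrow> b \<in> carrier B \<Longrightarrow>
    self.\<phi> (tgt_bten b U) = tgt_dia b (self.\<phi> U)"
  by (induct rule: self.E.induct) (simp_all add: cop_tgt_left tgt_dia_rmul_total)

end

section \<open>The Galois map\<close>

locale galois_extension = coacted_ring H P \<eta> \<delta>
  for H :: "('k, 'b, 'l) bialgebroid" and P :: "('k, 'p) module" and \<eta> :: "'b \<Rightarrow> 'p"
    and \<delta> :: "'p \<Rightarrow> (('l \<times> 'p) \<Rightarrow>\<^sub>0 int) set" +
  assumes galois: "left_galois H P \<eta> \<delta>"
    and skew: "skew_regular H (ring_bimodule P \<eta>) \<delta>"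
begin

lemma comodule_algebra: "left_comodule_algebra H P \<eta> \<delta>"
  using galois by (simp add: left_galois_def)

lemma \<delta>_mult:
  "p \<in> carrier P \<Longrightarrow> q \<in> carrier P \<Longrightarrow> \<delta> (p \<otimes>\<^bsub>P\<^esub> q) = takeuchi_mult H P \<eta> (\<delta> p) (\<delta> q)"
  using comodule_algebra by (simp add: left_comodule_algebra_def)

lemma \<delta>_one: "\<delta> \<one>\<^bsub>P\<^esub> = pure D (\<one>\<^bsub>L\<^esub>, \<one>\<^bsub>P\<^esub>)"
  using comodule_algebra by (simp add: left_comodule_algebra_def)

lemma cou_simps [simp]:
  "x \<in> carrier L \<Longrightarrow> cou H x \<in> carrier B"
  "x \<in> carrier L \<Longrightarrow> y \<in> carrier L \<Longrightarrow> cou H (x \<oplus>\<^bsub>L\<^esub> y) = cou H x \<oplus>\<^bsub>B\<^esub> cou H y"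
  "cou H \<one>\<^bsub>L\<^esub> = \<one>\<^bsub>B\<^esub>"
proof -
  have h: "cou H \<in> hom (add_monoid L) (add_monoid B)"
    using H unfolding left_bialgebroid_def by (elim conjE) assumption
  show "x \<in> carrier L \<Longrightarrow> cou H x \<in> carrier B"
    "x \<in> carrier L \<Longrightarrow> y \<in> carrier L \<Longrightarrow> cou H (x \<oplus>\<^bsub>L\<^esub> y) = cou H x \<oplus>\<^bsub>B\<^esub> cou H y"
    using hom_in_carrier[OF h] hom_mult[OF h] by simp_all
  show "cou H \<one>\<^bsub>L\<^esub> = \<one>\<^bsub>B\<^esub>"
    using H unfolding left_bialgebroid_def by (elim conjE) assumption
qed

lemma cou_tgt:
  assumes "c \<in> carrier B" "x \<in> carrier L"
  shows "cou H (t c \<otimes>\<^bsub>L\<^esub> x) = cou H x \<otimes>\<^bsub>B\<^esub> c"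
proof -
  have "\<forall>b\<in>carrier B. \<forall>c\<in>carrier B. \<forall>x\<in>carrier L.
      cou H (s b \<otimes>\<^bsub>L\<^esub> t c \<otimes>\<^bsub>L\<^esub> x) = b \<otimes>\<^bsub>B\<^esub> cou H x \<otimes>\<^bsub>B\<^esub> c"
    using H unfolding left_bialgebroid_def by (elim conjE) assumption
  from bspec[OF this B.one_closed] show ?thesis using assms by simp
qed

lemma \<eta>_ring_hom [simp]:
  "b \<in> carrier B \<Longrightarrow> c \<in> carrier B \<Longrightarrow> \<eta> (b \<oplus>\<^bsub>B\<^esub> c) = \<eta> b \<oplus>\<^bsub>P\<^esub> \<eta> c"
  "b \<in> carrier B \<Longrightarrow> c \<in> carrier B \<Longrightarrow> \<eta> (b \<otimes>\<^bsub>B\<^esub> c) = \<eta> b \<otimes>\<^bsub>P\<^esub> \<eta> c"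
proof -
  have h: "\<eta> \<in> ring_hom B P" using \<eta>_hom by (simp add: k_alg_hom_def)
  show "b \<in> carrier B \<Longrightarrow> c \<in> carrier B \<Longrightarrow> \<eta> (b \<oplus>\<^bsub>B\<^esub> c) = \<eta> b \<oplus>\<^bsub>P\<^esub> \<eta> c"
    "b \<in> carrier B \<Longrightarrow> c \<in> carrier B \<Longrightarrow> \<eta> (b \<otimes>\<^bsub>B\<^esub> c) = \<eta> b \<otimes>\<^bsub>P\<^esub> \<eta> c"
    by (rule ring_hom_add[OF h] ring_hom_mult[OF h]; assumption)+
qed

text \<open>The counit gives the retraction \<open>x \<otimes> p \<mapsto> \<epsilon>(x) p\<close> of \<open>p \<mapsto> 1 \<otimes> p\<close>.\<close>

lemma pure_one_inject:
  assumes "p \<in> carrier P" "q \<in> carrier P" "pure D (\<one>\<^bsub>L\<^esub>, p) = pure D (\<one>\<^bsub>L\<^esub>, q)"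
  shows "p = q"
proof -
  have h: "bilinear L P dia_balance (add_monoid P) (\<lambda>x p. \<eta> (cou H x) \<otimes>\<^bsub>P\<^esub> p)"
  proof (rule D_bilinearI, goal_cases)
    case 1 show ?case by (rule P.a_comm_group)
  next
    case (2 x p) then show ?case by simp
  next
    case (3 x x' p) then show ?case by (simp add: P.l_distr)
  next
    case (4 x p p') then show ?case by (simp add: P.r_distr)
  next
    case (5 b x p) then show ?case by (simp add: cou_tgt P.m_assoc)
  qed
  have "tsum (add_monoid P) (pure D (\<one>\<^bsub>L\<^esub>, r)) (\<lambda>(x, p). \<eta> (cou H x) \<otimes>\<^bsub>P\<^esub> p) = r"
    if "r \<in> carrier P" for r
    unfolding D.tsum_pure[OF h L.one_closed that] using that by simp
  from this[OF assms(1)] this[OF assms(2)] show ?thesis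
    unfolding assms(3) by (rule trans[OF sym])
qed

abbreviation "N \<equiv> coinvariants H P \<eta> \<delta>"

lemma N_simps [simp]: "n \<in> N \<Longrightarrow> n \<in> carrier P" "n \<in> N \<Longrightarrow> \<delta> n = pure D (\<one>\<^bsub>L\<^esub>, n)"
  by (simp_all add: coinvariants_def)

text \<open>As \<open>1 \<otimes> n\<close> lies in \<open>\<L> \<times>\<^sub>B P\<close>, both \<open>1 \<otimes> n b\<close> and \<open>1 \<otimes> b n\<close> equal \<open>t(b) \<otimes> n\<close>. This is why
  right multiplication by \<open>n\<close> is defined on \<open>\<L> \<otimes>\<^sup>B P\<close>.\<close>

lemma N_commute:
  assumes n: "n \<in> N" and b: "b \<in> carrier B"
  shows "n \<otimes>\<^bsub>P\<^esub> \<eta> b = \<eta> b \<otimes>\<^bsub>P\<^esub> n"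
proof (rule pure_one_inject)
  have "rmul_total (t b) (\<delta> n) = rmul_ring (\<eta> b) (\<delta> n)"
    by (rule takeuchi_rmul_total_rmul_ring[OF \<delta>_takeuchi b]) (simp add: n)
  then have "pure D (t b, n) = pure D (\<one>\<^bsub>L\<^esub>, n \<otimes>\<^bsub>P\<^esub> \<eta> b)"
    using n b by simp
  moreover have "pure D (t b, n) = pure D (\<one>\<^bsub>L\<^esub>, \<eta> b \<otimes>\<^bsub>P\<^esub> n)"
    using D_balance[OF b, of "\<one>\<^bsub>L\<^esub>" n] n b by simp
  ultimately show "pure D (\<one>\<^bsub>L\<^esub>, n \<otimes>\<^bsub>P\<^esub> \<eta> b) = pure D (\<one>\<^bsub>L\<^esub>, \<eta> b \<otimes>\<^bsub>P\<^esub> n)" by simp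
qed (use n b in simp_all)

lemma \<delta>_coinvariant: "n \<in> N \<Longrightarrow> p \<in> carrier P \<Longrightarrow> \<delta> (p \<otimes>\<^bsub>P\<^esub> n) = rmul_ring n (\<delta> p)"
  by (simp add: \<delta>_mult takeuchi_mult_pure[OF \<delta>_takeuchi])

text \<open>The image of the ground field is coinvariant because source and target agree on it.\<close>

lemma ground_coinvariant:
  assumes c: "c \<in> carrier (ground H)" shows "\<eta> (c \<odot>\<^bsub>B\<^esub> \<one>\<^bsub>B\<^esub>) \<in> N"
proof -
  let ?b = "c \<odot>\<^bsub>B\<^esub> \<one>\<^bsub>B\<^esub>"
  have b: "?b \<in> carrier B" by (rule ground_in_base[OF c])
  have s: "s ?b = t ?b"
    using smult_L[OF c L.one_closed] b by simp
  have "\<delta> (\<eta> ?b) = lmul_src ?b (pure D (\<one>\<^bsub>L\<^esub>, \<one>\<^bsub>P\<^esub>))"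
    using \<delta>_left[OF b P.one_closed] by (simp only: P.r_one \<eta>_simps(1)[OF b] \<delta>_one)
  then have "\<delta> (\<eta> ?b) = pure D (t ?b \<otimes>\<^bsub>L\<^esub> \<one>\<^bsub>L\<^esub>, \<one>\<^bsub>P\<^esub>)"
    by (simp only: lmul_src_simps(3)[OF b L.one_closed P.one_closed] s)
  then have "\<delta> (\<eta> ?b) = pure D (\<one>\<^bsub>L\<^esub>, \<eta> ?b)"
    by (simp only: D_balance[OF b L.one_closed P.one_closed] P.r_one \<eta>_simps(1)[OF b])
  then show ?thesis using \<eta>_simps(1)[OF b] unfolding coinvariants_def by blast
qed

abbreviation "S \<equiv> sub_tensor (ground H) P N"

definition sub_balance :: "(('p \<times> 'p) \<times> ('p \<times> 'p)) set" where
  "sub_balance = {((p \<otimes>\<^bsub>P\<^esub> n, q), (p, n \<otimes>\<^bsub>P\<^esub> q)) | p n q. p \<in> carrier P \<and> n \<in> N \<and> q \<in> carrier P}"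

lemma S_eq: "S = tensor2 P P sub_balance"
proof -
  have "bal2 (ground H) P P \<subseteq> sub_balance"
  proof
    fix z assume "z \<in> bal2 (ground H) P P"
    then obtain c x p where z: "z = ((c \<odot>\<^bsub>P\<^esub> x, p), (x, c \<odot>\<^bsub>P\<^esub> p))"
      and cxp: "c \<in> carrier (ground H)" "x \<in> carrier P" "p \<in> carrier P"
      by (auto simp: bal2_def)
    show "z \<in> sub_balance"
      unfolding sub_balance_def z smult_P(2)[OF cxp(1,2)] smult_P(1)[OF cxp(1,3)]
      using cxp ground_coinvariant[OF cxp(1)] by blast
  qed
  then have "bal2 (ground H) P P \<union> sub_balance = sub_balance" by blast
  then show ?thesis
    unfolding sub_tensor_def sub_balance_def by simp
qed

sublocale S: tensor_product P P sub_balance S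
  by (rule tensor_product.intro) (auto simp: S_eq sub_balance_def P.abelian_group_axioms)

lemma S_balance:
  "p \<in> carrier P \<Longrightarrow> n \<in> N \<Longrightarrow> q \<in> carrier P \<Longrightarrow> pure S (p \<otimes>\<^bsub>P\<^esub> n, q) = pure S (p, n \<otimes>\<^bsub>P\<^esub> q)"
  by (rule S.pure_cong) (auto simp: sub_balance_def)

lemma S_bilinearI:
  assumes "comm_group G"
    and "\<And>p q. p \<in> carrier P \<Longrightarrow> q \<in> carrier P \<Longrightarrow> h p q \<in> carrier G"
    and "\<And>p p' q. p \<in> carrier P \<Longrightarrow> p' \<in> carrier P \<Longrightarrow> q \<in> carrier P \<Longrightarrow>
      h (p \<oplus>\<^bsub>P\<^esub> p') q = h p q \<otimes>\<^bsub>G\<^esub> h p' q"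
    and "\<And>p q q'. p \<in> carrier P \<Longrightarrow> q \<in> carrier P \<Longrightarrow> q' \<in> carrier P \<Longrightarrow>
      h p (q \<oplus>\<^bsub>P\<^esub> q') = h p q \<otimes>\<^bsub>G\<^esub> h p q'"
    and "\<And>p n q. p \<in> carrier P \<Longrightarrow> n \<in> N \<Longrightarrow> q \<in> carrier P \<Longrightarrow>
      h (p \<otimes>\<^bsub>P\<^esub> n) q = h p (n \<otimes>\<^bsub>P\<^esub> q)"
  shows "bilinear P P sub_balance G h"
  using assms unfolding bilinear_def sub_balance_def by auto

abbreviation "can \<equiv> left_can H P \<eta> \<delta>"

lemma can_eq: "can U = tsum D U (\<lambda>(p, q). rmul_ring q (\<delta> p))"
  by (simp add: left_can_def rmul_ring_def)

lemma can_bilinear: "bilinear P P sub_balance D (\<lambda>p q. rmul_ring q (\<delta> p))"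
  by (rule S_bilinearI) (simp_all add: D.comm_group_axioms rmul_ring_add \<delta>_coinvariant rmul_ring_mult)

lemmas can_simps [simp] =
  S.tsum_closed[OF can_bilinear, folded can_eq] S.tsum_mult[OF can_bilinear, folded can_eq]
  S.tsum_pure[OF can_bilinear, folded can_eq]

lemma can_hom: "can \<in> hom S D"
  by (rule homI) simp_all

lemma can_bij: "bij_betw can (carrier S) (carrier D)"
  using galois by (simp add: left_galois_def)

lemma \<phi>_bij: "bij_betw \<phi> (carrier E) (carrier D)"
  using skew by (simp add: skew_regular_def)

abbreviation "can_inv \<equiv> inv_into (carrier S) can"
abbreviation "\<phi>_inv \<equiv> inv_into (carrier E) \<phi>"

lemma can_inv_hom: "can_inv \<in> hom D S"
  using S.iso_set_sym[of can D] can_hom can_bij by (simp add: iso_def)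

lemma \<phi>_inv_hom: "\<phi>_inv \<in> hom D E"
  using E.iso_set_sym[of \<phi> D] \<phi>_hom \<phi>_bij by (simp add: iso_def)

lemma can_inv_simps [simp]:
  "U \<in> carrier D \<Longrightarrow> can_inv U \<in> carrier S"
  "U \<in> carrier D \<Longrightarrow> V \<in> carrier D \<Longrightarrow> can_inv (U \<otimes>\<^bsub>D\<^esub> V) = can_inv U \<otimes>\<^bsub>S\<^esub> can_inv V"
  "U \<in> carrier D \<Longrightarrow> can (can_inv U) = U"
  "W \<in> carrier S \<Longrightarrow> can_inv (can W) = W"
  using can_inv_hom can_bij by (simp_all add: hom_in_carrier hom_mult bij_betw_def f_inv_into_f)

lemma \<phi>_inv_simps [simp]:
  "U \<in> carrier D \<Longrightarrow> \<phi>_inv U \<in> carrier E"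
  "U \<in> carrier D \<Longrightarrow> V \<in> carrier D \<Longrightarrow> \<phi>_inv (U \<otimes>\<^bsub>D\<^esub> V) = \<phi>_inv U \<otimes>\<^bsub>E\<^esub> \<phi>_inv V"
  "U \<in> carrier D \<Longrightarrow> \<phi> (\<phi>_inv U) = U"
  "W \<in> carrier E \<Longrightarrow> \<phi>_inv (\<phi> W) = W"
  using \<phi>_inv_hom \<phi>_bij by (simp_all add: hom_in_carrier hom_mult bij_betw_def f_inv_into_f)

definition lmul_sub :: "'b \<Rightarrow> (('p \<times> 'p) \<Rightarrow>\<^sub>0 int) set \<Rightarrow> (('p \<times> 'p) \<Rightarrow>\<^sub>0 int) set" where
  "lmul_sub b V = tsum S V (\<lambda>(p, q). pure S (\<eta> b \<otimes>\<^bsub>P\<^esub> p, q))"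

lemma lmul_sub_bilinear:
  "b \<in> carrier B \<Longrightarrow> bilinear P P sub_balance S (\<lambda>p q. pure S (\<eta> b \<otimes>\<^bsub>P\<^esub> p, q))"
  by (rule S_bilinearI) (simp_all add: S.comm_group_axioms S.pure_add_left S.pure_add_right
      P.r_distr S_balance P.m_assoc[symmetric])

lemmas lmul_sub_simps [simp] =
  S.tsum_closed[OF lmul_sub_bilinear, folded lmul_sub_def] S.tsum_mult[OF lmul_sub_bilinear, folded lmul_sub_def]
  S.tsum_pure[OF lmul_sub_bilinear, folded lmul_sub_def]

text \<open>Linearity of \<open>can\<close> over \<open>B\<close>, hence of its inverse, balances the inverse of \<open>\<mu> \<otimes> P\<close> over the
  middle leg of \<open>\<L> \<diamondop>\<^sub>B \<L> \<diamondop>\<^sub>B P\<close>.\<close>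

lemma can_lmul_sub: "V \<in> carrier S \<Longrightarrow> b \<in> carrier B \<Longrightarrow> can (lmul_sub b V) = lmul_src b (can V)"
  by (induct rule: S.induct) (simp_all add: \<delta>_left lmul_src_rmul_ring)

lemma can_inv_lmul_src: "U \<in> carrier D \<Longrightarrow> b \<in> carrier B \<Longrightarrow>
    can_inv (lmul_src b U) = lmul_sub b (can_inv U)"
proof -
  assume "U \<in> carrier D" "b \<in> carrier B"
  then show ?thesis using can_lmul_sub[of "can_inv U" b] can_inv_simps(4)[of "lmul_sub b (can_inv U)"] by simp
qed

definition rmul_bten :: "'p \<Rightarrow> (('l \<times> 'p) \<Rightarrow>\<^sub>0 int) set \<Rightarrow> (('l \<times> 'p) \<Rightarrow>\<^sub>0 int) set" where
  "rmul_bten n W = tsum E W (\<lambda>(z, r). pure E (z, r \<otimes>\<^bsub>P\<^esub> n))"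

lemma rmul_bten_bilinear:
  "n \<in> N \<Longrightarrow> bilinear L P bten_balance E (\<lambda>z r. pure E (z, r \<otimes>\<^bsub>P\<^esub> n))"
  by (rule E_bilinearI) (simp_all add: E.comm_group_axioms E.pure_add_left E.pure_add_right
      P.l_distr E_balance P.m_assoc N_commute)

lemmas rmul_bten_simps [simp] =
  E.tsum_closed[OF rmul_bten_bilinear, folded rmul_bten_def] E.tsum_mult[OF rmul_bten_bilinear, folded rmul_bten_def]
  E.tsum_pure[OF rmul_bten_bilinear, folded rmul_bten_def]

text \<open>Linearity of \<open>\<phi>\<close> over \<open>N\<close>, hence of its inverse, allows \<open>\<phi>\<inverse>\<close> to be applied inside
  \<open>P \<otimes>\<^sub>N P\<close>.\<close>

lemma \<phi>_rmul_bten: "W \<in> carrier E \<Longrightarrow> n \<in> N \<Longrightarrow> \<phi> (rmul_bten n W) = rmul_ring n (\<phi> W)"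
  by (induct rule: E.induct) (simp_all add: \<delta>_coinvariant rmul_total_rmul_ring)

lemma \<phi>_inv_rmul_ring: "U \<in> carrier D \<Longrightarrow> n \<in> N \<Longrightarrow> \<phi>_inv (rmul_ring n U) = rmul_bten n (\<phi>_inv U)"
proof -
  assume "U \<in> carrier D" "n \<in> N"
  then show ?thesis using \<phi>_rmul_bten[of "\<phi>_inv U" n] \<phi>_inv_simps(4)[of "rmul_bten n (\<phi>_inv U)"] by simp
qed

end

section \<open>Inverting the Hopf map after tensoring with the extension\<close>

lemma with_action_simps [simp]:
  "carrier (with_action M act) = carrier M" "add (with_action M act) = add M"
  "ring.zero (with_action M act) = ring.zero M" "smult (with_action M act) = act"
  by (simp_all add: with_action_def)

context bialg_ring
begin

lemma left_mod_base: "left_mod B (with_action (ring_bimodule P \<eta>) (lact (ring_bimodule P \<eta>)))"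
proof -
  have h: "\<eta> \<in> ring_hom B P" using \<eta>_hom by (simp add: k_alg_hom_def)
  have "abelian_group (with_action (ring_bimodule P \<eta>) (lact (ring_bimodule P \<eta>)))"
    by (rule abelian_group_cong[OF P.abelian_group_axioms]) simp_all
  then show ?thesis
    by (simp add: left_mod_def B.ring_axioms ring_hom_add[OF h]
        ring_hom_mult[OF h] P.l_distr P.r_distr P.m_assoc)
qed

end

context bialg
begin

lemma tgt_bten_add: "U \<in> carrier self.E \<Longrightarrow> b \<in> carrier B \<Longrightarrow> c \<in> carrier B \<Longrightarrow>
    tgt_bten (b \<oplus>\<^bsub>B\<^esub> c) U = tgt_bten b U \<otimes>\<^bsub>self.E\<^esub> tgt_bten c U"
  by (induct rule: self.E.induct) (simp_all add: L.l_distr self.E.pure_add_right self.E.m_ac)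

lemma tgt_bten_mult: "U \<in> carrier self.E \<Longrightarrow> b \<in> carrier B \<Longrightarrow> c \<in> carrier B \<Longrightarrow>
    tgt_bten (b \<otimes>\<^bsub>B\<^esub> c) U = tgt_bten c (tgt_bten b U)"
  by (induct rule: self.E.induct) (simp_all add: L.m_assoc)

lemma tgt_dia_add: "U \<in> carrier self.D \<Longrightarrow> b \<in> carrier B \<Longrightarrow> c \<in> carrier B \<Longrightarrow>
    tgt_dia (b \<oplus>\<^bsub>B\<^esub> c) U = tgt_dia b U \<otimes>\<^bsub>self.D\<^esub> tgt_dia c U"
  by (induct rule: self.D.induct) (simp_all add: L.l_distr self.D.pure_add_right self.D.m_ac)

lemma tgt_dia_mult: "U \<in> carrier self.D \<Longrightarrow> b \<in> carrier B \<Longrightarrow> c \<in> carrier B \<Longrightarrow>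
    tgt_dia (b \<otimes>\<^bsub>B\<^esub> c) U = tgt_dia c (tgt_dia b U)"
  by (induct rule: self.D.induct) (simp_all add: L.m_assoc)

end

text \<open>The parameter \<open>e\<close> moves \<open>\<L> \<otimes>\<^sup>B \<L>\<close> and \<open>\<L> \<diamondop>\<^sub>B \<L>\<close> into the universe of test modules. The groups
  \<open>T1\<close> and \<open>T2\<close> below are \<open>(\<L> \<otimes>\<^sup>B \<L>) \<otimes>\<^sub>B P\<close> and \<open>(\<L> \<diamondop>\<^sub>B \<L>) \<otimes>\<^sub>B P\<close>.\<close>

locale embedded_galois_extension = galois_extension H P \<eta> \<delta>
  for H :: "('k, 'b, 'l) bialgebroid" and P :: "('k, 'p) module" and \<eta> :: "'b \<Rightarrow> 'p"
    and \<delta> :: "'p \<Rightarrow> (('l \<times> 'p) \<Rightarrow>\<^sub>0 int) set" +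
  fixes e :: "(('l \<times> 'l) \<Rightarrow>\<^sub>0 int) set \<Rightarrow> 'u"
  assumes inj_e: "inj e"
begin

abbreviation "PM \<equiv> with_action (ring_bimodule P \<eta>) (lact (ring_bimodule P \<eta>))"

sublocale X: scalar_extension B self.E tgt_bten e PM
  by unfold_locales (simp_all add: inj_e left_mod_base self.E.comm_group_axioms tgt_bten_add tgt_bten_mult tgt_bten_one
      del: with_action_simps ring_bimodule_simps)

sublocale Y: scalar_extension B self.D tgt_dia e PM
  by unfold_locales (simp_all add: inj_e left_mod_base self.D.comm_group_axioms tgt_dia_add tgt_dia_mult
      del: with_action_simps ring_bimodule_simps)

abbreviation "T1 \<equiv> X.XM"
abbreviation "T2 \<equiv> Y.XM"

lemma X_elt_simps [simp]:
  "U \<in> carrier self.E \<Longrightarrow> p \<in> carrier P \<Longrightarrow> X.elt U p \<in> carrier T1"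
  "U \<in> carrier self.E \<Longrightarrow> V \<in> carrier self.E \<Longrightarrow> p \<in> carrier P \<Longrightarrow>
     X.elt (U \<otimes>\<^bsub>self.E\<^esub> V) p = X.elt U p \<otimes>\<^bsub>T1\<^esub> X.elt V p"
  "U \<in> carrier self.E \<Longrightarrow> p \<in> carrier P \<Longrightarrow> q \<in> carrier P \<Longrightarrow>
     X.elt U (p \<oplus>\<^bsub>P\<^esub> q) = X.elt U p \<otimes>\<^bsub>T1\<^esub> X.elt U q"
  using X.elt_closed[of U p] X.elt_mult[of U V p] X.elt_add[of U p q] by simp_all

lemma Y_elt_simps [simp]:
  "U \<in> carrier self.D \<Longrightarrow> p \<in> carrier P \<Longrightarrow> Y.elt U p \<in> carrier T2"
  "U \<in> carrier self.D \<Longrightarrow> V \<in> carrier self.D \<Longrightarrow> p \<in> carrier P \<Longrightarrow>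
     Y.elt (U \<otimes>\<^bsub>self.D\<^esub> V) p = Y.elt U p \<otimes>\<^bsub>T2\<^esub> Y.elt V p"
  "U \<in> carrier self.D \<Longrightarrow> p \<in> carrier P \<Longrightarrow> q \<in> carrier P \<Longrightarrow>
     Y.elt U (p \<oplus>\<^bsub>P\<^esub> q) = Y.elt U p \<otimes>\<^bsub>T2\<^esub> Y.elt U q"
  using Y.elt_closed[of U p] Y.elt_mult[of U V p] Y.elt_add[of U p q] by simp_all

lemma X_elt_act:
  "b \<in> carrier B \<Longrightarrow> U \<in> carrier self.E \<Longrightarrow> p \<in> carrier P \<Longrightarrow> X.elt (tgt_bten b U) p = X.elt U (\<eta> b \<otimes>\<^bsub>P\<^esub> p)"
  using X.elt_act[of b U p] by simp

lemma Y_elt_act: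
  "b \<in> carrier B \<Longrightarrow> U \<in> carrier self.D \<Longrightarrow> p \<in> carrier P \<Longrightarrow> Y.elt (tgt_dia b U) p = Y.elt U (\<eta> b \<otimes>\<^bsub>P\<^esub> p)"
  using Y.elt_act[of b U p] by simp

lemma X_elt_tgt:
  "b \<in> carrier B \<Longrightarrow> z \<in> carrier L \<Longrightarrow> y \<in> carrier L \<Longrightarrow> p \<in> carrier P \<Longrightarrow>
     X.elt (pure self.E (z, t b \<otimes>\<^bsub>L\<^esub> y)) p = X.elt (pure self.E (z, y)) (\<eta> b \<otimes>\<^bsub>P\<^esub> p)"
  using X_elt_act[of b "pure self.E (z, y)" p] by simp

lemma Y_elt_tgt:
  "b \<in> carrier B \<Longrightarrow> z \<in> carrier L \<Longrightarrow> y \<in> carrier L \<Longrightarrow> p \<in> carrier P \<Longrightarrow>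
     Y.elt (pure self.D (z, t b \<otimes>\<^bsub>L\<^esub> y)) p = Y.elt (pure self.D (z, y)) (\<eta> b \<otimes>\<^bsub>P\<^esub> p)"
  using Y_elt_act[of b "pure self.D (z, y)" p] by simp

text \<open>For fixed \<open>z\<close>, the maps \<open>y \<otimes> u \<mapsto> z \<otimes> y \<otimes> u\<close> from \<open>\<L> \<diamondop>\<^sub>B P\<close> to \<open>T1\<close> and to \<open>T2\<close>.\<close>

definition attach_bten :: "'l \<Rightarrow> (('l \<times> 'p) \<Rightarrow>\<^sub>0 int) set \<Rightarrow> (('u \<times> 'p) \<Rightarrow>\<^sub>0 int) set" where
  "attach_bten z W = tsum T1 W (\<lambda>(y, u). X.elt (pure self.E (z, y)) u)"

definition attach_dia :: "'l \<Rightarrow> (('l \<times> 'p) \<Rightarrow>\<^sub>0 int) set \<Rightarrow> (('u \<times> 'p) \<Rightarrow>\<^sub>0 int) set" where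
  "attach_dia x W = tsum T2 W (\<lambda>(y, p). Y.elt (pure self.D (x, y)) p)"

lemma attach_bten_bilinear:
  "z \<in> carrier L \<Longrightarrow> bilinear L P dia_balance T1 (\<lambda>y u. X.elt (pure self.E (z, y)) u)"
  by (rule D_bilinearI) (simp_all add: X.tensor.comm_group_axioms self.E.pure_add_right X_elt_tgt)

lemma attach_dia_bilinear:
  "x \<in> carrier L \<Longrightarrow> bilinear L P dia_balance T2 (\<lambda>y u. Y.elt (pure self.D (x, y)) u)"
  by (rule D_bilinearI) (simp_all add: Y.tensor.comm_group_axioms self.D.pure_add_right Y_elt_tgt)

lemmas attach_bten_simps [simp] =
  D.tsum_closed[OF attach_bten_bilinear, folded attach_bten_def] D.tsum_mult[OF attach_bten_bilinear, folded attach_bten_def]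
  D.tsum_pure[OF attach_bten_bilinear, folded attach_bten_def]

lemmas attach_dia_simps [simp] =
  D.tsum_closed[OF attach_dia_bilinear, folded attach_dia_def] D.tsum_mult[OF attach_dia_bilinear, folded attach_dia_def]
  D.tsum_pure[OF attach_dia_bilinear, folded attach_dia_def]

lemma attach_bten_add: "W \<in> carrier D \<Longrightarrow> z \<in> carrier L \<Longrightarrow> z' \<in> carrier L \<Longrightarrow>
    attach_bten (z \<oplus>\<^bsub>L\<^esub> z') W = attach_bten z W \<otimes>\<^bsub>T1\<^esub> attach_bten z' W"
  by (induct rule: D.induct) (simp_all add: self.E.pure_add_left X.tensor.m_ac)

lemma attach_bten_src: "W \<in> carrier D \<Longrightarrow> b \<in> carrier B \<Longrightarrow> z \<in> carrier L \<Longrightarrow>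
    attach_bten (s b \<otimes>\<^bsub>L\<^esub> z) W = attach_bten z (rmul_total (s b) W)"
  by (induct rule: D.induct) (simp_all add: self.E_balance)

lemma attach_dia_add: "W \<in> carrier D \<Longrightarrow> x \<in> carrier L \<Longrightarrow> x' \<in> carrier L \<Longrightarrow>
    attach_dia (x \<oplus>\<^bsub>L\<^esub> x') W = attach_dia x W \<otimes>\<^bsub>T2\<^esub> attach_dia x' W"
  by (induct rule: D.induct) (simp_all add: self.D.pure_add_left Y.tensor.m_ac)

lemma attach_dia_tgt: "W \<in> carrier D \<Longrightarrow> b \<in> carrier B \<Longrightarrow> x \<in> carrier L \<Longrightarrow>
    attach_dia (t b \<otimes>\<^bsub>L\<^esub> x) W = attach_dia x (lmul_src b W)"
  by (induct rule: D.induct) (simp_all add: self.D_balance)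

text \<open>The map \<open>id \<otimes> can\<close> with the last leg \<open>q\<close> fixed: \<open>z \<otimes> r \<mapsto> z \<otimes> r\<^sub>(\<^sub>-\<^sub>1\<^sub>) \<otimes> r\<^sub>(\<^sub>0\<^sub>) q\<close>.\<close>

definition coact_bten :: "'p \<Rightarrow> (('l \<times> 'p) \<Rightarrow>\<^sub>0 int) set \<Rightarrow> (('u \<times> 'p) \<Rightarrow>\<^sub>0 int) set" where
  "coact_bten q V = tsum T1 V (\<lambda>(z, r). attach_bten z (rmul_ring q (\<delta> r)))"

lemma coact_bten_bilinear:
  "q \<in> carrier P \<Longrightarrow> bilinear L P bten_balance T1 (\<lambda>z r. attach_bten z (rmul_ring q (\<delta> r)))"
  by (rule E_bilinearI)
    (simp_all add: X.tensor.comm_group_axioms attach_bten_add attach_bten_src \<delta>_right rmul_total_rmul_ring)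

lemmas coact_bten_simps [simp] =
  E.tsum_closed[OF coact_bten_bilinear, folded coact_bten_def] E.tsum_mult[OF coact_bten_bilinear, folded coact_bten_def]
  E.tsum_pure[OF coact_bten_bilinear, folded coact_bten_def]

lemma coact_bten_add: "V \<in> carrier E \<Longrightarrow> q \<in> carrier P \<Longrightarrow> q' \<in> carrier P \<Longrightarrow>
    coact_bten (q \<oplus>\<^bsub>P\<^esub> q') V = coact_bten q V \<otimes>\<^bsub>T1\<^esub> coact_bten q' V"
  by (induct rule: E.induct) (simp_all add: rmul_ring_add X.tensor.m_ac)

lemma coact_bten_coinvariant: "V \<in> carrier E \<Longrightarrow> n \<in> N \<Longrightarrow> q \<in> carrier P \<Longrightarrow>
    coact_bten (n \<otimes>\<^bsub>P\<^esub> q) V = coact_bten q (rmul_bten n V)"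
  by (induct rule: E.induct) (simp_all add: rmul_ring_mult \<delta>_coinvariant)

lemma \<phi>_inv_coinvariant: "x \<in> carrier L \<Longrightarrow> p \<in> carrier P \<Longrightarrow> n \<in> N \<Longrightarrow>
    \<phi>_inv (pure D (x, p \<otimes>\<^bsub>P\<^esub> n)) = rmul_bten n (\<phi>_inv (pure D (x, p)))"
  using \<phi>_inv_rmul_ring[of "pure D (x, p)" n] by simp

lemma can_inv_src: "y \<in> carrier L \<Longrightarrow> p \<in> carrier P \<Longrightarrow> b \<in> carrier B \<Longrightarrow>
    can_inv (pure D (s b \<otimes>\<^bsub>L\<^esub> y, p)) = lmul_sub b (can_inv (pure D (y, p)))"
  using can_inv_lmul_src[of "pure D (y, p)" b] by simp

text \<open>From \<open>x \<otimes> p \<otimes> q\<close>, apply \<open>\<phi>\<inverse>\<close> to \<open>x \<otimes> p\<close> and then \<open>id \<otimes> can\<close>.\<close>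

definition inv_sub :: "'l \<Rightarrow> (('p \<times> 'p) \<Rightarrow>\<^sub>0 int) set \<Rightarrow> (('u \<times> 'p) \<Rightarrow>\<^sub>0 int) set" where
  "inv_sub x V = tsum T1 V (\<lambda>(p, q). coact_bten q (\<phi>_inv (pure D (x, p))))"

lemma inv_sub_bilinear:
  "x \<in> carrier L \<Longrightarrow> bilinear P P sub_balance T1 (\<lambda>p q. coact_bten q (\<phi>_inv (pure D (x, p))))"
  by (rule S_bilinearI) (simp_all add: X.tensor.comm_group_axioms D.pure_add_right coact_bten_add
      coact_bten_coinvariant \<phi>_inv_coinvariant)

lemmas inv_sub_simps [simp] =
  S.tsum_closed[OF inv_sub_bilinear, folded inv_sub_def] S.tsum_mult[OF inv_sub_bilinear, folded inv_sub_def]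
  S.tsum_pure[OF inv_sub_bilinear, folded inv_sub_def]

lemma inv_sub_add: "V \<in> carrier S \<Longrightarrow> x \<in> carrier L \<Longrightarrow> x' \<in> carrier L \<Longrightarrow>
    inv_sub (x \<oplus>\<^bsub>L\<^esub> x') V = inv_sub x V \<otimes>\<^bsub>T1\<^esub> inv_sub x' V"
  by (induct rule: S.induct) (simp_all add: D.pure_add_left X.tensor.m_ac)

lemma inv_sub_tgt: "V \<in> carrier S \<Longrightarrow> b \<in> carrier B \<Longrightarrow> x \<in> carrier L \<Longrightarrow>
    inv_sub (t b \<otimes>\<^bsub>L\<^esub> x) V = inv_sub x (lmul_sub b V)"
  by (induct rule: S.induct) (simp_all add: D_balance)

text \<open>From \<open>x \<otimes> y \<otimes> p\<close>, write \<open>y \<otimes> p\<close> as \<open>can\<close> of an element of \<open>P \<otimes>\<^sub>N P\<close> and continue as above.\<close>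

definition inv_dia :: "'p \<Rightarrow> (('l \<times> 'l) \<Rightarrow>\<^sub>0 int) set \<Rightarrow> (('u \<times> 'p) \<Rightarrow>\<^sub>0 int) set" where
  "inv_dia p U = tsum T1 U (\<lambda>(x, y). inv_sub x (can_inv (pure D (y, p))))"

lemma inv_dia_bilinear:
  "p \<in> carrier P \<Longrightarrow> bilinear L L self.dia_balance T1 (\<lambda>x y. inv_sub x (can_inv (pure D (y, p))))"
  by (rule self.D_bilinearI) (simp_all add: X.tensor.comm_group_axioms D.pure_add_left inv_sub_add
      inv_sub_tgt can_inv_src)

lemmas inv_dia_simps [simp] =
  self.D.tsum_closed[OF inv_dia_bilinear, folded inv_dia_def] self.D.tsum_mult[OF inv_dia_bilinear, folded inv_dia_def]
  self.D.tsum_pure[OF inv_dia_bilinear, folded inv_dia_def]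

lemma inv_dia_add: "U \<in> carrier self.D \<Longrightarrow> p \<in> carrier P \<Longrightarrow> q \<in> carrier P \<Longrightarrow>
    inv_dia (p \<oplus>\<^bsub>P\<^esub> q) U = inv_dia p U \<otimes>\<^bsub>T1\<^esub> inv_dia q U"
  by (induct rule: self.D.induct) (simp_all add: D.pure_add_right X.tensor.m_ac)

lemma inv_dia_tgt_dia: "U \<in> carrier self.D \<Longrightarrow> p \<in> carrier P \<Longrightarrow> b \<in> carrier B \<Longrightarrow>
    inv_dia p (tgt_dia b U) = inv_dia (\<eta> b \<otimes>\<^bsub>P\<^esub> p) U"
  by (induct rule: self.D.induct) (simp_all add: D_balance)

text \<open>The candidate for the inverse of \<open>\<mu> \<otimes> P\<close>.\<close>

definition Mu_inv :: "(('u \<times> 'p) \<Rightarrow>\<^sub>0 int) set \<Rightarrow> (('u \<times> 'p) \<Rightarrow>\<^sub>0 int) set" where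
  "Mu_inv = Y.ext_lift T1 (\<lambda>U p. inv_dia p U)"

lemma Mu_inv_simps [simp]:
  "W \<in> carrier T2 \<Longrightarrow> Mu_inv W \<in> carrier T1"
  "V \<in> carrier T2 \<Longrightarrow> W \<in> carrier T2 \<Longrightarrow> Mu_inv (V \<otimes>\<^bsub>T2\<^esub> W) = Mu_inv V \<otimes>\<^bsub>T1\<^esub> Mu_inv W"
  "U \<in> carrier self.D \<Longrightarrow> p \<in> carrier P \<Longrightarrow> Mu_inv (Y.elt U p) = inv_dia p U"
  unfolding Mu_inv_def
  subgoal by (rule Y.ext_lift_closed) (simp_all add: X.tensor.comm_group_axioms inv_dia_add inv_dia_tgt_dia)
  subgoal by (rule Y.ext_lift_mult) (simp_all add: X.tensor.comm_group_axioms inv_dia_add inv_dia_tgt_dia)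
  subgoal by (rule Y.ext_lift_elt) (simp_all add: X.tensor.comm_group_axioms inv_dia_add inv_dia_tgt_dia)
  done

definition Mu :: "(('u \<times> 'p) \<Rightarrow>\<^sub>0 int) set \<Rightarrow> (('u \<times> 'p) \<Rightarrow>\<^sub>0 int) set" where
  "Mu = X.ext_lift T2 (\<lambda>U. Y.elt (self.\<phi> U))"

lemma Mu_simps [simp]:
  "W \<in> carrier T1 \<Longrightarrow> Mu W \<in> carrier T2"
  "V \<in> carrier T1 \<Longrightarrow> W \<in> carrier T1 \<Longrightarrow> Mu (V \<otimes>\<^bsub>T1\<^esub> W) = Mu V \<otimes>\<^bsub>T2\<^esub> Mu W"
  "U \<in> carrier self.E \<Longrightarrow> p \<in> carrier P \<Longrightarrow> Mu (X.elt U p) = Y.elt (self.\<phi> U) p"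
  unfolding Mu_def
  subgoal by (rule X.ext_lift_closed) (simp_all add: Y.tensor.comm_group_axioms \<phi>_tgt_bten Y_elt_act)
  subgoal by (rule X.ext_lift_mult) (simp_all add: Y.tensor.comm_group_axioms \<phi>_tgt_bten Y_elt_act)
  subgoal by (rule X.ext_lift_elt) (simp_all add: Y.tensor.comm_group_axioms \<phi>_tgt_bten Y_elt_act)
  done

text \<open>The map \<open>id \<otimes> can\<close> from \<open>\<L> \<diamondop>\<^sub>B P\<close> to \<open>T2\<close>, again with the last leg fixed; it is the lower
  right side of the square.\<close>

definition coact_dia :: "'p \<Rightarrow> (('l \<times> 'p) \<Rightarrow>\<^sub>0 int) set \<Rightarrow> (('u \<times> 'p) \<Rightarrow>\<^sub>0 int) set" where
  "coact_dia q U = tsum T2 U (\<lambda>(x, r). attach_dia x (rmul_ring q (\<delta> r)))"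

lemma coact_dia_bilinear:
  "q \<in> carrier P \<Longrightarrow> bilinear L P dia_balance T2 (\<lambda>x r. attach_dia x (rmul_ring q (\<delta> r)))"
  by (rule D_bilinearI)
    (simp_all add: Y.tensor.comm_group_axioms attach_dia_add attach_dia_tgt \<delta>_left lmul_src_rmul_ring)

lemmas coact_dia_simps [simp] =
  D.tsum_closed[OF coact_dia_bilinear, folded coact_dia_def] D.tsum_mult[OF coact_dia_bilinear, folded coact_dia_def]
  D.tsum_pure[OF coact_dia_bilinear, folded coact_dia_def]

end

section \<open>Coassociativity\<close>

context galois_extension
begin

lemma smult_closed:
  "c \<in> carrier (ground H) \<Longrightarrow> x \<in> carrier L \<Longrightarrow> c \<odot>\<^bsub>L\<^esub> x \<in> carrier L"
  "c \<in> carrier (ground H) \<Longrightarrow> p \<in> carrier P \<Longrightarrow> c \<odot>\<^bsub>P\<^esub> p \<in> carrier P"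
  using ground_in_base[of c] by (simp_all add: smult_L(1) smult_P(1))

abbreviation "D3 \<equiv> dia3 H (ring_bimodule P \<eta>)"

definition dia3_balance :: "(('l \<times> 'l \<times> 'p) \<times> ('l \<times> 'l \<times> 'p)) set" where
  "dia3_balance =
     {((t b \<otimes>\<^bsub>L\<^esub> x, y, p), (x, s b \<otimes>\<^bsub>L\<^esub> y, p)) | b x y p.
        b \<in> carrier B \<and> x \<in> carrier L \<and> y \<in> carrier L \<and> p \<in> carrier P} \<union>
     {((x, t b \<otimes>\<^bsub>L\<^esub> y, p), (x, y, \<eta> b \<otimes>\<^bsub>P\<^esub> p)) | b x y p.
        b \<in> carrier B \<and> x \<in> carrier L \<and> y \<in> carrier L \<and> p \<in> carrier P}"

lemma D3_eq: "D3 = tensor3 L L P dia3_balance"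
proof -
  have "bal3 (ground H) L L (ring_bimodule P \<eta>) \<subseteq> dia3_balance"
  proof
    fix w assume "w \<in> bal3 (ground H) L L (ring_bimodule P \<eta>)"
    then consider
      c x y p where "w = ((c \<odot>\<^bsub>L\<^esub> x, y, p), (x, c \<odot>\<^bsub>L\<^esub> y, p))"
        "c \<in> carrier (ground H)" "x \<in> carrier L" "y \<in> carrier L" "p \<in> carrier P"
    | c x y p where "w = ((x, c \<odot>\<^bsub>L\<^esub> y, p), (x, y, c \<odot>\<^bsub>P\<^esub> p))"
        "c \<in> carrier (ground H)" "x \<in> carrier L" "y \<in> carrier L" "p \<in> carrier P"
      by (auto simp: bal3_def)
    then show "w \<in> dia3_balance"
    proof cases
      case (1 c x y p)
      show ?thesis
        unfolding dia3_balance_def 1(1) smult_L(2)[OF 1(2,3)] smult_L(1)[OF 1(2,4)]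
        using 1 ground_in_base[OF 1(2)] by blast
    next
      case (2 c x y p)
      show ?thesis
        unfolding dia3_balance_def 2(1) smult_L(2)[OF 2(2,4)] smult_P(1)[OF 2(2,5)]
        using 2 ground_in_base[OF 2(2)] by blast
    qed
  qed
  then have "bal3 (ground H) L L (ring_bimodule P \<eta>) \<union> dia3_balance = dia3_balance" by blast
  then show ?thesis
    unfolding dia3_def dia3_balance_def by (simp add: tensor3_def Un_assoc)
qed

sublocale D3: triple_tensor_product L L P dia3_balance D3
  by (rule triple_tensor_product.intro)
    (auto simp: D3_eq dia3_balance_def L.abelian_group_axioms P.abelian_group_axioms)

lemma D3_balance:
  "b \<in> carrier B \<Longrightarrow> x \<in> carrier L \<Longrightarrow> y \<in> carrier L \<Longrightarrow> p \<in> carrier P \<Longrightarrow>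
     pure D3 (t b \<otimes>\<^bsub>L\<^esub> x, y, p) = pure D3 (x, s b \<otimes>\<^bsub>L\<^esub> y, p)"
  "b \<in> carrier B \<Longrightarrow> x \<in> carrier L \<Longrightarrow> y \<in> carrier L \<Longrightarrow> p \<in> carrier P \<Longrightarrow>
     pure D3 (x, t b \<otimes>\<^bsub>L\<^esub> y, p) = pure D3 (x, y, \<eta> b \<otimes>\<^bsub>P\<^esub> p)"
  by (rule D3.pure_cong, force simp: dia3_balance_def)+

text \<open>The inner sums of the coassociativity law, as homomorphisms into \<open>\<L> \<diamondop>\<^sub>B \<L> \<diamondop>\<^sub>B P\<close>.\<close>

definition append_ring :: "'p \<Rightarrow> (('l \<times> 'l) \<Rightarrow>\<^sub>0 int) set \<Rightarrow> (('l \<times> 'l \<times> 'p) \<Rightarrow>\<^sub>0 int) set" where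
  "append_ring u W = tsum D3 W (\<lambda>(x, y). pure D3 (x, y, u))"

definition prepend_total :: "'l \<Rightarrow> (('l \<times> 'p) \<Rightarrow>\<^sub>0 int) set \<Rightarrow> (('l \<times> 'l \<times> 'p) \<Rightarrow>\<^sub>0 int) set" where
  "prepend_total x W = tsum D3 W (\<lambda>(y, u). pure D3 (x, y, u))"

lemma append_ring_bilinear:
  "u \<in> carrier P \<Longrightarrow> bilinear L L self.dia_balance D3 (\<lambda>x y. pure D3 (x, y, u))"
  by (rule self.D_bilinearI)
    (simp_all add: D3.comm_group_axioms D3.pure_add1 D3.pure_add2 D3_balance)

lemma prepend_total_bilinear:
  "x \<in> carrier L \<Longrightarrow> bilinear L P dia_balance D3 (\<lambda>y u. pure D3 (x, y, u))"
  by (rule D_bilinearI)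
    (simp_all add: D3.comm_group_axioms D3.pure_add2 D3.pure_add3 D3_balance)

lemmas append_ring_simps [simp] =
  self.D.tsum_closed[OF append_ring_bilinear, folded append_ring_def]
  self.D.tsum_mult[OF append_ring_bilinear, folded append_ring_def]
  self.D.tsum_pure[OF append_ring_bilinear, folded append_ring_def]

lemmas prepend_total_simps [simp] =
  D.tsum_closed[OF prepend_total_bilinear, folded prepend_total_def] D.tsum_mult[OF prepend_total_bilinear, folded prepend_total_def]
  D.tsum_pure[OF prepend_total_bilinear, folded prepend_total_def]

lemma append_ring_add: "W \<in> carrier self.D \<Longrightarrow> u \<in> carrier P \<Longrightarrow> v \<in> carrier P \<Longrightarrow>
    append_ring (u \<oplus>\<^bsub>P\<^esub> v) W = append_ring u W \<otimes>\<^bsub>D3\<^esub> append_ring v W"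
  by (induct rule: self.D.induct) (simp_all add: D3.pure_add3 D3.m_ac)

lemma append_ring_tgt_dia: "W \<in> carrier self.D \<Longrightarrow> u \<in> carrier P \<Longrightarrow> b \<in> carrier B \<Longrightarrow>
    append_ring u (tgt_dia b W) = append_ring (\<eta> b \<otimes>\<^bsub>P\<^esub> u) W"
  by (induct rule: self.D.induct) (simp_all add: D3_balance)

lemma prepend_total_add: "W \<in> carrier D \<Longrightarrow> x \<in> carrier L \<Longrightarrow> y \<in> carrier L \<Longrightarrow>
    prepend_total (x \<oplus>\<^bsub>L\<^esub> y) W = prepend_total x W \<otimes>\<^bsub>D3\<^esub> prepend_total y W"
  by (induct rule: D.induct) (simp_all add: D3.pure_add1 D3.m_ac)

lemma prepend_total_tgt: "W \<in> carrier D \<Longrightarrow> x \<in> carrier L \<Longrightarrow> b \<in> carrier B \<Longrightarrow>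
    prepend_total (t b \<otimes>\<^bsub>L\<^esub> x) W = prepend_total x (lmul_src b W)"
  by (induct rule: D.induct) (simp_all add: D3_balance)

definition cop_left :: "(('l \<times> 'p) \<Rightarrow>\<^sub>0 int) set \<Rightarrow> (('l \<times> 'l \<times> 'p) \<Rightarrow>\<^sub>0 int) set" where
  "cop_left W = tsum D3 W (\<lambda>(x, q). append_ring q (cop H x))"

definition coact_right :: "(('l \<times> 'p) \<Rightarrow>\<^sub>0 int) set \<Rightarrow> (('l \<times> 'l \<times> 'p) \<Rightarrow>\<^sub>0 int) set" where
  "coact_right W = tsum D3 W (\<lambda>(x, q). prepend_total x (\<delta> q))"

lemma cop_left_bilinear: "bilinear L P dia_balance D3 (\<lambda>x q. append_ring q (cop H x))"
  by (rule D_bilinearI) (simp_all add: D3.comm_group_axioms append_ring_add append_ring_tgt_dia cop_tgt_left)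

lemma coact_right_bilinear: "bilinear L P dia_balance D3 (\<lambda>x q. prepend_total x (\<delta> q))"
  by (rule D_bilinearI) (simp_all add: D3.comm_group_axioms prepend_total_add prepend_total_tgt \<delta>_left)

lemmas cop_left_simps [simp] =
  D.tsum_closed[OF cop_left_bilinear, folded cop_left_def] D.tsum_mult[OF cop_left_bilinear, folded cop_left_def]
  D.tsum_pure[OF cop_left_bilinear, folded cop_left_def]

lemmas coact_right_simps [simp] =
  D.tsum_closed[OF coact_right_bilinear, folded coact_right_def]
  D.tsum_mult[OF coact_right_bilinear, folded coact_right_def]
  D.tsum_pure[OF coact_right_bilinear, folded coact_right_def]

lemma coassociative:
  assumes "p \<in> carrier P" shows "cop_left (\<delta> p) = coact_right (\<delta> p)"
proof -
  have c: "left_comodule H (ring_bimodule P \<eta>) \<delta>"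
    using comodule_algebra unfolding left_comodule_algebra_def by (elim conjE) assumption
  have "\<forall>p\<in>carrier (ring_bimodule P \<eta>).
       tsum D3 (\<delta> p) (\<lambda>(x, q). tsum D3 (cop H x) (\<lambda>(x1, x2). pure D3 (x1, x2, q))) =
       tsum D3 (\<delta> p) (\<lambda>(x, q). tsum D3 (\<delta> q) (\<lambda>(y, r). pure D3 (x, y, r)))"
    using c unfolding left_comodule_def by (elim conjE) assumption
  then show ?thesis
    unfolding cop_left_def coact_right_def prepend_total_def append_ring_def using assms by simp
qed

end

section \<open>The Hopf map is bijective\<close>

context embedded_galois_extension
begin

text \<open>Coassociativity is an identity in \<open>\<L> \<diamondop>\<^sub>B \<L> \<diamondop>\<^sub>B P\<close>, whereas the square lives in \<open>T2\<close>. This map carries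
  the former to the latter and at the same time multiplies by \<open>z\<close> on the first leg and by \<open>q\<close> on
  the last one, so that the two sides of coassociativity become the two paths of the square.\<close>

definition act_dia3 :: "'l \<Rightarrow> 'p \<Rightarrow> (('l \<times> 'l \<times> 'p) \<Rightarrow>\<^sub>0 int) set \<Rightarrow> (('u \<times> 'p) \<Rightarrow>\<^sub>0 int) set" where
  "act_dia3 z q W = tsum T2 W (\<lambda>(x, y, u). Y.elt (pure self.D (x \<otimes>\<^bsub>L\<^esub> z, y)) (u \<otimes>\<^bsub>P\<^esub> q))"

lemma act_dia3_trilinear:
  assumes zq: "z \<in> carrier L" "q \<in> carrier P"
  shows "trilinear L L P dia3_balance T2 (\<lambda>x y u. Y.elt (pure self.D (x \<otimes>\<^bsub>L\<^esub> z, y)) (u \<otimes>\<^bsub>P\<^esub> q))"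
    (is "trilinear _ _ _ _ _ ?h")
proof -
  have 1: "?h (t b \<otimes>\<^bsub>L\<^esub> x) y u = ?h x (s b \<otimes>\<^bsub>L\<^esub> y) u"
    if "b \<in> carrier B" "x \<in> carrier L" "y \<in> carrier L" "u \<in> carrier P" for b x y u
    using that zq by (simp add: L.m_assoc self.D_balance)
  have 2: "?h x (t b \<otimes>\<^bsub>L\<^esub> y) u = ?h x y (\<eta> b \<otimes>\<^bsub>P\<^esub> u)"
    if "b \<in> carrier B" "x \<in> carrier L" "y \<in> carrier L" "u \<in> carrier P" for b x y u
    using that zq by (simp add: Y_elt_tgt P.m_assoc)
  show ?thesis
    unfolding trilinear_def
  proof (intro conjI ballI allI impI)
    show "comm_group T2" by (rule Y.tensor.comm_group_axioms)
  next
    fix x y u x' y' u' assume "((x, y, u), (x', y', u')) \<in> dia3_balance"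
    then show "?h x y u = ?h x' y' u'"
      unfolding dia3_balance_def by (elim UnE CollectE exE conjE Pair_inject) (simp_all only: 1 2)
  qed (use zq in \<open>simp_all add: L.l_distr P.l_distr self.D.pure_add_left self.D.pure_add_right\<close>)
qed

lemma act_dia3_simps [simp]:
  assumes zq: "z \<in> carrier L" "q \<in> carrier P"
  shows "W \<in> carrier D3 \<Longrightarrow> act_dia3 z q W \<in> carrier T2"
    and "V \<in> carrier D3 \<Longrightarrow> W \<in> carrier D3 \<Longrightarrow> act_dia3 z q (V \<otimes>\<^bsub>D3\<^esub> W) = act_dia3 z q V \<otimes>\<^bsub>T2\<^esub> act_dia3 z q W"
    and "x \<in> carrier L \<Longrightarrow> y \<in> carrier L \<Longrightarrow> u \<in> carrier P \<Longrightarrow>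
      act_dia3 z q (pure D3 (x, y, u)) = Y.elt (pure self.D (x \<otimes>\<^bsub>L\<^esub> z, y)) (u \<otimes>\<^bsub>P\<^esub> q)"
  unfolding act_dia3_def
  by (rule D3.tsum_closed[OF act_dia3_trilinear[OF zq]] D3.tsum_mult[OF act_dia3_trilinear[OF zq]]
      D3.tsum_pure[OF act_dia3_trilinear[OF zq]]; assumption)+

lemma act_dia3_append_ring: "W \<in> carrier self.D \<Longrightarrow> z \<in> carrier L \<Longrightarrow> q \<in> carrier P \<Longrightarrow> u \<in> carrier P \<Longrightarrow>
    act_dia3 z q (append_ring u W) = Y.elt (self.rmul_total z W) (u \<otimes>\<^bsub>P\<^esub> q)"
  by (induct rule: self.D.induct) simp_all

lemma act_dia3_prepend_total: "W \<in> carrier D \<Longrightarrow> z \<in> carrier L \<Longrightarrow> q \<in> carrier P \<Longrightarrow> x \<in> carrier L \<Longrightarrow>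
    act_dia3 z q (prepend_total x W) = attach_dia (x \<otimes>\<^bsub>L\<^esub> z) (rmul_ring q W)"
  by (induct rule: D.induct) simp_all

lemma act_dia3_cop_left: "W \<in> carrier D \<Longrightarrow> z \<in> carrier L \<Longrightarrow> q \<in> carrier P \<Longrightarrow>
    act_dia3 z q (cop_left W) = Mu (attach_bten z (rmul_ring q W))"
  by (induct rule: D.induct) (simp_all add: act_dia3_append_ring)

lemma act_dia3_coact_right: "W \<in> carrier D \<Longrightarrow> z \<in> carrier L \<Longrightarrow> q \<in> carrier P \<Longrightarrow>
    act_dia3 z q (coact_right W) = coact_dia q (rmul_total z W)"
  by (induct rule: D.induct) (simp_all add: act_dia3_prepend_total)

text \<open>Coassociativity, read in \<open>T2\<close>, is the square on \<open>z \<otimes> p \<otimes> q\<close>; by additivity the square follows on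
  \<open>\<L> \<otimes>\<^sup>B P\<close> with \<open>q\<close> as a parameter.\<close>

lemma Mu_attach_bten: "p \<in> carrier P \<Longrightarrow> z \<in> carrier L \<Longrightarrow> q \<in> carrier P \<Longrightarrow>
    Mu (attach_bten z (rmul_ring q (\<delta> p))) = coact_dia q (rmul_total z (\<delta> p))"
  using act_dia3_cop_left[of "\<delta> p" z q] act_dia3_coact_right[of "\<delta> p" z q] coassociative[of p] by simp

lemma Mu_coact_bten: "V \<in> carrier E \<Longrightarrow> q \<in> carrier P \<Longrightarrow> Mu (coact_bten q V) = coact_dia q (\<phi> V)"
  by (induct rule: E.induct) (simp_all add: Mu_attach_bten)

lemma Mu_inv_sub: "V \<in> carrier S \<Longrightarrow> x \<in> carrier L \<Longrightarrow> Mu (inv_sub x V) = attach_dia x (can V)"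
  by (induct rule: S.induct) (simp_all add: Mu_coact_bten)

lemma Mu_inv_dia: "U \<in> carrier self.D \<Longrightarrow> p \<in> carrier P \<Longrightarrow> Mu (inv_dia p U) = Y.elt U p"
  by (induct rule: self.D.induct) (simp_all add: Mu_inv_sub)

lemma Mu_Mu_inv: "W \<in> carrier T2 \<Longrightarrow> Mu (Mu_inv W) = W"
  by (induct rule: Y.ext_induct) (simp_all add: Mu_inv_dia)

lemma Mu_inv_attach_dia: "W \<in> carrier D \<Longrightarrow> x \<in> carrier L \<Longrightarrow>
    Mu_inv (attach_dia x W) = inv_sub x (can_inv W)"
  by (induct rule: D.induct) simp_all

lemma can_inv_rmul_ring: "r \<in> carrier P \<Longrightarrow> q \<in> carrier P \<Longrightarrow>
    can_inv (rmul_ring q (\<delta> r)) = pure S (r, q)"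
  using can_inv_simps(4)[of "pure S (r, q)"] by simp

lemma \<phi>_inv_rmul_total: "z \<in> carrier L \<Longrightarrow> p \<in> carrier P \<Longrightarrow> \<phi>_inv (rmul_total z (\<delta> p)) = pure E (z, p)"
  using \<phi>_inv_simps(4)[of "pure E (z, p)"] by simp

lemma Mu_inv_coact_dia: "U \<in> carrier D \<Longrightarrow> q \<in> carrier P \<Longrightarrow>
    Mu_inv (coact_dia q U) = coact_bten q (\<phi>_inv U)"
  by (induct rule: D.induct) (simp_all add: Mu_inv_attach_dia can_inv_rmul_ring)

text \<open>The composite \<open>Mu_inv \<circ> Mu\<close> is easy to compute only on elements \<open>z \<otimes> can V\<close>, where the square
  applies; surjectivity of \<open>can\<close> gives the rest.\<close>

lemma Mu_inv_Mu_attach_bten_can: "V \<in> carrier S \<Longrightarrow> z \<in> carrier L \<Longrightarrow>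
    Mu_inv (Mu (attach_bten z (can V))) = attach_bten z (can V)"
  by (induct rule: S.induct) (simp_all add: Mu_attach_bten Mu_inv_coact_dia \<phi>_inv_rmul_total)

lemma Mu_inv_Mu_attach_bten: "W \<in> carrier D \<Longrightarrow> z \<in> carrier L \<Longrightarrow>
    Mu_inv (Mu (attach_bten z W)) = attach_bten z W"
  using Mu_inv_Mu_attach_bten_can[of "can_inv W" z] by simp

lemma Mu_inv_Mu_pure: "z \<in> carrier L \<Longrightarrow> y \<in> carrier L \<Longrightarrow> p \<in> carrier P \<Longrightarrow>
    Mu_inv (Mu (X.elt (pure self.E (z, y)) p)) = X.elt (pure self.E (z, y)) p"
  using Mu_inv_Mu_attach_bten[of "pure D (y, p)" z] by simp

lemma Mu_inv_Mu_elt: "U \<in> carrier self.E \<Longrightarrow> p \<in> carrier P \<Longrightarrow> Mu_inv (Mu (X.elt U p)) = X.elt U p"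
proof (induct rule: self.E.induct)
  case (pure z y)
  then show ?case by (rule Mu_inv_Mu_pure)
next
  case (mult U V)
  then show ?case by (simp only: X_elt_simps Mu_simps(1,2) Mu_inv_simps(1,2))
qed

lemma Mu_inv_Mu: "W \<in> carrier T1 \<Longrightarrow> Mu_inv (Mu W) = W"
  by (induct rule: X.ext_induct) (simp_all add: Mu_inv_Mu_elt del: Mu_simps(3))

lemma Mu_bij: "bij_betw Mu (carrier T1) (carrier T2)"
  by (rule bij_betw_byWitness[where f' = Mu_inv]) (auto simp: Mu_inv_Mu Mu_Mu_inv)

lemma hopf_map_bij:
  assumes "faithfully_flat TYPE('u) B PM"
  shows "bij_betw (hopf_map H) (carrier self.E) (carrier self.D)"
  unfolding hopf_map_eq
  by (rule scalar_extension_detects_bij[OF assms X.scalar_extension_axioms Y.scalar_extension_axioms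
        self.\<phi>_hom \<phi>_tgt_bten Mu_bij[unfolded Mu_def]])

section \<open>The inverse of the Hopf map\<close>

abbreviation "A \<equiv> mixed_tensor H P \<eta>"

definition mixed_balance :: "(('l \<times> 'p \<times> 'l) \<times> ('l \<times> 'p \<times> 'l)) set" where
  "mixed_balance = bal3 (ground H) L P L \<union>
     {((t a \<otimes>\<^bsub>L\<^esub> y, p, z), (y, \<eta> a \<otimes>\<^bsub>P\<^esub> p, z)) | a y p z.
        a \<in> carrier B \<and> y \<in> carrier L \<and> p \<in> carrier P \<and> z \<in> carrier L} \<union>
     {((y \<otimes>\<^bsub>L\<^esub> s b, p, z), (y, p, s b \<otimes>\<^bsub>L\<^esub> z)) | b y p z.
        b \<in> carrier B \<and> y \<in> carrier L \<and> p \<in> carrier P \<and> z \<in> carrier L}"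

sublocale A: triple_tensor_product L P L mixed_balance A
  by (rule triple_tensor_product.intro)
    (auto simp: mixed_tensor_def mixed_balance_def bal3_def smult_closed
      L.abelian_group_axioms P.abelian_group_axioms)

lemma A_balance:
  "a \<in> carrier B \<Longrightarrow> y \<in> carrier L \<Longrightarrow> p \<in> carrier P \<Longrightarrow> z \<in> carrier L \<Longrightarrow>
     pure A (t a \<otimes>\<^bsub>L\<^esub> y, p, z) = pure A (y, \<eta> a \<otimes>\<^bsub>P\<^esub> p, z)"
  "b \<in> carrier B \<Longrightarrow> y \<in> carrier L \<Longrightarrow> p \<in> carrier P \<Longrightarrow> z \<in> carrier L \<Longrightarrow>
     pure A (y \<otimes>\<^bsub>L\<^esub> s b, p, z) = pure A (y, p, s b \<otimes>\<^bsub>L\<^esub> z)"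
  by (rule A.pure_cong, force simp: mixed_balance_def)+

text \<open>The identity of the theorem is stated with the legs in another order; this is the corresponding
  change of order, extended to \<open>T1\<close> by \<open>to_mixed\<close>.\<close>

definition swap_mixed :: "'p \<Rightarrow> (('l \<times> 'l) \<Rightarrow>\<^sub>0 int) set \<Rightarrow> (('l \<times> 'p \<times> 'l) \<Rightarrow>\<^sub>0 int) set" where
  "swap_mixed p U = tsum A U (\<lambda>(z, y). pure A (y, p, z))"

lemma swap_mixed_bilinear:
  "p \<in> carrier P \<Longrightarrow> bilinear L L self.bten_balance A (\<lambda>z y. pure A (y, p, z))"
  by (rule self.E_bilinearI) (simp_all add: A.comm_group_axioms A.pure_add1 A.pure_add3 A_balance)

lemmas swap_mixed_simps [simp] =
  self.E.tsum_closed[OF swap_mixed_bilinear, folded swap_mixed_def]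
  self.E.tsum_mult[OF swap_mixed_bilinear, folded swap_mixed_def]
  self.E.tsum_pure[OF swap_mixed_bilinear, folded swap_mixed_def]

lemma swap_mixed_add: "U \<in> carrier self.E \<Longrightarrow> p \<in> carrier P \<Longrightarrow> q \<in> carrier P \<Longrightarrow>
    swap_mixed (p \<oplus>\<^bsub>P\<^esub> q) U = swap_mixed p U \<otimes>\<^bsub>A\<^esub> swap_mixed q U"
  by (induct rule: self.E.induct) (simp_all add: A.pure_add2 A.m_ac)

lemma swap_mixed_tgt_bten: "U \<in> carrier self.E \<Longrightarrow> p \<in> carrier P \<Longrightarrow> b \<in> carrier B \<Longrightarrow>
    swap_mixed p (tgt_bten b U) = swap_mixed (\<eta> b \<otimes>\<^bsub>P\<^esub> p) U"
  by (induct rule: self.E.induct) (simp_all add: A_balance)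

definition to_mixed :: "(('u \<times> 'p) \<Rightarrow>\<^sub>0 int) set \<Rightarrow> (('l \<times> 'p \<times> 'l) \<Rightarrow>\<^sub>0 int) set" where
  "to_mixed = X.ext_lift A (\<lambda>U p. swap_mixed p U)"

lemma to_mixed_simps [simp]:
  "W \<in> carrier T1 \<Longrightarrow> to_mixed W \<in> carrier A"
  "V \<in> carrier T1 \<Longrightarrow> W \<in> carrier T1 \<Longrightarrow> to_mixed (V \<otimes>\<^bsub>T1\<^esub> W) = to_mixed V \<otimes>\<^bsub>A\<^esub> to_mixed W"
  "U \<in> carrier self.E \<Longrightarrow> p \<in> carrier P \<Longrightarrow> to_mixed (X.elt U p) = swap_mixed p U"
  unfolding to_mixed_def
  subgoal by (rule X.ext_lift_closed) (simp_all add: A.comm_group_axioms swap_mixed_add swap_mixed_tgt_bten)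
  subgoal by (rule X.ext_lift_mult) (simp_all add: A.comm_group_axioms swap_mixed_add swap_mixed_tgt_bten)
  subgoal by (rule X.ext_lift_elt) (simp_all add: A.comm_group_axioms swap_mixed_add swap_mixed_tgt_bten)
  done

lemma to_mixed_hom: "to_mixed \<in> hom T1 A"
  by (rule homI) simp_all

lemma to_mixed_attach_bten:
  assumes "W \<in> carrier D" and zq: "z \<in> carrier L" "q \<in> carrier P"
  shows "to_mixed (attach_bten z (rmul_ring q W)) = tsum A W (\<lambda>(y, u). pure A (y, u \<otimes>\<^bsub>P\<^esub> q, z))"
proof -
  have h: "bilinear L P dia_balance A (\<lambda>y u. pure A (y, u \<otimes>\<^bsub>P\<^esub> q, z))"
    by (rule D_bilinearI)
      (simp_all add: zq A.comm_group_axioms A.pure_add1 A.pure_add2 A_balance P.l_distr P.m_assoc)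
  from assms(1) show ?thesis
    by (induct rule: D.induct) (simp_all add: zq D.tsum_mult[OF h] D.tsum_pure[OF h])
qed

lemma to_mixed_coact_bten:
  assumes V: "V \<in> carrier E" and q: "q \<in> carrier P"
  shows "to_mixed (coact_bten q V) =
    tsum A V (\<lambda>(z, r). tsum A (\<delta> r) (\<lambda>(y, u). pure A (y, u \<otimes>\<^bsub>P\<^esub> q, z)))"
  unfolding coact_bten_def E.tsum_comp_hom[OF coact_bten_bilinear[OF q] to_mixed_hom A.comm_group_axioms V]
  by (rule E.tsum_cong[OF E.bilinear_comp_hom[OF coact_bten_bilinear[OF q] to_mixed_hom A.comm_group_axioms] V])
    (simp add: to_mixed_attach_bten q)

lemma to_mixed_inv_sub:
  assumes V: "V \<in> carrier S" and x: "x \<in> carrier L"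
  shows "to_mixed (inv_sub x V) =
    tsum A V (\<lambda>(p, q). tsum A (\<phi>_inv (pure D (x, p))) (\<lambda>(z, r).
      tsum A (\<delta> r) (\<lambda>(y, u). pure A (y, u \<otimes>\<^bsub>P\<^esub> q, z))))"
  unfolding inv_sub_def S.tsum_comp_hom[OF inv_sub_bilinear[OF x] to_mixed_hom A.comm_group_axioms V]
  by (rule S.tsum_cong[OF S.bilinear_comp_hom[OF inv_sub_bilinear[OF x] to_mixed_hom A.comm_group_axioms] V])
    (simp add: to_mixed_coact_bten x)

text \<open>By definition \<open>\<mu> \<otimes> P\<close> sends \<open>X\<^sub>[\<^sub>-\<^sub>] \<otimes> X\<^sub>[\<^sub>+\<^sub>] \<otimes> 1\<close> to \<open>1 \<otimes> X \<otimes> 1\<close>. Applying \<open>Mu_inv\<close> to the latter evaluates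
  \<open>can\<inverse>(X \<otimes> 1)\<close>, the translation map, and then \<open>\<phi>\<inverse>\<close> at \<open>1 \<otimes> X\<^sup><\<^sup>1\<^sup>>\<close>.\<close>

lemma hopf_inv_formula:
  assumes ff: "faithfully_flat TYPE('u) B PM" and x: "x \<in> carrier L"
  shows "tsum A (hopf_inv H x) (\<lambda>(xm, xp). pure A (xp, \<one>\<^bsub>P\<^esub>, xm)) =
       tsum A (translation H P \<eta> \<delta> x) (\<lambda>(p, q).
         tsum A (skew_inv H (ring_bimodule P \<eta>) \<delta> p) (\<lambda>(z, r).
           tsum A (\<delta> r) (\<lambda>(y, u). pure A (y, u \<otimes>\<^bsub>P\<^esub> q, z))))"
proof -
  let ?V = "hopf_inv H x"
  note bij = hopf_map_bij[OF ff]
  have V_eq: "?V = inv_into (carrier self.E) (hopf_map H) (pure self.D (\<one>\<^bsub>L\<^esub>, x))"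
    unfolding hopf_inv_def self_eq ..
  have d: "pure self.D (\<one>\<^bsub>L\<^esub>, x) \<in> carrier self.D" using x by simp
  have V: "?V \<in> carrier self.E"
    unfolding V_eq using inv_into_into[of _ "hopf_map H" "carrier self.E"] d bij
    by (simp add: bij_betw_def)
  have \<mu>V: "self.\<phi> ?V = pure self.D (\<one>\<^bsub>L\<^esub>, x)"
    unfolding V_eq hopf_map_eq[symmetric]
    using f_inv_into_f[of _ "hopf_map H" "carrier self.E"] d bij by (simp add: bij_betw_def)
  have "X.elt ?V \<one>\<^bsub>P\<^esub> = Mu_inv (Mu (X.elt ?V \<one>\<^bsub>P\<^esub>))"
    by (rule Mu_inv_Mu_elt[OF V P.one_closed, symmetric])
  also have "\<dots> = inv_sub \<one>\<^bsub>L\<^esub> (can_inv (pure D (x, \<one>\<^bsub>P\<^esub>)))"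
    using V x by (simp add: \<mu>V)
  finally have "to_mixed (X.elt ?V \<one>\<^bsub>P\<^esub>) = to_mixed (inv_sub \<one>\<^bsub>L\<^esub> (can_inv (pure D (x, \<one>\<^bsub>P\<^esub>))))"
    by (rule arg_cong)
  then have "swap_mixed \<one>\<^bsub>P\<^esub> ?V = to_mixed (inv_sub \<one>\<^bsub>L\<^esub> (can_inv (pure D (x, \<one>\<^bsub>P\<^esub>))))"
    using V by simp
  then show ?thesis
    using x by (simp add: to_mixed_inv_sub swap_mixed_def translation_def skew_inv_def)
qed

end

section \<open>Bialgebroids with a skew regular Galois extension are anti-left Hopf\<close>

lemma galois_extensionI:
  assumes H: "left_bialgebroid H" and galois: "left_galois H P \<eta> \<delta>"
    and skew: "skew_regular H (ring_bimodule P \<eta>) \<delta>"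
  shows "galois_extension H P \<eta> \<delta>"
proof -
  have ca: "left_comodule_algebra H P \<eta> \<delta>"
    using galois by (simp add: left_galois_def)
  have P: "k_algebra (ground H) P" and \<eta>: "\<eta> \<in> k_alg_hom (ground H) (base H) P"
    and c: "left_comodule H (ring_bimodule P \<eta>) \<delta>"
    using ca by (simp_all add: left_comodule_algebra_def)
  interpret bialg_ring H P \<eta>
    by unfold_locales (fact H P \<eta>)+
  have hom: "\<delta> \<in> hom (add_monoid (ring_bimodule P \<eta>)) D"
    and tak: "\<forall>p\<in>carrier (ring_bimodule P \<eta>). \<delta> p \<in> takeuchi H (ring_bimodule P \<eta>)"
    and bim: "\<forall>b\<in>carrier B. \<forall>b'\<in>carrier B. \<forall>p\<in>carrier (ring_bimodule P \<eta>).
       \<delta> (ract (ring_bimodule P \<eta>) (lact (ring_bimodule P \<eta>) b p) b') =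
       tsum D (\<delta> p) (\<lambda>(x, q). pure D (s b \<otimes>\<^bsub>L\<^esub> x \<otimes>\<^bsub>L\<^esub> s b', q))"
    using c unfolding left_comodule_def by - (elim conjE, assumption)+
  have cl: "\<delta> p \<in> carrier D" if "p \<in> carrier P" for p
    using tak that takeuchi_closed by simp
  have bim': "\<delta> (\<eta> b \<otimes>\<^bsub>P\<^esub> p \<otimes>\<^bsub>P\<^esub> \<eta> b') = rmul_total (s b') (lmul_src b (\<delta> p))"
    if "b \<in> carrier B" "b' \<in> carrier B" "p \<in> carrier P" for b b' p
    using bspec[OF bspec[OF bspec[OF bim that(1)] that(2)], of p] that
    by (simp add: bimodule_pure cl)
  show ?thesis
  proof unfold_locales
    show "\<delta> \<in> hom (add_monoid P) D" using hom by (simp add: hom_def)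
    show "\<delta> p \<in> takeuchi H (ring_bimodule P \<eta>)" if "p \<in> carrier P" for p
      using tak that by simp
    show "\<delta> (\<eta> b \<otimes>\<^bsub>P\<^esub> p) = lmul_src b (\<delta> p)" if "b \<in> carrier B" "p \<in> carrier P" for b p
      using bim'[OF that(1) B.one_closed that(2)] that by (simp add: cl)
    show "\<delta> (p \<otimes>\<^bsub>P\<^esub> \<eta> b) = rmul_total (s b) (\<delta> p)" if "b \<in> carrier B" "p \<in> carrier P" for b p
      using bim'[OF B.one_closed that] that by (simp add: cl)
  qed (fact galois skew)+
qed

theorem lemma3p13:
  fixes H :: "('k, 'b, 'l) bialgebroid"
    and P :: "('k, 'p) module"
    and \<eta> :: "'b \<Rightarrow> 'p"
    and \<delta> :: "'p \<Rightarrow> (('l \<times> 'p) \<Rightarrow>\<^sub>0 int) set"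
  assumes "left_bialgebroid H"
    and "flat_bialgebroid TYPE(('b, 'p, 'l) universe) H"
    and "left_galois H P \<eta> \<delta>"
    and "flat_bimodule TYPE(('b, 'p, 'l) universe) (base H) (ring_bimodule P \<eta>)"
    and "flat_extension TYPE(('b, 'p, 'l) universe) H P \<eta> \<delta>"
    and "skew_regular H (ring_bimodule P \<eta>) \<delta>"
  shows "anti_left_hopf H \<and>
    (\<forall>x\<in>carrier (total H).
       tsum (mixed_tensor H P \<eta>) (hopf_inv H x) (\<lambda>(xm, xp).
         pure (mixed_tensor H P \<eta>) (xp, \<one>\<^bsub>P\<^esub>, xm)) =
       tsum (mixed_tensor H P \<eta>) (translation H P \<eta> \<delta> x) (\<lambda>(p, q).
         tsum (mixed_tensor H P \<eta>) (skew_inv H (ring_bimodule P \<eta>) \<delta> p) (\<lambda>(z, r).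
           tsum (mixed_tensor H P \<eta>) (\<delta> r) (\<lambda>(y, u).
             pure (mixed_tensor H P \<eta>) (y, u \<otimes>\<^bsub>P\<^esub> q, z)))))"
proof -
  let ?e = "\<lambda>U. Inr (Inr U) :: ('b, 'p, 'l) universe"
  interpret galois_extension H P \<eta> \<delta>
    by (rule galois_extensionI[OF assms(1,3,6)])
  interpret embedded_galois_extension H P \<eta> \<delta> ?e
    by unfold_locales (simp add: inj_def)
  have ff: "faithfully_flat TYPE(('b, 'p, 'l) universe) B PM"
    using assms(4) unfolding flat_bimodule_def by (rule conjunct1)
  show ?thesis
    unfolding anti_left_hopf_def self_eq
    using assms(1) hopf_map_bij[OF ff] hopf_inv_formula[OF ff] by blast
qed

end
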